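(* Let $q\neq1$ be a positive real number, $r,n$ positive integers, and $u_1,\ldots,u_r\in\mathbb{C}^*$. If the cyclotomic Hecke algebra $H_{r,1,n}(u_1,u_2,\ldots,u_r;q)$ is semisimple, then its simple modules (up to isomorphism) are the modules $\tilde H^{(c,\lambda)}$ described in the context, where $\lambda=(\lambda^{(1)},\ldots,\lambda^{(r)})$ runs over the $r$-tuples of partitions with a total of $n$ boxes and $c$ is the content function determined by $$q^{2c(b)}=u_i,\quad\text{if } b \text{ is the northwest corner box of } \lambda^{(i)}.$$
   Context: $H_{r,1,n}(u_1,\ldots,u_r;q)$ is the unital associative $\mathbb{C}$-algebra with generators $T_1,\ldots,T_n$ and relations: $T_iT_j=T_jT_i$ if $|i-j|>1$; $T_iT_{i+1}T_i=T_{i+1}T_iT_{i+1}$ for $2\le i\le n-1$; $T_1T_2T_1T_2=T_2T_1T_2T_1$; $(T_1-u_1)\cdots(T_1-u_r)=0$; $(T_i-q)(T_i+q^{-1})=0$ for $2\le i\le n$. Let $\alpha=2\pi/\ln(q^2)$; the map $x\mapsto q^{2x}=e^{\ln(q^2)x}$ is a bijection $\mathbb{R}+i(\mathbb{R}/\alpha\mathbb{Z})\to\mathbb{C}^*$. Partitions are drawn as diagrams of boxes in the upper left corner, rows and columns numbered as for matrices. The content function $c$ on the boxes of $\lambda=(\lambda^{(1)},\ldots,\lambda^{(r)})$ takes values in $\mathbb{R}+i(\mathbb{R}/\alpha\mathbb{Z})$, and increases by $1$ when moving one box to the right and decreases by $1$ when moving one box down; so for the box $b$ in row $x$ and column $y$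 of $\lambda^{(i)}$ one has $q^{2c(b)}=u_iq^{2(y-x)}$. A standard tableau $L$ of shape $\lambda$ is a filling of all the boxes of $\lambda^{(1)},\ldots,\lambda^{(r)}$ with $1,\ldots,n$, each used once, increasing left to right in rows and top to bottom in columns of each $\lambda^{(i)}$; $L(i)$ denotes the box containing $i$. $\tilde H^{(c,\lambda)}$ is the vector space with basis $\{v_L\}$, $L$ ranging over standard tableaux of shape $\lambda$, with $H_{r,1,n}(u_1,\ldots,u_r;q)$-action $$T_1v_L=q^{2c(L(1))}v_L,\qquad T_iv_L=(T_i)_{LL}v_L+(q^{-1}+(T_i)_{LL})v_{s_iL},\quad 2\le i\le n,$$ where $(T_i)_{LL}=\dfrac{q-q^{-1}}{1-q^{2(c(L(i-1))-c(L(i)))}}$, $s_iL$ is $L$ with the entries $i-1$ and $i$ interchanged, and $v_{s_iL}=0$ if $s_iL$ is not a standard tableau. *)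

theory Defs
  imports Complex_Main "HOL-Algebra.QuotRing" "HOL-Algebra.Module" "HOL-Combinatorics.Transposition"
begin

section \<open>Left modules over a not necessarily commutative ring\<close>

text \<open>The axioms of \<^locale>\<open>Module.module\<close>, except that the scalars only form a
  \<^locale>\<open>Ring.ring\<close>. As there, the ring multiplication and unit of the record \<open>M\<close> are ignored.\<close>

locale left_module = R?: ring R + M?: abelian_group M for R (structure) and M (structure) +
  assumes smult_closed [simp, intro]:
      "\<lbrakk>a \<in> carrier R; x \<in> carrier M\<rbrakk> \<Longrightarrow> a \<odot>\<^bsub>M\<^esub> x \<in> carrier M"
    and smult_l_distr:
      "\<lbrakk>a \<in> carrier R; b \<in> carrier R; x \<in> carrier M\<rbrakk> \<Longrightarrow>
        (a \<oplus>\<^bsub>R\<^esub> b) \<odot>\<^bsub>M\<^esub> x = a \<odot>\<^bsub>M\<^esub> x \<oplus>\<^bsub>M\<^esub> b \<odot>\<^bsub>M\<^esub> x"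
    and smult_r_distr:
      "\<lbrakk>a \<in> carrier R; x \<in> carrier M; y \<in> carrier M\<rbrakk> \<Longrightarrow>
        a \<odot>\<^bsub>M\<^esub> (x \<oplus>\<^bsub>M\<^esub> y) = a \<odot>\<^bsub>M\<^esub> x \<oplus>\<^bsub>M\<^esub> a \<odot>\<^bsub>M\<^esub> y"
    and smult_assoc1:
      "\<lbrakk>a \<in> carrier R; b \<in> carrier R; x \<in> carrier M\<rbrakk> \<Longrightarrow>
        (a \<otimes>\<^bsub>R\<^esub> b) \<odot>\<^bsub>M\<^esub> x = a \<odot>\<^bsub>M\<^esub> (b \<odot>\<^bsub>M\<^esub> x)"
    and smult_one [simp]:
      "x \<in> carrier M \<Longrightarrow> \<one>\<^bsub>R\<^esub> \<odot>\<^bsub>M\<^esub> x = x"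

definition simple_left_module :: "('a, 'k) ring_scheme \<Rightarrow> ('a, 'b, 'm) module_scheme \<Rightarrow> bool" where
  "simple_left_module R M \<longleftrightarrow>
     left_module R M \<and> carrier M \<noteq> {\<zero>\<^bsub>M\<^esub>} \<and>
     (\<forall>N. submodule N R M \<longrightarrow> N = {\<zero>\<^bsub>M\<^esub>} \<or> N = carrier M)"

definition left_module_iso ::
    "('a, 'k) ring_scheme \<Rightarrow> ('a, 'b, 'm) module_scheme \<Rightarrow> ('a, 'c, 'n) module_scheme \<Rightarrow> bool" where
  "left_module_iso R M N \<longleftrightarrow>
     (\<exists>\<phi>. bij_betw \<phi> (carrier M) (carrier N) \<and>
          (\<forall>x\<in>carrier M. \<forall>y\<in>carrier M. \<phi> (x \<oplus>\<^bsub>M\<^esub> y) = \<phi> x \<oplus>\<^bsub>N\<^esub> \<phi> y) \<and>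
          (\<forall>a\<in>carrier R. \<forall>x\<in>carrier M. \<phi> (a \<odot>\<^bsub>M\<^esub> x) = a \<odot>\<^bsub>N\<^esub> \<phi> x))"

definition internal_direct_sum :: "('a, 'b, 'm) module_scheme \<Rightarrow> 'b set set \<Rightarrow> bool" where
  "internal_direct_sum M S \<longleftrightarrow>
     (\<forall>x\<in>carrier M. \<exists>F f. finite F \<and> F \<subseteq> S \<and> (\<forall>N\<in>F. f N \<in> N) \<and> x = finsum M f F) \<and>
     (\<forall>F f. finite F \<and> F \<subseteq> S \<and> (\<forall>N\<in>F. f N \<in> N) \<and> finsum M f F = \<zero>\<^bsub>M\<^esub>
              \<longrightarrow> (\<forall>N\<in>F. f N = \<zero>\<^bsub>M\<^esub>))"

definition semisimple_left_module :: "('a, 'k) ring_scheme \<Rightarrow> ('a, 'b, 'm) module_scheme \<Rightarrow> bool" where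
  "semisimple_left_module R M \<longleftrightarrow>
     left_module R M \<and>
     (\<exists>S. (\<forall>N\<in>S. submodule N R M \<and> simple_left_module R (M\<lparr>carrier := N\<rparr>)) \<and>
          internal_direct_sum M S)"

definition regular_module :: "('a, 'k) ring_scheme \<Rightarrow> ('a, 'a) module" where
  "regular_module R =
     \<lparr>carrier = carrier R, mult = mult R, one = one R, zero = zero R, add = add R, smult = mult R\<rparr>"

definition semisimple_ring :: "('a, 'k) ring_scheme \<Rightarrow> bool" where
  "semisimple_ring R \<longleftrightarrow> semisimple_left_module R (regular_module R)"

section \<open>The cyclotomic Hecke algebra\<close>

text \<open>The free unital associative complex algebra on \<open>T\<^sub>1, \<dots>, T\<^sub>n\<close>: finitely supported
  functions on the words over \<open>{1..n}\<close>, multiplied by convolution along concatenation.\<close>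

definition free_algebra :: "nat \<Rightarrow> (nat list \<Rightarrow> complex) ring" where
  "free_algebra n =
     \<lparr>carrier = {a. finite {w. a w \<noteq> 0} \<and> (\<forall>w. a w \<noteq> 0 \<longrightarrow> set w \<subseteq> {1..n})},
      mult = (\<lambda>a b w. \<Sum>k\<le>length w. a (take k w) * b (drop k w)),
      one = (\<lambda>w. if w = [] then 1 else 0),
      zero = (\<lambda>w. 0),
      add = (\<lambda>a b w. a w + b w)\<rparr>"

definition scal :: "complex \<Rightarrow> nat list \<Rightarrow> complex" where
  "scal z = (\<lambda>w. if w = [] then z else 0)"

definition gen :: "nat \<Rightarrow> nat list \<Rightarrow> complex" where
  "gen i = (\<lambda>w. if w = [i] then 1 else 0)"

text \<open>The parameters \<open>u\<^sub>1, \<dots>, u\<^sub>r\<close> are given as a list \<open>us\<close> of length \<open>r\<close>, so that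
  \<open>u\<^sub>i = us ! (i - 1)\<close>. A relation \<open>x = y\<close> is encoded by the element \<open>x - y\<close>.\<close>

definition cyclotomic_poly :: "nat \<Rightarrow> complex list \<Rightarrow> nat list \<Rightarrow> complex" where
  "cyclotomic_poly n us =
     foldr (\<lambda>z p. (gen 1 \<ominus>\<^bsub>free_algebra n\<^esub> scal z) \<otimes>\<^bsub>free_algebra n\<^esub> p) us \<one>\<^bsub>free_algebra n\<^esub>"

definition hecke_relations :: "nat \<Rightarrow> complex list \<Rightarrow> complex \<Rightarrow> (nat list \<Rightarrow> complex) set" where
  "hecke_relations n us q = (let A = free_algebra n; T = gen in
      {T i \<otimes>\<^bsub>A\<^esub> T j \<ominus>\<^bsub>A\<^esub> T j \<otimes>\<^bsub>A\<^esub> T i | i j.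
          i \<in> {1..n} \<and> j \<in> {1..n} \<and> \<bar>int i - int j\<bar> > 1}
    \<union> {T i \<otimes>\<^bsub>A\<^esub> T (i + 1) \<otimes>\<^bsub>A\<^esub> T i \<ominus>\<^bsub>A\<^esub> T (i + 1) \<otimes>\<^bsub>A\<^esub> T i \<otimes>\<^bsub>A\<^esub> T (i + 1) | i.
          2 \<le> i \<and> i + 1 \<le> n}
    \<union> (if 2 \<le> n then {T 1 \<otimes>\<^bsub>A\<^esub> T 2 \<otimes>\<^bsub>A\<^esub> T 1 \<otimes>\<^bsub>A\<^esub> T 2 \<ominus>\<^bsub>A\<^esub> T 2 \<otimes>\<^bsub>A\<^esub> T 1 \<otimes>\<^bsub>A\<^esub> T 2 \<otimes>\<^bsub>A\<^esub> T 1} else {})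
    \<union> {cyclotomic_poly n us}
    \<union> {(T i \<ominus>\<^bsub>A\<^esub> scal q) \<otimes>\<^bsub>A\<^esub> (T i \<oplus>\<^bsub>A\<^esub> scal (inverse q)) | i. 2 \<le> i \<and> i \<le> n})"

definition hecke_ideal :: "nat \<Rightarrow> complex list \<Rightarrow> complex \<Rightarrow> (nat list \<Rightarrow> complex) set" where
  "hecke_ideal n us q = Idl\<^bsub>free_algebra n\<^esub> (hecke_relations n us q)"

definition hecke :: "nat \<Rightarrow> complex list \<Rightarrow> complex \<Rightarrow> (nat list \<Rightarrow> complex) set ring" where
  "hecke n us q = free_algebra n Quot hecke_ideal n us q"

definition hecke_class :: "nat \<Rightarrow> complex list \<Rightarrow> complex \<Rightarrow> (nat list \<Rightarrow> complex) \<Rightarrow> (nat list \<Rightarrow> complex) set" where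
  "hecke_class n us q a = hecke_ideal n us q +>\<^bsub>free_algebra n\<^esub> a"

section \<open>Multipartitions, contents and standard tableaux\<close>

text \<open>A partition is the list of its row lengths, a multipartition a list of partitions.
  The box \<open>(i, x, y)\<close> lies in row \<open>x\<close> and column \<open>y\<close> of component \<open>i\<close>, all three counted
  from 0; contents only see the difference \<open>y - x\<close>.\<close>

definition is_partition :: "nat list \<Rightarrow> bool" where
  "is_partition p \<longleftrightarrow> sorted_wrt (\<ge>) p \<and> 0 \<notin> set p"

definition multipartitions :: "nat \<Rightarrow> nat \<Rightarrow> nat list list set" where
  "multipartitions r n =
     {lam. length lam = r \<and> (\<forall>p\<in>set lam. is_partition p) \<and> sum_list (map sum_list lam) = n}"

type_synonym diagram_box = "nat \<times> nat \<times> nat"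

definition boxes :: "nat list list \<Rightarrow> diagram_box set" where
  "boxes lam = {(i, x, y). i < length lam \<and> x < length (lam ! i) \<and> y < lam ! i ! x}"

definition q2pow :: "real \<Rightarrow> complex \<Rightarrow> complex" where
  "q2pow q z = exp (complex_of_real (ln (q ^ 2)) * z)"

text \<open>Contents live in \<open>\<real> + \<i>(\<real>/\<alpha>\<int>)\<close> with \<open>\<alpha> = 2\<pi> / ln (q\<^sup>2)\<close>; they are represented by
  complex numbers, compared by the following congruence.\<close>

definition content_cong :: "real \<Rightarrow> complex \<Rightarrow> complex \<Rightarrow> bool" where
  "content_cong q z w \<longleftrightarrow>
     (\<exists>k::int. z = w + \<i> * complex_of_real (2 * pi / ln (q ^ 2)) * of_int k)"

definition content_function ::
    "real \<Rightarrow> complex list \<Rightarrow> nat list list \<Rightarrow> (diagram_box \<Rightarrow> complex) \<Rightarrow> bool" where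
  "content_function q us lam c \<longleftrightarrow>
     (\<forall>i x y. (i, x, Suc y) \<in> boxes lam \<longrightarrow> content_cong q (c (i, x, Suc y)) (c (i, x, y) + 1)) \<and>
     (\<forall>i x y. (i, Suc x, y) \<in> boxes lam \<longrightarrow> content_cong q (c (i, Suc x, y)) (c (i, x, y) - 1)) \<and>
     (\<forall>i. (i, 0, 0) \<in> boxes lam \<longrightarrow> q2pow q (c (i, 0, 0)) = us ! i)"

text \<open>A tableau is given by the map sending an entry \<open>k\<close> to the box \<open>L k\<close> containing it,
  with the value \<^term>\<open>undefined\<close> outside \<open>{1..n}\<close>.\<close>

type_synonym tableau = "nat \<Rightarrow> diagram_box"

definition standard_tableaux :: "nat \<Rightarrow> nat list list \<Rightarrow> tableau set" where
  "standard_tableaux n lam =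
     {L \<in> extensional {1..n}. bij_betw L {1..n} (boxes lam) \<and>
        (\<forall>k\<in>{1..n}. \<forall>l\<in>{1..n}. \<forall>i x y y'. L k = (i, x, y) \<and> L l = (i, x, y') \<and> y < y' \<longrightarrow> k < l) \<and>
        (\<forall>k\<in>{1..n}. \<forall>l\<in>{1..n}. \<forall>i x x' y. L k = (i, x, y) \<and> L l = (i, x', y) \<and> x < x' \<longrightarrow> k < l)}"

definition swap_entries :: "nat \<Rightarrow> tableau \<Rightarrow> tableau" where
  "swap_entries i L = L \<circ> transpose (i - 1) i"

section \<open>The modules attached to multipartitions\<close>

type_synonym tab_vec = "tableau \<Rightarrow> complex"

text \<open>The basis vector \<open>v\<^sub>L\<close>, which is 0 if \<open>L\<close> is not standard.\<close>

definition basis_vec :: "nat \<Rightarrow> nat list list \<Rightarrow> tableau \<Rightarrow> tab_vec" where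
  "basis_vec n lam L = (\<lambda>M. if M = L \<and> L \<in> standard_tableaux n lam then 1 else 0)"

definition diag_coeff :: "real \<Rightarrow> (diagram_box \<Rightarrow> complex) \<Rightarrow> nat \<Rightarrow> tableau \<Rightarrow> complex" where
  "diag_coeff q c i L = complex_of_real (q - inverse q) / (1 - q2pow q (c (L (i - 1)) - c (L i)))"

definition gen_on_basis ::
    "real \<Rightarrow> nat \<Rightarrow> (diagram_box \<Rightarrow> complex) \<Rightarrow> nat list list \<Rightarrow> nat \<Rightarrow> tableau \<Rightarrow> tab_vec" where
  "gen_on_basis q n c lam i L =
     (if i = 1 then (\<lambda>M. q2pow q (c (L 1)) * basis_vec n lam L M)
      else (\<lambda>M. diag_coeff q c i L * basis_vec n lam L M
              + (complex_of_real (inverse q) + diag_coeff q c i L)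
                  * basis_vec n lam (swap_entries i L) M))"

definition gen_op ::
    "real \<Rightarrow> nat \<Rightarrow> (diagram_box \<Rightarrow> complex) \<Rightarrow> nat list list \<Rightarrow> nat \<Rightarrow> tab_vec \<Rightarrow> tab_vec" where
  "gen_op q n c lam i f = (\<lambda>M. \<Sum>L\<in>standard_tableaux n lam. f L * gen_on_basis q n c lam i L M)"

definition free_act ::
    "real \<Rightarrow> nat \<Rightarrow> (diagram_box \<Rightarrow> complex) \<Rightarrow> nat list list \<Rightarrow> (nat list \<Rightarrow> complex) \<Rightarrow> tab_vec \<Rightarrow> tab_vec" where
  "free_act q n c lam a f = (\<lambda>M. \<Sum>w | a w \<noteq> 0. a w * foldr (gen_op q n c lam) w f M)"

text \<open>A class in the Hecke algebra acts by the common value of the actions of its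
  representatives in the free algebra. That this value exists, i.e. that the formulas for the
  generators respect the relations, is not built in: it has to be asserted separately.\<close>

definition H_tilde ::
    "real \<Rightarrow> nat \<Rightarrow> (diagram_box \<Rightarrow> complex) \<Rightarrow> nat list list \<Rightarrow> ((nat list \<Rightarrow> complex) set, tab_vec) module" where
  "H_tilde q n c lam =
     \<lparr>carrier = {f. \<forall>L. L \<notin> standard_tableaux n lam \<longrightarrow> f L = 0},
      mult = undefined, one = undefined,
      zero = (\<lambda>L. 0),
      add = (\<lambda>f g L. f L + g L),
      smult = (\<lambda>X f. the_elem ((\<lambda>a. free_act q n c lam a f) ` X))\<rparr>"

section \<open>Consistency of the definitions\<close>

lemma free_algebra_mult_closed:
  assumes "a \<in> carrier (free_algebra n)" "b \<in> carrier (free_algebra n)"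
  shows "a \<otimes>\<^bsub>free_algebra n\<^esub> b \<in> carrier (free_algebra n)"
proof -
  let ?c = "\<lambda>w. \<Sum>k\<le>length w. a (take k w) * b (drop k w)"
  have fin: "finite {w. a w \<noteq> 0}" "finite {w. b w \<noteq> 0}"
    and sub: "\<And>w. a w \<noteq> 0 \<Longrightarrow> set w \<subseteq> {1..n}" "\<And>w. b w \<noteq> 0 \<Longrightarrow> set w \<subseteq> {1..n}"
    using assms by (auto simp: free_algebra_def)
  have ex: "\<exists>k. a (take k w) \<noteq> 0 \<and> b (drop k w) \<noteq> 0" if "?c w \<noteq> 0" for w
  proof (rule ccontr)
    assume "\<not> ?thesis"
    then have "?c w = 0" by (intro sum.neutral) auto
    with that show False by simp
  qed
  have "{w. ?c w \<noteq> 0} \<subseteq> (\<lambda>(v, w). v @ w) ` ({w. a w \<noteq> 0} \<times> {w. b w \<noteq> 0})"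
  proof
    fix w assume "w \<in> {w. ?c w \<noteq> 0}"
    then obtain k where "a (take k w) \<noteq> 0" "b (drop k w) \<noteq> 0" using ex by blast
    then show "w \<in> (\<lambda>(v, w). v @ w) ` ({w. a w \<noteq> 0} \<times> {w. b w \<noteq> 0})"
      by (intro image_eqI[of _ _ "(take k w, drop k w)"]) auto
  qed
  then have "finite {w. ?c w \<noteq> 0}" using fin finite_subset by blast
  moreover have "set w \<subseteq> {1..n}" if w: "?c w \<noteq> 0" for w
  proof -
    obtain k where k: "a (take k w) \<noteq> 0" "b (drop k w) \<noteq> 0" using ex[OF w] by blast
    have "set w = set (take k w) \<union> set (drop k w)"
      by (metis append_take_drop_id set_append)
    then show ?thesis using sub k by blast
  qed
  ultimately show ?thesis by (auto simp: free_algebra_def)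
qed

lemma free_algebra_mult_assoc:
  "(\<Sum>k\<le>length w. (\<Sum>j\<le>length (take k w). a (take j (take k w)) * b (drop j (take k w))) * c (drop k w))
   = (\<Sum>j\<le>length w. a (take j w) * (\<Sum>i\<le>length (drop j w). b (take i (drop j w)) * c (drop i (drop j w))))"
  (is "?l = ?r") for a b c :: "'a list \<Rightarrow> complex"
proof -
  have "?l = (\<Sum>(k, j)\<in>Sigma {..length w} (\<lambda>k. {..k}). a (take j w) * b (drop j (take k w)) * c (drop k w))"
    by (subst sum.Sigma[symmetric]) (auto simp: sum_distrib_right min_def intro!: sum.cong)
  also have "\<dots> = (\<Sum>(j, i)\<in>Sigma {..length w} (\<lambda>j. {..length w - j}).
      a (take j w) * (b (take i (drop j w)) * c (drop i (drop j w))))"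
    by (rule sum.reindex_bij_witness[of _ "\<lambda>(j, i). (i + j, j)" "\<lambda>(k, j). (j, k - j)"])
       (auto simp: take_drop add.commute)
  also have "\<dots> = ?r"
    by (subst sum.Sigma[symmetric]) (auto simp: sum_distrib_left intro!: sum.cong)
  finally show ?thesis .
qed

lemma free_algebra_one_left:
  "(\<Sum>k\<le>length w. (if take k w = [] then 1 else 0) * a (drop k w)) = (a w :: complex)"
proof -
  have "(\<Sum>k\<le>length w. (if take k w = [] then 1 else 0) * a (drop k w))
      = (\<Sum>k\<in>{0::nat}. a w)"
    by (rule sum.mono_neutral_cong_right) auto
  then show ?thesis by simp
qed

lemma free_algebra_one_right:
  "(\<Sum>k\<le>length w. a (take k w) * (if drop k w = [] then 1 else 0)) = (a w :: complex)"
proof -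
  have "(\<Sum>k\<le>length w. a (take k w) * (if drop k w = [] then 1 else 0))
      = (\<Sum>k\<in>{length w}. a w)"
    by (rule sum.mono_neutral_cong_right) auto
  then show ?thesis by simp
qed

lemma ring_free_algebra: "ring (free_algebra n)"
proof (rule ringI)
  show "abelian_group (free_algebra n)"
  proof (rule abelian_groupI)
    fix x y assume xy: "x \<in> carrier (free_algebra n)" "y \<in> carrier (free_algebra n)"
    have "{w. x w + y w \<noteq> 0} \<subseteq> {w. x w \<noteq> 0} \<union> {w. y w \<noteq> 0}" by auto
    then have "finite {w. x w + y w \<noteq> 0}"
      using xy by (elim finite_subset) (auto simp: free_algebra_def)
    moreover have "set w \<subseteq> {1..n}" if "x w + y w \<noteq> 0" for w
    proof -
      have "x w \<noteq> 0 \<or> y w \<noteq> 0" using that by auto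
      then show ?thesis using xy unfolding free_algebra_def by auto
    qed
    ultimately show "x \<oplus>\<^bsub>free_algebra n\<^esub> y \<in> carrier (free_algebra n)"
      by (auto simp: free_algebra_def)
  next
    fix x assume "x \<in> carrier (free_algebra n)"
    then have "(\<lambda>w. - x w) \<in> carrier (free_algebra n)" by (auto simp: free_algebra_def)
    then show "\<exists>y\<in>carrier (free_algebra n). y \<oplus>\<^bsub>free_algebra n\<^esub> x = \<zero>\<^bsub>free_algebra n\<^esub>"
      by (intro bexI[of _ "\<lambda>w. - x w"]) (auto simp: free_algebra_def)
  qed (auto simp: free_algebra_def algebra_simps)
  show "monoid (free_algebra n)"
  proof (rule monoidI)
    fix x y z
    show "x \<otimes>\<^bsub>free_algebra n\<^esub> y \<otimes>\<^bsub>free_algebra n\<^esub> z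
        = x \<otimes>\<^bsub>free_algebra n\<^esub> (y \<otimes>\<^bsub>free_algebra n\<^esub> z)"
      by (simp add: free_algebra_def free_algebra_mult_assoc del: length_take length_drop take_take drop_drop)
  next
    show "\<one>\<^bsub>free_algebra n\<^esub> \<in> carrier (free_algebra n)"
      by (auto simp: free_algebra_def)
  next
    fix x
    show "\<one>\<^bsub>free_algebra n\<^esub> \<otimes>\<^bsub>free_algebra n\<^esub> x = x"
      using free_algebra_one_left[of _ x] by (simp add: free_algebra_def del: take_eq_Nil)
    show "x \<otimes>\<^bsub>free_algebra n\<^esub> \<one>\<^bsub>free_algebra n\<^esub> = x"
      using free_algebra_one_right[of x] by (simp add: free_algebra_def del: drop_eq_Nil)
  qed (rule free_algebra_mult_closed)
qed (auto simp: free_algebra_def algebra_simps sum.distrib)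

lemma scal_carrier: "scal z \<in> carrier (free_algebra n)"
  by (auto simp: scal_def free_algebra_def)

lemma gen_carrier: "i \<in> {1..n} \<Longrightarrow> gen i \<in> carrier (free_algebra n)"
  by (auto simp: gen_def free_algebra_def)

lemma hecke_relations_carrier:
  assumes "n \<ge> 1"
  shows "hecke_relations n us q \<subseteq> carrier (free_algebra n)"
proof -
  interpret ring "free_algebra n" by (rule ring_free_algebra)
  note carr = scal_carrier gen_carrier
  have "cyclotomic_poly n us \<in> carrier (free_algebra n)"
    using assms by (induction us) (auto simp: cyclotomic_poly_def carr)
  then show ?thesis
    unfolding hecke_relations_def Let_def using assms by (auto simp: carr)
qed

lemma ideal_hecke_ideal: "n \<ge> 1 \<Longrightarrow> ideal (hecke_ideal n us q) (free_algebra n)"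
  unfolding hecke_ideal_def
  by (intro ring.genideal_ideal ring_free_algebra hecke_relations_carrier)

lemma ring_hecke: "n \<ge> 1 \<Longrightarrow> ring (hecke n us q)"
  unfolding hecke_def by (intro ideal.quotient_is_ring ideal_hecke_ideal)

lemma q2pow_add: "q2pow q (z + w) = q2pow q z * q2pow q w"
  by (simp add: q2pow_def distrib_left exp_add)

lemma q2pow_of_real:
  assumes "q > 0"
  shows "q2pow q (of_real t) = complex_of_real (q powr (2 * t))"
  using assms by (simp add: q2pow_def powr_def ln_realpow mult_ac flip: exp_of_real)

lemma q2pow_content_cong:
  assumes "q > 0" "q \<noteq> 1" "content_cong q z w"
  shows "q2pow q z = q2pow q w"
proof -
  have nz: "complex_of_real (ln (q ^ 2)) \<noteq> 0"
    using assms by (simp add: ln_realpow)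
  obtain k :: int where "z = w + \<i> * complex_of_real (2 * pi / ln (q ^ 2)) * of_int k"
    using assms(3) by (auto simp: content_cong_def)
  then have *: "complex_of_real (ln (q ^ 2)) * z
      = complex_of_real (ln (q ^ 2)) * w + \<i> * complex_of_real (2 * pi * of_int k)"
    using nz by (simp add: field_simps)
  have "exp (\<i> * complex_of_real (2 * pi * of_int k)) = 1"
    using cis_multiple_2pi[of "of_int k"] by (simp add: cis_conv_exp)
  then show ?thesis
    by (simp only: q2pow_def * exp_add) simp
qed

lemma content_function_exists:
  assumes "q > 0" "q \<noteq> 1" "length us = length lam" "0 \<notin> set us"
  shows "\<exists>c. content_function q us lam c"
proof -
  have nz: "complex_of_real (ln (q ^ 2)) \<noteq> 0"
    using assms by (simp add: ln_realpow)
  have "\<exists>z. i < length us \<longrightarrow> exp z = us ! i" for i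
  proof (cases "i < length us")
    case True
    then have "us ! i \<noteq> 0" using assms(4) nth_mem by fastforce
    have tz: "us ! i = rcis (cmod (us ! i)) (Arg (us ! i))"
      by (simp add: rcis_cmod_Arg)
    have "us ! i = exp (of_real (ln (cmod (us ! i))) + \<i> * of_real (Arg (us ! i)))"
      using tz \<open>us ! i \<noteq> 0\<close> by (simp add: rcis_def cis_conv_exp exp_add exp_of_real)
    then show ?thesis by metis
  qed auto
  then obtain e where e: "\<And>i. i < length us \<Longrightarrow> exp (e i) = us ! i" by metis
  define c where "c = (\<lambda>(i, x, y). e i / complex_of_real (ln (q ^ 2)) + of_nat y - of_nat x :: complex)"
  have refl: "content_cong q z z" for z by (auto simp: content_cong_def intro: exI[of _ 0])
  have "content_function q us lam c"
    unfolding content_function_def using nz refl assms(3)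
    by (auto simp: c_def q2pow_def e boxes_def algebra_simps)
  then show ?thesis by (rule exI[where x = c])
qed

lemma content_function_formula:
  assumes q: "q > 0" "q \<noteq> 1" and c: "content_function q us lam c"
    and part: "\<And>p. p \<in> set lam \<Longrightarrow> is_partition p" and b: "(i, x, y) \<in> boxes lam"
  shows "q2pow q (c (i, x, y)) = us ! i * complex_of_real (q powr (2 * (real y - real x)))"
proof -
  have q2: "q2pow q 1 = complex_of_real (q powr 2)" "q2pow q (-1) = complex_of_real (q powr (-2))"
    using q2pow_of_real[OF q(1), of 1] q2pow_of_real[OF q(1), of "-1"] by simp_all
  have left: "(i, x, y) \<in> boxes lam" if "(i, x, Suc y) \<in> boxes lam" for x y
    using that by (auto simp: boxes_def)
  have up: "(i, x, y) \<in> boxes lam" if "(i, Suc x, y) \<in> boxes lam" for x y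
  proof -
    have "i < length lam" "Suc x < length (lam ! i)" "y < lam ! i ! Suc x"
      using that by (auto simp: boxes_def)
    moreover from this have "sorted_wrt (\<ge>) (lam ! i)"
      using part[of "lam ! i"] by (simp add: is_partition_def)
    then have "lam ! i ! Suc x \<le> lam ! i ! x"
      using \<open>Suc x < length (lam ! i)\<close> by (auto simp: sorted_wrt_iff_nth_less)
    ultimately show ?thesis by (auto simp: boxes_def)
  qed
  have *: "q2pow q (c (i, x, 0)) = us ! i * complex_of_real (q powr (- 2 * real x))"
    if "(i, x, 0) \<in> boxes lam" for x
    using that
  proof (induction x)
    case 0
    then show ?case using c q by (simp add: content_function_def)
  next
    case (Suc x)
    have "content_cong q (c (i, Suc x, 0)) (c (i, x, 0) + (- 1))"
      using c Suc.prems by (simp add: content_function_def)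
    from q2pow_content_cong[OF q this]
    have "q2pow q (c (i, Suc x, 0)) = q2pow q (c (i, x, 0)) * q2pow q (- 1)"
      by (simp only: q2pow_add)
    also have "\<dots> = us ! i * complex_of_real (q powr (- 2 * real x) * q powr (- 2))"
      using Suc.IH[OF up[OF Suc.prems]] q2 by simp
    also have "q powr (- 2 * real x) * q powr (- 2) = q powr (- 2 * real (Suc x))"
      by (simp only: powr_add[symmetric]) (simp add: algebra_simps)
    finally show ?case .
  qed
  show ?thesis using b
  proof (induction y)
    case 0
    then show ?case using * by simp
  next
    case (Suc y)
    have "content_cong q (c (i, x, Suc y)) (c (i, x, y) + 1)"
      using c Suc.prems by (simp add: content_function_def)
    from q2pow_content_cong[OF q this]
    have "q2pow q (c (i, x, Suc y)) = q2pow q (c (i, x, y)) * q2pow q 1"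
      by (simp only: q2pow_add)
    also have "\<dots> = us ! i * complex_of_real (q powr (2 * (real y - real x)) * q powr 2)"
      using Suc.IH[OF left[OF Suc.prems]] q2 by simp
    also have "q powr (2 * (real y - real x)) * q powr 2 = q powr (2 * (real (Suc y) - real x))"
      by (simp only: powr_add[symmetric]) (simp add: algebra_simps)
    finally show ?case .
  qed
qed

lemma finite_boxes: "finite (boxes lam)"
proof -
  have "boxes lam = Sigma {..<length lam} (\<lambda>i. Sigma {..<length (lam ! i)} (\<lambda>x. {..<lam ! i ! x}))"
    by (auto simp: boxes_def)
  then show ?thesis by simp
qed

lemma finite_standard_tableaux: "finite (standard_tableaux n lam)"
proof (rule finite_subset)
  show "standard_tableaux n lam \<subseteq> {1..n} \<rightarrow>\<^sub>E boxes lam"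
    unfolding standard_tableaux_def PiE_def by (auto simp: bij_betw_def)
  show "finite ({1..n} \<rightarrow>\<^sub>E boxes lam)"
    by (intro finite_PiE finite_boxes) auto
qed

lemma free_act_gen_basis_vec:
  assumes "L \<in> standard_tableaux n lam"
  shows "free_act q n c lam (gen i) (basis_vec n lam L) = gen_on_basis q n c lam i L"
proof
  fix M
  have "{w. gen i w \<noteq> 0} = {[i]}" by (auto simp: gen_def)
  then have "free_act q n c lam (gen i) (basis_vec n lam L) M
      = (\<Sum>K\<in>standard_tableaux n lam. basis_vec n lam L K * gen_on_basis q n c lam i K M)"
    by (simp add: free_act_def gen_op_def gen_def)
  also have "\<dots> = (\<Sum>K\<in>{L}. gen_on_basis q n c lam i K M)"
    using assms finite_standard_tableaux
    by (intro sum.mono_neutral_cong_right) (auto simp: basis_vec_def)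
  finally show "free_act q n c lam (gen i) (basis_vec n lam L) M = gen_on_basis q n c lam i L M"
    by simp
qed

end

theory Submission
  imports Defs "HOL-Library.Function_Algebras"
begin

text \<open>
  Semisimplicity forces \<open>u\<^sub>j \<noteq> u\<^sub>i q\<^sup>2\<^sup>k\<close> for \<open>i \<noteq> j\<close> and \<open>\<bar>k\<bar> < n\<close>: otherwise the action on the
  \<open>n\<close>-th tensor power of a two-dimensional space, with \<open>T\<^sub>1\<close> acting on the first factor through a solution of the
  reflection equation with eigenvalues \<open>u\<^sub>i\<close> and \<open>u\<^sub>j\<close>, has a one-dimensional quotient that does not split off.
  Under this condition no denominator vanishes, and the seminormal formulas satisfy the relations by
  identities in three contents. The Jucys--Murphy elements act diagonally on all modules
  at once, with distinct joint eigenvalues for distinct tableaux, so that the algebra contains all matrix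
  units; hence the modules are simple and pairwise non-isomorphic.

  There are \<open>\<Sum>\<^sub>\<lambda> (f\<^sup>\<lambda>)\<^sup>2 = r\<^sup>n n!\<close> matrix units, by the commutation relation between adding and removing
  boxes, while normal forms of words bound the dimension of the algebra by the same number. So the algebra acts
  faithfully on the sum of the modules, and in an arbitrary simple module some diagonal matrix unit has
  a nonzero image, which generates a copy of one of them.
\<close>

section \<open>Functionals on the free algebra and representations of the relations\<close>

section \<open>Pairing the free algebra with functions on words\<close>

text \<open>The presentation gives no direct hold on the size of the algebra, so the upper bound is
  proved on the dual side. A functional that kills the ideal is a function on words satisfying the
  relations as equations between numbers, and such a function vanishes once it vanishes on the
  normal words. If an element outside the ideal acted as zero on all modules, a functional
  separating it from the ideal would join the matrix coefficients to make more functionals than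
  there are normal words; a linear relation between them, evaluated at this element and at the
  matrix units, would have only zero coefficients.

  Semisimplicity enters through one consequence: if a nonzero functional on a module is multiplied
  by a character under the generators, the module contains an eigenvector for that character on
  which the functional is nonzero. In the tensor representation such eigenvectors are explicit.

  All shapes share one space of functions on tableaux, so that by faithfulness an equation in the
  algebra becomes an equation between operators on this space; abstract simple modules are handled
  through such equations.\<close>

definition mon :: "nat list \<Rightarrow> nat list \<Rightarrow> complex" where
  "mon w = (\<lambda>v. if v = w then 1 else 0)"

text \<open>Words form a basis of the free algebra, so arbitrary functions on words are exactly its
  linear functionals; \<open>pairing\<close> evaluates such a functional.\<close>

definition pairing :: "(nat list \<Rightarrow> complex) \<Rightarrow> (nat list \<Rightarrow> complex) \<Rightarrow> complex" where
  "pairing \<phi> a = (\<Sum>w | a w \<noteq> 0. a w * \<phi> w)"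

lemma gen_eq_mon: "gen i = mon [i]"
  by (simp add: gen_def mon_def)

lemma scal_eq_mon: "scal z = (\<lambda>w. z * mon [] w)"
  by (auto simp: scal_def mon_def)

lemma free_one_eq_mon: "\<one>\<^bsub>free_algebra n\<^esub> = mon []"
  by (simp add: free_algebra_def mon_def)

lemma free_one_eq_scal: "\<one>\<^bsub>free_algebra n\<^esub> = scal 1"
  by (simp add: free_algebra_def scal_def)

lemma free_zero: "\<zero>\<^bsub>free_algebra n\<^esub> = (\<lambda>w. 0)"
  by (simp add: free_algebra_def)

lemma free_add: "a \<oplus>\<^bsub>free_algebra n\<^esub> b = (\<lambda>w. a w + b w)"
  by (simp add: free_algebra_def)

lemma free_mult: "a \<otimes>\<^bsub>free_algebra n\<^esub> b = (\<lambda>w. \<Sum>k\<le>length w. a (take k w) * b (drop k w))"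
  by (simp add: free_algebra_def)

lemma free_finite: "a \<in> carrier (free_algebra n) \<Longrightarrow> finite {w. a w \<noteq> 0}"
  and free_letters: "a \<in> carrier (free_algebra n) \<Longrightarrow> a w \<noteq> 0 \<Longrightarrow> set w \<subseteq> {1..n}"
  by (simp_all add: free_algebra_def)

lemma mon_carrier: "set w \<subseteq> {1..n} \<Longrightarrow> mon w \<in> carrier (free_algebra n)"
  by (auto simp: mon_def free_algebra_def)

lemma free_uminus:
  assumes "a \<in> carrier (free_algebra n)"
  shows "\<ominus>\<^bsub>free_algebra n\<^esub> a = (\<lambda>w. - a w)"
proof -
  interpret ring "free_algebra n" by (rule ring_free_algebra)
  have "(\<lambda>w. - a w) \<in> carrier (free_algebra n)" using assms by (auto simp: free_algebra_def)
  moreover have "a \<oplus>\<^bsub>free_algebra n\<^esub> (\<lambda>w. - a w) = \<zero>\<^bsub>free_algebra n\<^esub>"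
    by (simp add: free_add free_zero)
  ultimately show ?thesis using assms minus_equality a_comm by metis
qed

lemma free_minus:
  assumes "b \<in> carrier (free_algebra n)"
  shows "a \<ominus>\<^bsub>free_algebra n\<^esub> b = (\<lambda>w. a w - b w)"
  using free_uminus[OF assms] by (simp add: a_minus_def free_add)

lemma free_scale_carrier:
  "a \<in> carrier (free_algebra n) \<Longrightarrow> (\<lambda>w. z * a w) \<in> carrier (free_algebra n)"
  by (auto simp: free_algebra_def elim: rev_finite_subset)

lemma free_sum_carrier:
  assumes "\<And>j. j \<in> J \<Longrightarrow> a j \<in> carrier (free_algebra n)"
  shows "(\<lambda>w. \<Sum>j\<in>J. a j w) \<in> carrier (free_algebra n)"
proof -
  interpret ring "free_algebra n" by (rule ring_free_algebra)
  show ?thesis using assms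
  proof (induction J rule: infinite_finite_induct)
    case (insert j J)
    then have "a j \<oplus>\<^bsub>free_algebra n\<^esub> (\<lambda>w. \<Sum>j\<in>J. a j w) \<in> carrier (free_algebra n)"
      by simp
    then show ?case using insert by (simp add: free_add)
  qed (use zero_closed in \<open>auto simp: free_zero\<close>)
qed

lemma free_scal_mult: "scal z \<otimes>\<^bsub>free_algebra n\<^esub> a = (\<lambda>w. z * a w)"
proof
  fix w
  have "(\<Sum>k\<le>length w. scal z (take k w) * a (drop k w)) = (\<Sum>k\<in>{0::nat}. z * a w)"
    by (rule sum.mono_neutral_cong_right) (auto simp: scal_def)
  then show "(scal z \<otimes>\<^bsub>free_algebra n\<^esub> a) w = z * a w" by (simp add: free_mult)
qed

lemma pairing_superset:
  assumes "finite W" "{w. a w \<noteq> 0} \<subseteq> W"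
  shows "pairing \<phi> a = (\<Sum>w\<in>W. a w * \<phi> w)"
  unfolding pairing_def by (rule sum.mono_neutral_left) (use assms in auto)

lemma pairing_mon [simp]: "pairing \<phi> (mon w) = \<phi> w"
  by (subst pairing_superset[of "{w}"]) (auto simp: mon_def)

lemma pairing_zero [simp]: "pairing \<phi> (\<lambda>w. 0) = 0"
  by (simp add: pairing_def)

lemma pairing_zero_left [simp]: "pairing (\<lambda>w. 0) a = 0"
  by (simp add: pairing_def)

lemma pairing_scale: "pairing \<phi> (\<lambda>w. z * a w) = z * pairing \<phi> a"
  by (cases "z = 0") (simp_all add: pairing_def sum_distrib_left mult.assoc)

lemma pairing_scal [simp]: "pairing \<phi> (scal z) = z * \<phi> []"
  by (simp add: scal_eq_mon pairing_scale)

lemma pairing_add: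
  assumes "a \<in> carrier (free_algebra n)" "b \<in> carrier (free_algebra n)"
  shows "pairing \<phi> (\<lambda>w. a w + b w) = pairing \<phi> a + pairing \<phi> b"
proof -
  let ?W = "{w. a w \<noteq> 0} \<union> {w. b w \<noteq> 0}"
  have W: "finite ?W" using assms by (simp add: free_finite)
  show ?thesis
    by (subst (1 2 3) pairing_superset[OF W]) (auto simp: sum.distrib distrib_right)
qed

lemma pairing_minus:
  assumes "a \<in> carrier (free_algebra n)" "b \<in> carrier (free_algebra n)"
  shows "pairing \<phi> (\<lambda>w. a w - b w) = pairing \<phi> a - pairing \<phi> b"
proof -
  let ?W = "{w. a w \<noteq> 0} \<union> {w. b w \<noteq> 0}"
  have W: "finite ?W" using assms by (simp add: free_finite)
  show ?thesis
    by (subst (1 2 3) pairing_superset[OF W]) (auto simp: sum_subtractf left_diff_distrib)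
qed

lemma pairing_sum:
  assumes "\<And>j. j \<in> J \<Longrightarrow> a j \<in> carrier (free_algebra n)"
  shows "pairing \<phi> (\<lambda>w. \<Sum>j\<in>J. a j w) = (\<Sum>j\<in>J. pairing \<phi> (a j))"
  using assms
proof (induction J rule: infinite_finite_induct)
  case (insert j J)
  then show ?case
    using pairing_add[of "a j" n "\<lambda>w. \<Sum>j\<in>J. a j w"] free_sum_carrier[of J a n] by simp
qed auto

lemma pairing_sum_left: "pairing (\<lambda>w. \<Sum>j\<in>J. z j * \<phi> j w) a = (\<Sum>j\<in>J. z j * pairing (\<phi> j) a)"
  unfolding pairing_def
  by (simp add: sum_distrib_left mult_ac) (rule sum.swap)

lemma pairing_cong:
  assumes "a \<in> carrier (free_algebra n)" "\<And>w. set w \<subseteq> {1..n} \<Longrightarrow> \<phi> w = \<psi> w"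
  shows "pairing \<phi> a = pairing \<psi> a"
  unfolding pairing_def using assms free_letters by (intro sum.cong) auto

text \<open>Multiplication is dual to concatenation: a word with a cut is the same as a pair of a
  prefix and a suffix, and the double sum is reindexed accordingly.\<close>

lemma pairing_mult:
  assumes "a \<in> carrier (free_algebra n)" "b \<in> carrier (free_algebra n)"
  shows "pairing \<phi> (a \<otimes>\<^bsub>free_algebra n\<^esub> b) = pairing (\<lambda>u. pairing (\<lambda>v. \<phi> (u @ v)) b) a"
proof -
  let ?A = "{w. a w \<noteq> 0}" and ?B = "{w. b w \<noteq> 0}"
  define W where "W = (\<lambda>(u, v). u @ v) ` (?A \<times> ?B)"
  let ?c = "\<lambda>w. \<Sum>k\<le>length w. a (take k w) * b (drop k w)"
  have fin: "finite ?A" "finite ?B" using assms by (simp_all add: free_finite)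
  then have W: "finite W" by (simp add: W_def)
  have memW: "u @ v \<in> W" if "a u \<noteq> 0" "b v \<noteq> 0" for u v using that by (auto simp: W_def)
  have sub: "{w. ?c w \<noteq> 0} \<subseteq> W"
  proof
    fix w assume w: "w \<in> {w. ?c w \<noteq> 0}"
    show "w \<in> W"
    proof (rule ccontr)
      assume "w \<notin> W"
      then have *: "a (take k w) * b (drop k w) = 0" for k
        using memW[of "take k w" "drop k w"] by auto
      have "?c w = 0" by (intro sum.neutral ballI *)
      then show False using w by simp
    qed
  qed
  have "pairing \<phi> (a \<otimes>\<^bsub>free_algebra n\<^esub> b) = (\<Sum>w\<in>W. ?c w * \<phi> w)"
    unfolding free_mult by (rule pairing_superset[OF W sub])
  also have "\<dots> = (\<Sum>(w, k)\<in>Sigma W (\<lambda>w. {..length w}). a (take k w) * b (drop k w) * \<phi> w)"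
    using W by (subst sum.Sigma[symmetric]) (auto simp: sum_distrib_right)
  also have "\<dots> = (\<Sum>(u, v)\<in>{(u, v). u @ v \<in> W}. a u * b v * \<phi> (u @ v))"
    by (rule sum.reindex_bij_witness[of _ "\<lambda>(u, v). (u @ v, length u)" "\<lambda>(w, k). (take k w, drop k w)"])
       auto
  also have "\<dots> = (\<Sum>(u, v)\<in>?A \<times> ?B. a u * b v * \<phi> (u @ v))"
  proof (rule sum.mono_neutral_right)
    have "{(u, v). u @ v \<in> W} \<subseteq> (\<lambda>(w, k). (take k w, drop k w)) ` Sigma W (\<lambda>w. {..length w})"
    proof clarify
      fix u v assume "u @ v \<in> W"
      then show "(u, v) \<in> (\<lambda>(w, k). (take k w, drop k w)) ` Sigma W (\<lambda>w. {..length w})"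
        by (intro image_eqI[of _ _ "(u @ v, length u)"]) auto
    qed
    moreover have "finite (Sigma W (\<lambda>w. {..length w}))" using W by auto
    ultimately show "finite {(u, v). u @ v \<in> W}" using finite_subset by blast
  qed (use memW in auto)
  also have "\<dots> = pairing (\<lambda>u. pairing (\<lambda>v. \<phi> (u @ v)) b) a"
    unfolding pairing_def
    by (subst sum.cartesian_product[symmetric]) (simp add: sum_distrib_left mult_ac)
  finally show ?thesis .
qed

lemma mon_mult:
  assumes "set u \<subseteq> {1..n}" "set v \<subseteq> {1..n}"
  shows "mon u \<otimes>\<^bsub>free_algebra n\<^esub> mon v = mon (u @ v)"
proof
  fix w
  have c: "mon u \<otimes>\<^bsub>free_algebra n\<^esub> mon v \<in> carrier (free_algebra n)"
    using assms by (intro free_algebra_mult_closed mon_carrier)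
  \<comment> \<open>Reading off a coefficient is itself a pairing, so the product rule for pairings
    decides the equation.\<close>
  have coeff: "a w = pairing (mon w) a" if "a \<in> carrier (free_algebra n)" for a
  proof (cases "a w = 0")
    case True
    then have "\<forall>v\<in>{v. a v \<noteq> 0}. a v * mon w v = 0" by (auto simp: mon_def)
    then show ?thesis using True by (simp add: pairing_def)
  next
    case False
    have "pairing (mon w) a = (\<Sum>v\<in>{w}. a v)" unfolding pairing_def
      using that False by (intro sum.mono_neutral_cong_right) (auto simp: mon_def free_finite)
    then show ?thesis by simp
  qed
  have "pairing (mon w) (mon u \<otimes>\<^bsub>free_algebra n\<^esub> mon v) = mon w (u @ v)"
    using assms by (simp add: pairing_mult[of _ n] mon_carrier)
  then have "(mon u \<otimes>\<^bsub>free_algebra n\<^esub> mon v) w = mon w (u @ v)"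
    using coeff[OF c] by simp
  then show "(mon u \<otimes>\<^bsub>free_algebra n\<^esub> mon v) w = mon (u @ v) w"
    by (simp add: mon_def eq_commute)
qed

section \<open>Representations by operators\<close>

definition linear_op :: "(('x \<Rightarrow> complex) \<Rightarrow> 'x \<Rightarrow> complex) \<Rightarrow> bool" where
  "linear_op F \<longleftrightarrow> (\<forall>f g. F (\<lambda>x. f x + g x) = (\<lambda>x. F f x + F g x)) \<and>
     (\<forall>z f. F (\<lambda>x. z * f x) = (\<lambda>x. z * F f x))"

definition word_act :: "(nat \<Rightarrow> ('x \<Rightarrow> complex) \<Rightarrow> 'x \<Rightarrow> complex) \<Rightarrow> (nat list \<Rightarrow> complex)
    \<Rightarrow> ('x \<Rightarrow> complex) \<Rightarrow> 'x \<Rightarrow> complex" where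
  "word_act Op a f = (\<lambda>x. pairing (\<lambda>w. foldr Op w f x) a)"

lemma free_act_eq_word_act: "free_act q n c lam a f = word_act (gen_op q n c lam) a f"
  by (simp add: free_act_def word_act_def pairing_def)

lemma linear_opD:
  assumes "linear_op F"
  shows "F (\<lambda>x. f x + g x) = (\<lambda>x. F f x + F g x)" "F (\<lambda>x. z * f x) = (\<lambda>x. z * F f x)"
    "F (\<lambda>x. 0) = (\<lambda>x. 0)" "F (\<lambda>x. f x - g x) = (\<lambda>x. F f x - F g x)"
proof -
  show 1: "F (\<lambda>x. f x + g x) = (\<lambda>x. F f x + F g x)" for f g
    using assms by (simp add: linear_op_def)
  show 2: "F (\<lambda>x. z * f x) = (\<lambda>x. z * F f x)" for z f
    using assms by (simp add: linear_op_def)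
  show "F (\<lambda>x. 0) = (\<lambda>x. 0)" using 2[of 0] by simp
  show "F (\<lambda>x. f x - g x) = (\<lambda>x. F f x - F g x)"
    using 1[of f "\<lambda>x. - 1 * g x"] 2[of "-1" g] by simp
qed

lemma linear_op_sum:
  assumes "linear_op F"
  shows "F (\<lambda>x. \<Sum>j\<in>J. z j * f j x) = (\<lambda>x. \<Sum>j\<in>J. z j * F (f j) x)"
  by (induction J rule: infinite_finite_induct) (auto simp: linear_opD[OF assms])

lemma linear_op_foldr:
  assumes "\<And>i. linear_op (Op i)"
  shows "linear_op (foldr Op w)"
  by (induction w) (simp_all add: linear_op_def linear_opD[OF assms])

lemma word_act_mult:
  assumes "\<And>i. linear_op (Op i)" "a \<in> carrier (free_algebra n)" "b \<in> carrier (free_algebra n)"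
  shows "word_act Op (a \<otimes>\<^bsub>free_algebra n\<^esub> b) f = word_act Op a (word_act Op b f)"
  unfolding word_act_def pairing_mult[OF assms(2,3)] pairing_def[of _ b]
  by (simp add: linear_op_sum[OF linear_op_foldr[OF assms(1)]])

lemma linear_op_word_act:
  assumes "\<And>i. linear_op (Op i)"
  shows "linear_op (word_act Op a)"
  unfolding linear_op_def[of "word_act Op a"] word_act_def pairing_def
  by (simp add: linear_opD[OF linear_op_foldr[OF assms]] distrib_left sum.distrib sum_distrib_left mult_ac)

lemma word_act_mon [simp]: "word_act Op (mon w) f = foldr Op w f"
  by (simp add: word_act_def)

lemma word_act_gen [simp]: "word_act Op (gen i) f = Op i f"
  by (simp add: gen_eq_mon)

lemma word_act_scal [simp]: "word_act Op (scal z) f = (\<lambda>x. z * f x)"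
  by (simp add: word_act_def)

lemma word_act_one [simp]: "word_act Op \<one>\<^bsub>free_algebra n\<^esub> f = f"
  by (simp add: free_one_eq_mon)

lemma word_act_add:
  assumes "a \<in> carrier (free_algebra n)" "b \<in> carrier (free_algebra n)"
  shows "word_act Op (a \<oplus>\<^bsub>free_algebra n\<^esub> b) f = (\<lambda>x. word_act Op a f x + word_act Op b f x)"
  by (simp add: word_act_def free_add pairing_add[OF assms])

lemma word_act_minus:
  assumes "a \<in> carrier (free_algebra n)" "b \<in> carrier (free_algebra n)"
  shows "word_act Op (a \<ominus>\<^bsub>free_algebra n\<^esub> b) f = (\<lambda>x. word_act Op a f x - word_act Op b f x)"
  by (simp add: word_act_def free_minus[OF assms(2)] pairing_minus[OF assms])

lemma word_act_scale: "word_act Op (\<lambda>w. z * a w) f = (\<lambda>x. z * word_act Op a f x)"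
  by (simp add: word_act_def pairing_scale)

lemma word_act_zero [simp]: "word_act Op (\<lambda>w. 0) f = (\<lambda>x. 0)"
  by (simp add: word_act_def)

lemma word_act_sum:
  assumes "\<And>j. j \<in> J \<Longrightarrow> a j \<in> carrier (free_algebra n)"
  shows "word_act Op (\<lambda>w. \<Sum>j\<in>J. a j w) f = (\<lambda>x. \<Sum>j\<in>J. word_act Op (a j) f x)"
  by (simp add: word_act_def pairing_sum[OF assms])

definition fun_subspace :: "('x \<Rightarrow> complex) set \<Rightarrow> bool" where
  "fun_subspace U \<longleftrightarrow> (\<lambda>x. 0) \<in> U \<and> (\<forall>f\<in>U. \<forall>g\<in>U. (\<lambda>x. f x + g x) \<in> U) \<and> (\<forall>z. \<forall>f\<in>U. (\<lambda>x. z * f x) \<in> U)"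

lemma fun_subspace_sum:
  assumes "fun_subspace U" "\<And>j. j \<in> J \<Longrightarrow> f j \<in> U"
  shows "(\<lambda>x. \<Sum>j\<in>J. z j * f j x) \<in> U"
  using assms(2)
  by (induction J rule: infinite_finite_induct) (use assms(1) in \<open>auto simp: fun_subspace_def\<close>)

lemma word_act_closed:
  assumes "fun_subspace U" "\<And>i f. i \<in> {1..n} \<Longrightarrow> f \<in> U \<Longrightarrow> Op i f \<in> U"
    and "a \<in> carrier (free_algebra n)" "f \<in> U"
  shows "word_act Op a f \<in> U"
proof -
  have "set w \<subseteq> {1..n} \<Longrightarrow> foldr Op w f \<in> U" for w
    by (induction w) (use assms in auto)
  then show ?thesis
    unfolding word_act_def pairing_def
    using assms(3) free_letters by (intro fun_subspace_sum[OF assms(1)]) blast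
qed

text \<open>The relations are required on an invariant subspace \<open>U\<close> only: the
  seminormal operators truncate to standard tableaux and satisfy the relations for functions
  supported there.\<close>

locale hecke_rep =
  fixes n :: nat and us :: "complex list" and q :: complex
    and Op :: "nat \<Rightarrow> ('x \<Rightarrow> complex) \<Rightarrow> 'x \<Rightarrow> complex" and U :: "('x \<Rightarrow> complex) set"
  assumes n: "n \<ge> 1" and q: "q \<noteq> 0"
    and lin: "\<And>i. linear_op (Op i)"
    and U: "fun_subspace U" "\<And>i f. i \<in> {1..n} \<Longrightarrow> f \<in> U \<Longrightarrow> Op i f \<in> U"
    and comm: "\<And>i j f. i \<in> {1..n} \<Longrightarrow> j \<in> {1..n} \<Longrightarrow> \<bar>int i - int j\<bar> > 1 \<Longrightarrow> f \<in> U \<Longrightarrow>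
      Op i (Op j f) = Op j (Op i f)"
    and braid: "\<And>i f. 2 \<le> i \<Longrightarrow> i + 1 \<le> n \<Longrightarrow> f \<in> U \<Longrightarrow>
      Op i (Op (i + 1) (Op i f)) = Op (i + 1) (Op i (Op (i + 1) f))"
    and braid4: "\<And>f. 2 \<le> n \<Longrightarrow> f \<in> U \<Longrightarrow>
      Op 1 (Op 2 (Op 1 (Op 2 f))) = Op 2 (Op 1 (Op 2 (Op 1 f)))"
    and quadratic: "\<And>i f. 2 \<le> i \<Longrightarrow> i \<le> n \<Longrightarrow> f \<in> U \<Longrightarrow>
      Op i (Op i f) = (\<lambda>x. (q - inverse q) * Op i f x + f x)"
    and cyclotomic: "\<And>f. f \<in> U \<Longrightarrow> foldr (\<lambda>z g x. Op 1 g x - z * g x) us f = (\<lambda>x. 0)"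
begin

text \<open>The elements that annihilate \<open>U\<close> form a two-sided ideal, closed under right
  multiplication because \<open>U\<close> is invariant. It contains the relations, hence the ideal
  they generate.\<close>

lemma hecke_ideal_acts_zero:
  assumes "a \<in> hecke_ideal n us q" "f \<in> U"
  shows "word_act Op a f = (\<lambda>x. 0)"
proof -
  let ?A = "free_algebra n"
  interpret A: ring ?A by (rule ring_free_algebra)
  define K where "K = {a \<in> carrier ?A. \<forall>f\<in>U. word_act Op a f = (\<lambda>x. 0)}"
  have closed: "word_act Op a f \<in> U" if "a \<in> carrier ?A" "f \<in> U" for a f
    using word_act_closed[OF U that] .
  have lina: "linear_op (word_act Op a)" for a by (rule linear_op_word_act[OF lin])
  have "ideal K ?A"
  proof (rule idealI[OF ring_free_algebra])
    show "subgroup K (add_monoid ?A)"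
    proof
      fix x y assume "x \<in> K" "y \<in> K"
      then show "x \<otimes>\<^bsub>add_monoid ?A\<^esub> y \<in> K" by (auto simp: K_def word_act_add)
    next
      fix x assume x: "x \<in> K"
      have "(\<lambda>w. - x w) = (\<lambda>w. - 1 * x w)" by simp
      then have "word_act Op (\<ominus>\<^bsub>?A\<^esub> x) f = (\<lambda>y. - 1 * word_act Op x f y)" for f
        using x word_act_scale[of Op "-1" x f] free_uminus[of x n] by (simp add: K_def)
      then show "inv\<^bsub>add_monoid ?A\<^esub> x \<in> K"
        unfolding a_inv_def[symmetric] using x by (auto simp: K_def)
    qed (auto simp: K_def free_zero A.zero_closed[unfolded free_zero])
  next
    fix a x assume ax: "a \<in> K" "x \<in> carrier ?A"
    then show "x \<otimes>\<^bsub>?A\<^esub> a \<in> K"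
      by (auto simp: K_def word_act_mult[OF lin] linear_opD(3)[OF lina])
    show "a \<otimes>\<^bsub>?A\<^esub> x \<in> K"
      using ax closed by (auto simp: K_def word_act_mult[OF lin])
  qed
  moreover have "hecke_relations n us q \<subseteq> K"
  proof
    fix x assume x: "x \<in> hecke_relations n us q"
    have xA: "x \<in> carrier ?A" using hecke_relations_carrier[OF n] x by blast
    note [simp] = gen_carrier scal_carrier word_act_mult[OF lin, of _ n] word_act_minus[of _ n] word_act_add[of _ n]
    have cyc: "cyclotomic_poly n vs \<in> carrier ?A \<and>
      word_act Op (cyclotomic_poly n vs) f = foldr (\<lambda>z g x. Op 1 g x - z * g x) vs f" for vs f
    proof (induction vs)
      case (Cons z vs)
      then show ?case using n by (simp add: cyclotomic_poly_def)
    qed (simp add: cyclotomic_poly_def)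
    have "word_act Op x f = (\<lambda>x. 0)" if f: "f \<in> U" for f
      using x unfolding hecke_relations_def Let_def
    proof (elim UnE)
      assume "x \<in> {cyclotomic_poly n us}"
      then show ?thesis using cyc cyclotomic[OF f] by simp
    next
      assume "x \<in> (if 2 \<le> n then {gen 1 \<otimes>\<^bsub>?A\<^esub> gen 2 \<otimes>\<^bsub>?A\<^esub> gen 1 \<otimes>\<^bsub>?A\<^esub> gen 2 \<ominus>\<^bsub>?A\<^esub>
        gen 2 \<otimes>\<^bsub>?A\<^esub> gen 1 \<otimes>\<^bsub>?A\<^esub> gen 2 \<otimes>\<^bsub>?A\<^esub> gen 1} else {})"
      then show ?thesis using braid4[OF _ f] by (auto split: if_splits)
    next
      assume "x \<in> {(gen i \<ominus>\<^bsub>?A\<^esub> scal q) \<otimes>\<^bsub>?A\<^esub> (gen i \<oplus>\<^bsub>?A\<^esub> scal (inverse q)) |i. 2 \<le> i \<and> i \<le> n}"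
      then show ?thesis using quadratic[OF _ _ f] q
        by (auto simp: linear_opD[OF lin] algebra_simps)
    qed (use comm[OF _ _ _ f] braid[OF _ _ f] in auto)
    then show "x \<in> K" using xA by (simp add: K_def)
  qed
  ultimately have "hecke_ideal n us q \<subseteq> K"
    unfolding hecke_ideal_def by (rule A.genideal_minimal)
  then show ?thesis using assms by (auto simp: K_def)
qed

end

section \<open>Upper bound for the dimension by normal forms, in dual form\<close>

section \<open>Normal forms of words\<close>

text \<open>The functions on words that factor through the Hecke algebra. Working with these functions
  instead of with elements of the algebra turns every rewriting step into an equation between
  complex numbers.\<close>

locale hecke_word_fun =
  fixes n r :: nat and h :: complex and p :: "nat \<Rightarrow> complex" and \<phi> :: "nat list \<Rightarrow> complex"
  assumes comm: "set x \<subseteq> {1..n} \<Longrightarrow> set y \<subseteq> {1..n} \<Longrightarrow> i \<in> {1..n} \<Longrightarrow> j \<in> {1..n} \<Longrightarrow>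
      \<bar>int i - int j\<bar> > 1 \<Longrightarrow> \<phi> (x @ i # j # y) = \<phi> (x @ j # i # y)"
    and braid: "set x \<subseteq> {1..n} \<Longrightarrow> set y \<subseteq> {1..n} \<Longrightarrow> 2 \<le> i \<Longrightarrow> Suc i \<le> n \<Longrightarrow>
      \<phi> (x @ i # Suc i # i # y) = \<phi> (x @ Suc i # i # Suc i # y)"
    and braid4: "set x \<subseteq> {1..n} \<Longrightarrow> set y \<subseteq> {1..n} \<Longrightarrow> 2 \<le> n \<Longrightarrow>
      \<phi> (x @ 1 # 2 # 1 # 2 # y) = \<phi> (x @ 2 # 1 # 2 # 1 # y)"
    and quad: "set x \<subseteq> {1..n} \<Longrightarrow> set y \<subseteq> {1..n} \<Longrightarrow> 2 \<le> i \<Longrightarrow> i \<le> n \<Longrightarrow>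
      \<phi> (x @ i # i # y) = h * \<phi> (x @ i # y) + \<phi> (x @ y)"
    and cyc: "set x \<subseteq> {1..n} \<Longrightarrow> set y \<subseteq> {1..n} \<Longrightarrow>
      \<phi> (x @ replicate r 1 @ y) = (\<Sum>j<r. p j * \<phi> (x @ replicate j 1 @ y))"

definition desc :: "nat \<Rightarrow> nat \<Rightarrow> nat list" where
  "desc k j = rev [j..<Suc k]"

definition asc :: "nat \<Rightarrow> nat list" where
  "asc i = [2..<Suc i]"

text \<open>These play the role of representatives of the right cosets of G(r,1,k-1) in G(r,1,k):
  the words k...j, empty for j = k+1, and k...2 1^a 2...i. There are at most k + (r-1) k = r k of
  them, the index.\<close>

definition coset_words :: "nat \<Rightarrow> nat \<Rightarrow> nat list set" where
  "coset_words r k = desc k ` {2..Suc k} \<union>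
     (\<lambda>(a, i). desc k 2 @ replicate a 1 @ asc i) ` ({1..<r} \<times> {1..k})"

fun normal_words :: "nat \<Rightarrow> nat \<Rightarrow> nat list set" where
  "normal_words r 0 = {[]}"
| "normal_words r (Suc k) = (\<lambda>(b, g). b @ g) ` (normal_words r k \<times> coset_words r (Suc k))"

lemma set_desc [simp]: "set (desc k j) = {j..k}"
  by (auto simp: desc_def)

lemma set_asc [simp]: "set (asc i) = {2..i}"
  by (auto simp: asc_def)

lemma desc_empty [simp]: "desc k (Suc k) = []"
  by (simp add: desc_def)

lemma desc_snoc: "Suc 0 \<le> j \<Longrightarrow> j \<le> Suc k \<Longrightarrow> desc k (j - 1) = desc k j @ [j - 1]"
  by (cases j) (simp_all add: desc_def upt_conv_Cons)

lemma upt_split: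
  assumes "i \<le> m" "m < k"
  shows "[i..<k] = [i..<m] @ m # [Suc m..<k]"
  using assms upt_add_eq_append[of i m "k - m"] by (simp add: upt_conv_Cons)

lemma desc_split: "1 \<le> m \<Longrightarrow> j \<le> m \<Longrightarrow> m \<le> k \<Longrightarrow> desc k j = desc k (Suc m) @ m # desc (m - 1) j"
  using upt_split[of j m "Suc k"] by (simp add: desc_def)

lemma asc_Suc: "1 \<le> i \<Longrightarrow> asc (Suc i) = asc i @ [Suc i]"
  by (simp add: asc_def)

lemma asc_split: "2 \<le> m \<Longrightarrow> m \<le> i \<Longrightarrow> asc i = asc (m - 1) @ m # [Suc m..<Suc i]"
  using upt_split[of 2 m "Suc i"] by (simp add: asc_def)

lemma asc_1 [simp]: "asc (Suc 0) = []"
  by (simp add: asc_def)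

lemma card_coset_words: "finite (coset_words r k) \<and> card (coset_words r k) \<le> k + (r - 1) * k"
proof -
  have "card (coset_words r k) \<le> card (desc k ` {2..Suc k}) +
      card ((\<lambda>(a, i). desc k 2 @ replicate a 1 @ asc i) ` ({1..<r} \<times> {1..k}))"
    unfolding coset_words_def by (rule card_Un_le)
  also have "\<dots> \<le> card {2..Suc k} + card ({1..<r} \<times> {1..k})"
    by (intro add_mono card_image_le) auto
  finally show ?thesis by (simp add: coset_words_def card_cartesian_product)
qed

lemma card_normal_words:
  assumes "r > 0"
  shows "finite (normal_words r k) \<and> card (normal_words r k) \<le> r ^ k * fact k"
proof (induction k)
  case (Suc k)
  have "card (normal_words r (Suc k)) \<le> card (normal_words r k \<times> coset_words r (Suc k))"
    unfolding normal_words.simps using Suc card_coset_words[of r "Suc k"] by (intro card_image_le) auto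
  also have "\<dots> \<le> (r ^ k * fact k) * (Suc k + (r - 1) * Suc k)"
    unfolding card_cartesian_product using Suc card_coset_words[of r "Suc k"] by (intro mult_mono) auto
  also have "Suc k + (r - 1) * Suc k = r * Suc k"
    using assms by (cases r) auto
  finally have "card (normal_words r (Suc k)) \<le> r ^ Suc k * fact (Suc k)"
    by (simp add: algebra_simps)
  then show ?case using Suc card_coset_words[of r "Suc k"] by simp
qed simp

section \<open>Rewriting rules and stability of the coset words under right multiplication\<close>

context hecke_word_fun
begin

lemma comm_word:
  assumes "set x \<subseteq> {1..n}" "set y \<subseteq> {1..n}" "m \<in> {1..n}"
    and "\<And>l. l \<in> set u \<Longrightarrow> l \<in> {1..n} \<and> \<bar>int l - int m\<bar> > 1"
  shows "\<phi> (x @ u @ m # y) = \<phi> (x @ m # u @ y)"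
  using assms(2,4)
proof (induction u arbitrary: y rule: rev_induct)
  case (snoc l u)
  have "\<phi> ((x @ u) @ l # m # y) = \<phi> ((x @ u) @ m # l # y)"
    using snoc.prems assms by (intro comm) auto
  then show ?case
    using snoc.IH[of "l # y"] snoc.prems assms by auto
qed simp

lemma comm_word_letters:
  assumes "set x \<subseteq> {1..n}" "set y \<subseteq> {1..n}" "set v \<subseteq> {1..n}"
    and "\<And>l m. l \<in> set u \<Longrightarrow> m \<in> set v \<Longrightarrow> l \<in> {1..n} \<and> \<bar>int l - int m\<bar> > 1"
  shows "\<phi> (x @ u @ v @ y) = \<phi> (x @ v @ u @ y)"
  using assms(1,3,4)
proof (induction v arbitrary: x)
  case (Cons m v)
  have "set u \<subseteq> {1..n}" using Cons.prems(3)[of _ m] by auto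
  then have "\<phi> (x @ u @ m # v @ y) = \<phi> (x @ m # u @ v @ y)"
    using Cons.prems assms(2) by (intro comm_word) auto
  moreover have "\<phi> ((x @ [m]) @ u @ v @ y) = \<phi> ((x @ [m]) @ v @ u @ y)"
    using Cons.prems by (intro Cons.IH) auto
  ultimately show ?case by simp
qed simp

text \<open>A single braid move in the middle, with commutations of distant letters on both sides.
  The letter comes out on the left lowered by one, hence among the generators below k.\<close>

lemma desc_move:
  assumes "set x \<subseteq> {1..n}" "set y \<subseteq> {1..n}" "2 \<le> j" "j < m" "m \<le> k" "k \<le> n"
  shows "\<phi> (x @ desc k j @ m # y) = \<phi> (x @ (m - 1) # desc k j @ y)"
proof -
  let ?D = "desc k (Suc m)" and ?E = "desc (m - 2) j"
  have d: "desc k j = ?D @ m # (m - 1) # ?E"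
    using assms desc_split[of m j k] desc_split[of "m - 1" j "m - 1"] desc_empty[of "m - 1"]
    by (simp add: numeral_2_eq_2)
  have "\<phi> (x @ desc k j @ m # y) = \<phi> ((x @ ?D @ [m, m - 1]) @ ?E @ m # y)"
    by (simp add: d)
  also have "\<dots> = \<phi> ((x @ ?D @ [m, m - 1]) @ m # ?E @ y)"
    using assms by (intro comm_word) auto
  also have "\<dots> = \<phi> ((x @ ?D) @ Suc (m - 1) # (m - 1) # Suc (m - 1) # ?E @ y)"
    using assms by simp
  also have "\<dots> = \<phi> ((x @ ?D) @ (m - 1) # Suc (m - 1) # (m - 1) # ?E @ y)"
    using assms by (intro braid[symmetric]) auto
  also have "\<dots> = \<phi> (x @ ?D @ (m - 1) # m # (m - 1) # ?E @ y)"
    using assms by simp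
  also have "\<dots> = \<phi> (x @ (m - 1) # ?D @ m # (m - 1) # ?E @ y)"
    using assms by (intro comm_word) auto
  finally show ?thesis by (simp add: d)
qed

text \<open>Mirror image of \<open>desc_move\<close>: passing an ascending word to the left raises
  the letter by one.\<close>

lemma asc_move:
  assumes "set x \<subseteq> {1..n}" "set y \<subseteq> {1..n}" "2 \<le> m" "m < i" "i \<le> n"
  shows "\<phi> (x @ asc i @ m # y) = \<phi> (x @ Suc m # asc i @ y)"
proof -
  let ?D = "asc (m - 1)" and ?E = "[Suc (Suc m)..<Suc i]"
  have d: "asc i = ?D @ m # Suc m # ?E"
    using assms asc_split[of m i] by (simp add: upt_conv_Cons)
  have "\<phi> (x @ asc i @ m # y) = \<phi> ((x @ ?D @ [m, Suc m]) @ ?E @ m # y)"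
    unfolding d by simp
  also have "\<dots> = \<phi> ((x @ ?D @ [m, Suc m]) @ m # ?E @ y)"
    using assms by (intro comm_word) auto
  also have "\<dots> = \<phi> ((x @ ?D) @ m # Suc m # m # ?E @ y)"
    by simp
  also have "\<dots> = \<phi> ((x @ ?D) @ Suc m # m # Suc m # ?E @ y)"
    using assms by (intro braid) auto
  also have "\<dots> = \<phi> (x @ ?D @ Suc m # m # Suc m # ?E @ y)"
    by simp
  also have "\<dots> = \<phi> (x @ Suc m # ?D @ m # Suc m # ?E @ y)"
    using assms by (intro comm_word) auto
  finally show ?thesis unfolding d by simp
qed

text \<open>The braid relation of length four says that T_1 commutes with T_2 T_1 T_2; this is
  iterated for powers of T_1.\<close>

lemma power_comm:
  assumes "set x \<subseteq> {1..n}" "set y \<subseteq> {1..n}" "2 \<le> n"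
  shows "\<phi> (x @ replicate a 1 @ 2 # 1 # 2 # y) = \<phi> (x @ 2 # 1 # 2 # replicate a 1 @ y)"
  using assms(2)
proof (induction a arbitrary: y)
  case (Suc a)
  have "\<phi> (x @ replicate (Suc a) 1 @ 2 # 1 # 2 # y) = \<phi> ((x @ replicate a 1) @ 1 # 2 # 1 # 2 # y)"
    by (simp add: replicate_app_Cons_same)
  also have "\<dots> = \<phi> ((x @ replicate a 1) @ 2 # 1 # 2 # 1 # y)"
    using assms Suc.prems by (intro braid4) auto
  also have "\<dots> = \<phi> (x @ 2 # 1 # 2 # replicate a 1 @ 1 # y)"
    using Suc.IH[of "1 # y"] Suc.prems assms by simp
  finally show ?case by (simp add: replicate_app_Cons_same)
qed simp

text \<open>Both sides agree after multiplication by the invertible element \<open>T\<^sub>2\<close> from the right,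
  where the identity only uses that \<open>T\<^sub>1\<close> and \<open>T\<^sub>2T\<^sub>1T\<^sub>2\<close> commute.\<close>

lemma exchange_21a21:
  assumes "set x \<subseteq> {1..n}" "set y \<subseteq> {1..n}" "2 \<le> n"
  shows "\<phi> (x @ 2 # replicate a 1 @ 2 # 1 # y) =
    \<phi> (x @ 1 # 2 # replicate a 1 @ 2 # y) + h * \<phi> (x @ replicate a 1 @ 2 # 1 # y)
    - h * \<phi> (x @ 1 # 2 # replicate a 1 @ y)"
proof -
  let ?E = "replicate a (1::nat)"
  define \<Delta> where "\<Delta> y = \<phi> (x @ 2 # ?E @ 2 # 1 # y) - \<phi> (x @ 1 # 2 # ?E @ 2 # y)
    - h * \<phi> (x @ ?E @ 2 # 1 # y) + h * \<phi> (x @ 1 # 2 # ?E @ y)" for y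
  have *: "\<Delta> (2 # y) = 0" if y: "set y \<subseteq> {1..n}" for y
  proof -
    have "\<phi> (x @ 2 # ?E @ 2 # 1 # 2 # y) = \<phi> (x @ 2 # 2 # 1 # 2 # ?E @ y)"
      using power_comm[of "x @ [2]" y a] assms y by simp
    also have "\<dots> = h * \<phi> (x @ 2 # 1 # 2 # ?E @ y) + \<phi> (x @ 1 # 2 # ?E @ y)"
      using assms y by (intro quad) auto
    finally have 1: "\<phi> (x @ 2 # ?E @ 2 # 1 # 2 # y) =
      h * \<phi> (x @ 2 # 1 # 2 # ?E @ y) + \<phi> (x @ 1 # 2 # ?E @ y)" .
    have 2: "\<phi> (x @ 1 # 2 # ?E @ 2 # 2 # y) = h * \<phi> (x @ 1 # 2 # ?E @ 2 # y) + \<phi> (x @ 1 # 2 # ?E @ y)"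
      using quad[of "x @ 1 # 2 # ?E" y 2] assms y by (auto simp: set_replicate_conv_if)
    have 3: "\<phi> (x @ ?E @ 2 # 1 # 2 # y) = \<phi> (x @ 2 # 1 # 2 # ?E @ y)"
      using power_comm assms y by simp
    show ?thesis unfolding \<Delta>_def 1 2 3 by (simp add: algebra_simps)
  qed
  \<comment> \<open>The quadratic relation in the form 1 = T_2^2 - h T_2: a value is recovered from
    those with two letters and with one letter 2 inserted, where the identity is already
    known.\<close>
  have q: "\<phi> (x @ z @ y) = \<phi> (x @ z @ 2 # 2 # y) - h * \<phi> (x @ z @ 2 # y)"
    if "set z \<subseteq> {1..n}" for z
    using quad[of "x @ z" y 2] assms that by simp
  have E: "set ?E \<subseteq> {1..n}" using assms(3) by (cases a) auto
  have q1: "\<phi> (x @ 2 # ?E @ 2 # 1 # y) =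
      \<phi> (x @ 2 # ?E @ 2 # 1 # 2 # 2 # y) - h * \<phi> (x @ 2 # ?E @ 2 # 1 # 2 # y)"
    using q[of "2 # ?E @ [2, 1]"] E assms(3) by simp
  have q2: "\<phi> (x @ 1 # 2 # ?E @ 2 # y) =
      \<phi> (x @ 1 # 2 # ?E @ 2 # 2 # 2 # y) - h * \<phi> (x @ 1 # 2 # ?E @ 2 # 2 # y)"
    using q[of "1 # 2 # ?E @ [2]"] E assms(3) by simp
  have q3: "\<phi> (x @ ?E @ 2 # 1 # y) =
      \<phi> (x @ ?E @ 2 # 1 # 2 # 2 # y) - h * \<phi> (x @ ?E @ 2 # 1 # 2 # y)"
    using q[of "?E @ [2, 1]"] E assms(3) by simp
  have q4: "\<phi> (x @ 1 # 2 # ?E @ y) =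
      \<phi> (x @ 1 # 2 # ?E @ 2 # 2 # y) - h * \<phi> (x @ 1 # 2 # ?E @ 2 # y)"
    using q[of "1 # 2 # ?E"] E assms(3) by simp
  have "\<Delta> y = \<Delta> (2 # 2 # y) - h * \<Delta> (2 # y)"
    unfolding \<Delta>_def q1 q2 q3 q4 by (simp only: algebra_simps)
  also have "\<dots> = 0" using *[of y] *[of "2 # y"] assms by simp
  finally show ?thesis unfolding \<Delta>_def by (simp add: algebra_simps)
qed

text \<open>Dual form of the statement that the words \<open>v @ g\<close> span a right ideal of the
  algebra of rank k: each case rewrites such a word followed by a letter m into words of the same
  kind.\<close>

lemma coset_step:
  assumes k: "1 \<le> k" "k \<le> n" and r: "r > 0" and y: "set y \<subseteq> {1..n}"
    and V: "\<And>v g. set v \<subseteq> {1..k - 1} \<Longrightarrow> g \<in> coset_words r k \<Longrightarrow> \<phi> (v @ g @ y) = 0"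
    and v: "set v \<subseteq> {1..k - 1}" and g: "g \<in> coset_words r k" and m: "m \<in> {1..k}"
  shows "\<phi> (v @ g @ m # y) = 0"
proof -
  have vn: "set v \<subseteq> {1..n}" if "set v \<subseteq> {1..k - 1}" for v using that k by force
  have VD: "\<phi> (v @ desc k j @ y) = 0" if "set v \<subseteq> {1..k - 1}" "j \<in> {2..Suc k}" for v j
    using V[OF that(1)] that(2) by (auto simp: coset_words_def)
  have VW: "\<phi> (v @ desc k 2 @ replicate a 1 @ asc i @ y) = 0"
    if "set v \<subseteq> {1..k - 1}" "a \<in> {1..<r}" "i \<in> {1..k}" for v a i
    using V[OF that(1), of "desc k 2 @ replicate a 1 @ asc i"] that(2,3)
    unfolding coset_words_def by (simp add: image_iff Bex_def) blast
  \<comment> \<open>The exponents 0 and r lie outside the second family of coset words: the first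
    leaves a descending word, the second is lowered by the cyclotomic relation.\<close>
  have V1: "\<phi> (v @ desc k 2 @ replicate a 1 @ y) = 0" if v: "set v \<subseteq> {1..k - 1}" and "a \<le> r" for v a
  proof -
    have *: "\<phi> (v @ desc k 2 @ replicate a 1 @ y) = 0" if "a < r" for a
    proof (cases "a = 0")
      case True
      then show ?thesis using VD[OF v, of 2] k by simp
    next
      case False
      then show ?thesis using VW[OF v, of a 1] that k by simp
    qed
    show ?thesis
    proof (cases "a = r")
      case True
      have "\<phi> ((v @ desc k 2) @ replicate r 1 @ y) = (\<Sum>j<r. p j * \<phi> ((v @ desc k 2) @ replicate j 1 @ y))"
        using vn[OF v] y k by (intro cyc) auto
      also have "\<dots> = 0" using * by simp
      finally show ?thesis using True by simp
    qed (use * that in auto)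
  qed
  \<comment> \<open>Letters from 3 on pass through \<open>desc k 2\<close> one by one, drop by one,
    and are absorbed into \<open>v\<close>.\<close>
  have push: "\<phi> (v @ desc k 2 @ u @ s) = 0"
    if "\<And>v. set v \<subseteq> {1..k - 1} \<Longrightarrow> \<phi> (v @ desc k 2 @ s) = 0"
      and "set v \<subseteq> {1..k - 1}" "set u \<subseteq> {3..k}" "set s \<subseteq> {1..n}" for v u s
    using that(2,3)
  proof (induction u arbitrary: v)
    case (Cons l u)
    have "\<phi> (v @ desc k 2 @ l # u @ s) = \<phi> (v @ (l - 1) # desc k 2 @ u @ s)"
      using Cons.prems that(4) vn k by (intro desc_move) auto
    also have "\<dots> = \<phi> ((v @ [l - 1]) @ desc k 2 @ u @ s)" by simp
    also have "\<dots> = 0" using Cons.prems by (intro Cons.IH) auto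
    finally show ?case by simp
  qed (use that(1) in simp)
  consider (D) j where "j \<in> {2..Suc k}" "g = desc k j"
    | (W) a i where "a \<in> {1..<r}" "i \<in> {1..k}" "g = desc k 2 @ replicate a 1 @ asc i"
    using g by (auto simp: coset_words_def)
  then show ?thesis
  proof cases
    case D
    have "Suc m < j \<or> Suc m = j \<and> m = 1 \<or> Suc m = j \<and> m \<ge> 2 \<or> m = j \<or> m > j"
      using m by auto
    then consider "Suc m < j" | "Suc m = j" "m = 1" | "Suc m = j" "m \<ge> 2" | "m = j" | "m > j"
      by blast
    then show ?thesis
    proof cases
      case 1
      have "\<phi> (v @ desc k j @ m # y) = \<phi> (v @ m # desc k j @ y)"
        using 1 m k y vn[OF v] D by (intro comm_word) auto
      then show ?thesis using VD[of "v @ [m]" j] v 1 m D by auto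
    next
      case 2
      then show ?thesis using V1[OF v, of 1] D r by (simp add: numeral_2_eq_2)
    next
      case 3
      then show ?thesis using VD[OF v, of m] desc_snoc[of j k] D by auto
    next
      case 4
      have "desc k m = desc k (Suc m) @ [m]" using desc_snoc[of "Suc m" k] m by simp
      moreover have "\<phi> ((v @ desc k (Suc m)) @ m # m # y) =
          h * \<phi> ((v @ desc k (Suc m)) @ m # y) + \<phi> ((v @ desc k (Suc m)) @ y)"
        using 4 D m k y vn[OF v] by (intro quad) auto
      ultimately show ?thesis using VD[OF v, of m] VD[OF v, of "Suc m"] 4 D m by simp
    next
      case 5
      have "\<phi> (v @ desc k j @ m # y) = \<phi> (v @ (m - 1) # desc k j @ y)"
        using 5 m k y vn[OF v] D by (intro desc_move) auto
      moreover have "set (v @ [m - 1]) \<subseteq> {1..k - 1}" using v 5 m D(1) by auto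
      ultimately show ?thesis using VD[of "v @ [m - 1]" j] D by simp
    qed
  next
    case W
    let ?E = "replicate a (1::nat)"
    have "m > Suc i \<or> m = Suc i \<or> m = i \<and> i \<ge> 2 \<or> 2 \<le> m \<and> m < i \<or> m = 1 \<and> i = 1 \<or> m = 1 \<and> i \<ge> 2"
      using m W(2) by auto
    then consider "m > Suc i" | "m = Suc i" | "m = i" "i \<ge> 2" | "2 \<le> m" "m < i" | "m = 1" "i = 1"
      | "m = 1" "i \<ge> 2"
      by blast
    then show ?thesis
    proof cases
      case 1
      have "\<phi> ((v @ desc k 2) @ (?E @ asc i) @ m # y) = \<phi> ((v @ desc k 2) @ m # (?E @ asc i) @ y)"
        using 1 m k y vn[OF v] W by (intro comm_word) auto
      also have "\<dots> = \<phi> (v @ desc k 2 @ m # ?E @ asc i @ y)" by simp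
      also have "\<dots> = \<phi> (v @ (m - 1) # desc k 2 @ ?E @ asc i @ y)"
        using 1 m k y vn[OF v] W by (intro desc_move) auto
      moreover have "set (v @ [m - 1]) \<subseteq> {1..k - 1}" using v 1 m by auto
      ultimately show ?thesis using VW[of "v @ [m - 1]" a i] W by simp
    next
      case 2
      then show ?thesis using VW[OF v, of a m] asc_Suc[of i] W m by simp
    next
      case 3
      have a: "asc i = asc (i - 1) @ [i]" using asc_Suc[of "i - 1"] 3 by simp
      have "\<phi> ((v @ desc k 2 @ ?E @ asc (i - 1)) @ i # i # y) =
          h * \<phi> ((v @ desc k 2 @ ?E @ asc (i - 1)) @ i # y) + \<phi> ((v @ desc k 2 @ ?E @ asc (i - 1)) @ y)"
        using 3 W m k y vn[OF v] by (intro quad) auto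
      then show ?thesis using VW[OF v, of a i] VW[OF v, of a "i - 1"] 3 W m a by (auto simp: Suc_le_eq)
    next
      case 4
      have "\<phi> ((v @ desc k 2 @ ?E) @ asc i @ m # y) = \<phi> ((v @ desc k 2 @ ?E) @ Suc m # asc i @ y)"
        using 4 m k y vn[OF v] W by (intro asc_move) auto
      also have "\<dots> = \<phi> ((v @ desc k 2) @ ?E @ Suc m # asc i @ y)" by simp
      also have "\<dots> = \<phi> ((v @ desc k 2) @ Suc m # ?E @ asc i @ y)"
        using 4 m k y vn[OF v] W by (intro comm_word) auto
      also have "\<dots> = \<phi> (v @ desc k 2 @ Suc m # ?E @ asc i @ y)" by simp
      also have "\<dots> = \<phi> (v @ (Suc m - 1) # desc k 2 @ ?E @ asc i @ y)"
        using 4 m k y vn[OF v] W by (intro desc_move) auto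
      finally show ?thesis using VW[of "v @ [m]" a i] v 4 W by auto
    next
      case 5
      then show ?thesis using V1[OF v, of "Suc a"] W by (simp add: replicate_app_Cons_same)
    next
      \<comment> \<open>The hard case: the letter 1 commutes with 3, ..., i and meets 2 1^a 2. Of
        the three words given by \<open>exchange_21a21\<close>, the first and the last let their
        leading 1 move left into \<open>v\<close>, and the middle one moves 1^a there. In the last
        two the letters from 3 on are then pushed through the descending word.\<close>
      case 6
      let ?F = "[3..<Suc i]"
      have n2: "2 \<le> n" using 6 W k by simp
      have v1: "set (v @ [1]) \<subseteq> {1..k - 1}" "set (v @ ?E) \<subseteq> {1..k - 1}" "set (v @ [1]) \<subseteq> {1..k - 1}"
        using v 6 W by auto
      have ai: "asc i = 2 # ?F" using 6 by (simp add: asc_def upt_conv_Cons)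
      have d: "desc k 2 = desc k 3 @ [2]" using desc_snoc[of 3 k] 6 W by simp
      have F: "set ?F \<subseteq> {3..k}" using W by auto
      have "\<phi> (v @ g @ m # y) = \<phi> ((v @ desc k 2 @ ?E @ [2]) @ ?F @ 1 # y)"
        using 6 W ai by simp
      also have "\<dots> = \<phi> ((v @ desc k 2 @ ?E @ [2]) @ 1 # ?F @ y)"
        using k y vn[OF v] W n2 by (intro comm_word) auto
      also have "\<dots> = \<phi> ((v @ desc k 3) @ 2 # ?E @ 2 # 1 # ?F @ y)" by (simp add: d)
      also have "\<dots> = \<phi> ((v @ desc k 3) @ 1 # 2 # ?E @ 2 # ?F @ y)
          + h * \<phi> ((v @ desc k 3) @ ?E @ 2 # 1 # ?F @ y) - h * \<phi> ((v @ desc k 3) @ 1 # 2 # ?E @ ?F @ y)"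
        using k y vn[OF v] W n2 by (intro exchange_21a21) auto
      also have "\<phi> ((v @ desc k 3) @ 1 # 2 # ?E @ 2 # ?F @ y) = 0"
      proof -
        have "\<phi> (v @ desc k 3 @ 1 # 2 # ?E @ 2 # ?F @ y) = \<phi> (v @ 1 # desc k 3 @ 2 # ?E @ 2 # ?F @ y)"
          using k y vn[OF v] W n2 by (intro comm_word) auto
        also have "\<dots> = \<phi> ((v @ [1]) @ desc k 2 @ ?E @ asc i @ y)" by (simp add: d ai)
        finally show ?thesis using VW[OF v1(1), of a i] W by simp
      qed
      also have "\<phi> ((v @ desc k 3) @ ?E @ 2 # 1 # ?F @ y) = 0"
      proof -
        have "\<phi> ((v @ desc k 3) @ ?E @ 2 # 1 # ?F @ y) = \<phi> (v @ desc k 3 @ ?E @ 2 # 1 # ?F @ y)" by simp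
        also have "\<dots> = \<phi> (v @ ?E @ desc k 3 @ 2 # 1 # ?F @ y)"
          using k y vn[OF v] W n2 by (intro comm_word_letters) auto
        also have "\<dots> = \<phi> ((v @ ?E @ desc k 2) @ 1 # ?F @ y)" by (simp add: d)
        also have "\<dots> = \<phi> ((v @ ?E @ desc k 2) @ ?F @ 1 # y)"
          using k y vn[OF v] W n2 by (intro comm_word[symmetric]) auto
        also have "\<dots> = \<phi> ((v @ ?E) @ desc k 2 @ ?F @ 1 # y)" by simp
        also have "\<dots> = 0"
          using push[OF _ v1(2) F, of "1 # y"] V1[of _ 1] r y n2 by simp
        finally show ?thesis .
      qed
      also have "\<phi> ((v @ desc k 3) @ 1 # 2 # ?E @ ?F @ y) = 0"
      proof -
        have "\<phi> (v @ desc k 3 @ 1 # 2 # ?E @ ?F @ y) = \<phi> (v @ 1 # desc k 3 @ 2 # ?E @ ?F @ y)"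
          using k y vn[OF v] W n2 by (intro comm_word) auto
        also have "\<dots> = \<phi> ((v @ 1 # desc k 2) @ ?E @ ?F @ y)" by (simp add: d)
        also have "\<dots> = \<phi> ((v @ 1 # desc k 2) @ ?F @ ?E @ y)"
          using k y vn[OF v] W n2 by (intro comm_word_letters) auto
        also have "\<dots> = \<phi> ((v @ [1]) @ desc k 2 @ ?F @ ?E @ y)" by simp
        also have "\<dots> = 0"
          using push[OF _ v1(1) F, of "?E @ y"] V1[of _ a] W y n2 by auto
        finally show ?thesis by simp
      qed
      finally show ?thesis by simp
    qed
  qed
qed

end

context hecke_word_fun begin

text \<open>By induction on the rank, the functional vanishes on \<open>v @ g @ y\<close> for all
  words \<open>v\<close> of lower rank and all coset words \<open>g\<close>. Then
  \<open>coset_step\<close> lets the letters of \<open>w\<close> be inserted from right to left, and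
  the empty coset word recovers \<open>w\<close> itself. So a functional is determined by its values
  on normal words.\<close>

theorem vanish_on_normal_words:
  assumes r: "r > 0" and "k \<le> n" "set y \<subseteq> {1..n}"
    and "\<And>b. b \<in> normal_words r k \<Longrightarrow> \<phi> (b @ y) = 0" and "set w \<subseteq> {1..k}"
  shows "\<phi> (w @ y) = 0"
  using assms(2-5)
proof (induction k arbitrary: w y)
  case (Suc k)
  define N where "N y \<longleftrightarrow> (\<forall>v g. set v \<subseteq> {1..k} \<longrightarrow> g \<in> coset_words r (Suc k) \<longrightarrow> \<phi> (v @ g @ y) = 0)" for y
  have sub: "set g \<subseteq> {1..n}" if "g \<in> coset_words r (Suc k)" for g
  proof -
    have "set g \<subseteq> {1..Suc k}"
      using that unfolding coset_words_def by (auto simp: set_replicate_conv_if split: if_splits)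
    then show ?thesis using Suc.prems(1) by auto
  qed
  have "N y" unfolding N_def
  proof (intro allI impI)
    fix v g assume v: "set v \<subseteq> {1..k}" and g: "g \<in> coset_words r (Suc k)"
    have "\<phi> (b @ (g @ y)) = 0" if "b \<in> normal_words r k" for b
    proof -
      have "b @ g \<in> normal_words r (Suc k)"
        unfolding normal_words.simps using that g by (intro image_eqI[of _ _ "(b, g)"]) simp_all
      from Suc.prems(3)[OF this] show ?thesis by simp
    qed
    moreover have "set (g @ y) \<subseteq> {1..n}" using sub[OF g] Suc.prems(2) by simp
    ultimately show "\<phi> (v @ g @ y) = 0"
      using Suc.IH[of "g @ y" v] Suc.prems(1) v by simp
  qed
  have "N (w @ y)" using Suc.prems(4)
  proof (induction w)
    case (Cons m w)
    have "{1..Suc k} \<subseteq> {1..n}" using Suc.prems(1) by simp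
    then have wy: "set (w @ y) \<subseteq> {1..n}" using Cons.prems Suc.prems(2) by auto
    have N: "\<phi> (v @ g @ w @ y) = 0" if "set v \<subseteq> {1..k}" "g \<in> coset_words r (Suc k)" for v g
      using Cons.IH Cons.prems that unfolding N_def by simp
    show ?case unfolding N_def append_Cons
    proof (intro allI impI)
      fix v g assume "set v \<subseteq> {1..k}" "g \<in> coset_words r (Suc k)"
      then show "\<phi> (v @ g @ m # w @ y) = 0"
        using Cons.prems N coset_step[OF _ Suc.prems(1) r wy, of v g m] by simp
    qed
  qed (use \<open>N y\<close> in simp)
  moreover have "[] \<in> coset_words r (Suc k)"
    unfolding coset_words_def by (intro UnI1 image_eqI[of _ _ "Suc (Suc k)"]) simp_all
  moreover have "set [] \<subseteq> {1..k}" by simp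
  ultimately have "\<phi> ([] @ [] @ w @ y) = 0"
    unfolding N_def by blast
  then show ?case by simp
next
  case 0
  then show ?case by simp
qed

end

section \<open>Tuples of Young diagrams: order ideals, tableaux and their number\<close>

section \<open>Diagrams as down-closed sets of boxes\<close>

definition box_le :: "diagram_box \<Rightarrow> diagram_box \<Rightarrow> bool" where
  "box_le = (\<lambda>(i, x, y) (j, x', y'). i = j \<and> x \<le> x' \<and> y \<le> y')"

definition down_closed :: "diagram_box set \<Rightarrow> bool" where
  "down_closed D \<longleftrightarrow> (\<forall>b\<in>D. \<forall>b'. box_le b' b \<longrightarrow> b' \<in> D)"

text \<open>Diagrams are taken as order ideals of boxes rather than lists of row lengths, because
  the count of tableaux needs unions and intersections of diagrams.\<close>

definition diagrams :: "nat \<Rightarrow> nat \<Rightarrow> diagram_box set set" where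
  "diagrams r n = {D. finite D \<and> card D = n \<and> fst ` D \<subseteq> {..<r} \<and> down_closed D}"

definition std :: "nat \<Rightarrow> diagram_box set \<Rightarrow> tableau set" where
  "std n D = {L \<in> extensional {1..n}. bij_betw L {1..n} D \<and>
     (\<forall>k\<in>{1..n}. \<forall>l\<in>{1..n}. box_le (L k) (L l) \<longrightarrow> k \<le> l)}"

lemma box_le_refl [simp]: "box_le b b"
  by (auto simp: box_le_def)

lemma down_closedD: "down_closed D \<Longrightarrow> b \<in> D \<Longrightarrow> box_le b' b \<Longrightarrow> b' \<in> D"
  unfolding down_closed_def by blast

lemma down_closed_Un: "down_closed D \<Longrightarrow> down_closed E \<Longrightarrow> down_closed (D \<union> E)"
  and down_closed_Int: "down_closed D \<Longrightarrow> down_closed E \<Longrightarrow> down_closed (D \<inter> E)"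
  by (auto simp: down_closed_def)

lemma finite_diagrams: "finite (diagrams r n)"
proof (rule finite_subset)
  show "diagrams r n \<subseteq> Pow ({..<r} \<times> {..<n} \<times> {..<n})"
  proof clarify
    fix D i x y assume D: "D \<in> diagrams r n" and b: "(i, x, y) \<in> D"
    have "(\<lambda>x'. (i, x', y)) ` {..x} \<subseteq> D" "(\<lambda>y'. (i, x, y')) ` {..y} \<subseteq> D"
      using D b by (auto simp: diagrams_def box_le_def intro: down_closedD)
    then have "card ((\<lambda>x'. (i, x', y)) ` {..x}) \<le> n" "card ((\<lambda>y'. (i, x, y')) ` {..y}) \<le> n"
      using D by (auto simp: diagrams_def intro!: card_mono)
    then have "Suc x \<le> n" "Suc y \<le> n"
      by (simp_all add: card_image inj_on_def)
    then show "i \<in> {..<r} \<and> (x, y) \<in> {..<n} \<times> {..<n}"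
      using D b by (auto simp: diagrams_def)
  qed
qed simp

lemma diagrams_cover_iff:
  assumes "D \<in> diagrams r n" "E \<in> diagrams r (Suc n)" "D \<subseteq> E"
  obtains b where "b \<notin> D" "E = insert b D"
proof -
  have "card (E - D) = 1" using assms by (auto simp: diagrams_def card_Diff_subset)
  then obtain b where "E - D = {b}" using card_1_singletonE by blast
  then show ?thesis using that[of b] assms(3) by blast
qed

definition addable :: "nat \<Rightarrow> diagram_box set \<Rightarrow> diagram_box set" where
  "addable r D = {b. b \<notin> D \<and> fst b < r \<and> down_closed (insert b D)}"

definition removable :: "diagram_box set \<Rightarrow> diagram_box set" where
  "removable D = {b \<in> D. down_closed (D - {b})}"

lemma finite_row:
  assumes "finite D"
  shows "finite {y. (i, x, y) \<in> D}"
proof -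
  have "(\<lambda>y. (i, x, y)) ` {y. (i, x, y) \<in> D} \<subseteq> D" by auto
  then have "finite ((\<lambda>y. (i, x, y)) ` {y. (i, x, y) \<in> D})" using assms finite_subset by blast
  then show ?thesis by (rule finite_imageD) (auto simp: inj_on_def)
qed

definition row_len :: "diagram_box set \<Rightarrow> nat \<Rightarrow> nat \<Rightarrow> nat" where
  "row_len D i x = card {y. (i, x, y) \<in> D}"

lemma mem_iff_row_len:
  assumes "finite D" "down_closed D"
  shows "(i, x, y) \<in> D \<longleftrightarrow> y < row_len D i x"
proof -
  let ?Y = "{y. (i, x, y) \<in> D}"
  have fin: "finite ?Y" by (rule finite_row[OF assms(1)])
  have down: "y' \<in> ?Y" if "y \<in> ?Y" "y' \<le> y" for y y'
    using down_closedD[OF assms(2), of "(i, x, y)" "(i, x, y')"] that by (simp add: box_le_def)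
  show ?thesis
  proof
    assume "(i, x, y) \<in> D"
    then have "{..y} \<subseteq> ?Y" using down by blast
    then have "card {..y} \<le> card ?Y" using fin by (rule card_mono[rotated])
    then show "y < row_len D i x" by (simp add: row_len_def)
  next
    assume y: "y < row_len D i x"
    show "(i, x, y) \<in> D"
    proof (rule ccontr)
      assume "(i, x, y) \<notin> D"
      then have "?Y \<subseteq> {..<y}" using down not_less by blast
      then have "card ?Y \<le> y" using card_mono[of "{..<y}" ?Y] by simp
      then show False using y by (simp add: row_len_def)
    qed
  qed
qed

lemma row_len_antimono:
  assumes "finite D" "down_closed D" "x \<le> x'"
  shows "row_len D i x' \<le> row_len D i x"
  unfolding row_len_def
proof (rule card_mono[OF finite_row[OF assms(1)]], clarify)
  fix y assume "(i, x', y) \<in> D"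
  then show "(i, x, y) \<in> D"
    using down_closedD[OF assms(2), of "(i, x', y)" "(i, x, y)"] assms(3) by (simp add: box_le_def)
qed

lemma addable_iff:
  assumes "finite D" "down_closed D"
  shows "(i, x, y) \<in> addable r D \<longleftrightarrow> i < r \<and> y = row_len D i x \<and>
    (x = 0 \<or> row_len D i x < row_len D i (x - 1))"
proof -
  note mem = mem_iff_row_len[OF assms]
  note anti = row_len_antimono[OF assms]
  show ?thesis
  proof
    assume "(i, x, y) \<in> addable r D"
    then have *: "\<not> y < row_len D i x" "i < r" "down_closed (insert (i, x, y) D)"
      by (auto simp: addable_def mem)
    have "y = row_len D i x"
    proof (rule ccontr)
      assume "y \<noteq> row_len D i x"
      then have "y - 1 < y" "\<not> y - 1 < row_len D i x" using *(1) by auto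
      then show False
        using down_closedD[OF *(3), of "(i, x, y)" "(i, x, y - 1)"] by (simp add: mem box_le_def)
    qed
    moreover have "row_len D i x < row_len D i (x - 1)" if "x \<noteq> 0"
      using down_closedD[OF *(3), of "(i, x, y)" "(i, x - 1, y)"] that \<open>y = row_len D i x\<close>
      by (cases x) (auto simp: mem box_le_def)
    ultimately show "i < r \<and> y = row_len D i x \<and> (x = 0 \<or> row_len D i x < row_len D i (x - 1))"
      using *(2) by blast
  next
    assume *: "i < r \<and> y = row_len D i x \<and> (x = 0 \<or> row_len D i x < row_len D i (x - 1))"
    have "b' \<in> insert (i, x, y) D" if "b \<in> insert (i, x, y) D" "box_le b' b" for b b'
    proof (cases "b \<in> D")
      case True
      then show ?thesis using down_closedD[OF assms(2)] that(2) by blast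
    next
      case False
      then have "box_le b' (i, x, y)" using that by simp
      then obtain x' y' where b': "b' = (i, x', y')" "x' \<le> x" "y' \<le> y"
        by (cases b') (auto simp: box_le_def)
      have "y' < row_len D i x'" if "b' \<noteq> (i, x, y)"
      proof (cases "x' = x")
        case True
        then show ?thesis using that b' * by auto
      next
        case False
        then have "x \<noteq> 0" "row_len D i (x - 1) \<le> row_len D i x'" using b' by (auto intro: anti)
        then show ?thesis using * b' by auto
      qed
      then show ?thesis using b' mem by auto
    qed
    then have "down_closed (insert (i, x, y) D)" unfolding down_closed_def by blast
    then show "(i, x, y) \<in> addable r D" using * by (simp add: addable_def mem)
  qed
qed

lemma removable_iff:
  assumes "finite D" "down_closed D"
  shows "(i, x, y) \<in> removable D \<longleftrightarrow> Suc y = row_len D i x \<and> row_len D i (Suc x) < row_len D i x"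
proof -
  note mem = mem_iff_row_len[OF assms]
  note anti = row_len_antimono[OF assms]
  show ?thesis
  proof
    assume "(i, x, y) \<in> removable D"
    then have *: "y < row_len D i x" "down_closed (D - {(i, x, y)})"
      by (auto simp: removable_def mem)
    have "\<not> Suc y < row_len D i x"
      using down_closedD[OF *(2), of "(i, x, Suc y)" "(i, x, y)"] by (auto simp: mem box_le_def)
    moreover have "\<not> y < row_len D i (Suc x)"
      using down_closedD[OF *(2), of "(i, Suc x, y)" "(i, x, y)"] by (auto simp: mem box_le_def)
    ultimately show "Suc y = row_len D i x \<and> row_len D i (Suc x) < row_len D i x" using *(1) by auto
  next
    assume *: "Suc y = row_len D i x \<and> row_len D i (Suc x) < row_len D i x"
    have "b' \<noteq> (i, x, y)" if b: "b \<in> D" "b \<noteq> (i, x, y)" "box_le b' b" for b b'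
    proof
      assume "b' = (i, x, y)"
      then obtain x' y' where b': "b = (i, x', y')" "x \<le> x'" "y \<le> y'" using b by (auto simp: box_le_def)
      show False
      proof (cases "x' = x")
        case True
        then show ?thesis using b b' * mem by auto
      next
        case False
        then have "row_len D i x' \<le> row_len D i (Suc x)" using b' by (intro anti) auto
        then show ?thesis using b b' * mem by auto
      qed
    qed
    then have "down_closed (D - {(i, x, y)})"
      using down_closedD[OF assms(2)] unfolding down_closed_def by blast
    then show "(i, x, y) \<in> removable D"
      using * by (simp add: removable_def mem)
  qed
qed

text \<open>Every removable corner yields an addable position at the end of the next row. All
  addable boxes outside the top rows arise exactly once in this way, and the r top rows contribute
  one more each.\<close>

lemma card_addable:
  assumes "D \<in> diagrams r n"
  shows "card (addable r D) = card (removable D) + r" "finite (addable r D)" "finite (removable D)"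
proof -
  have D: "finite D" "down_closed D" "fst ` D \<subseteq> {..<r}" using assms by (auto simp: diagrams_def)
  note add = addable_iff[OF D(1,2)]
  note rem = removable_iff[OF D(1,2)]
  let ?A = "(\<lambda>i. (i, 0::nat, row_len D i 0)) ` {..<r}"
  let ?B = "(\<lambda>(i, x, y). (i, Suc x, row_len D i (Suc x))) ` removable D"
  have "addable r D = ?A \<union> ?B"
  proof (intro equalityI subsetI)
    fix b assume b: "b \<in> addable r D"
    obtain i x y where bi: "b = (i, x, y)" by (cases b)
    show "b \<in> ?A \<union> ?B"
    proof (cases x)
      case 0
      then show ?thesis using b bi add by auto
    next
      case (Suc x')
      then have "(i, x', row_len D i x' - 1) \<in> removable D" using b bi add rem by auto
      then show ?thesis using Suc b bi add by (intro UnI2 image_eqI[of _ _ "(i, x', row_len D i x' - 1)"]) auto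
    qed
  next
    fix b assume "b \<in> ?A \<union> ?B"
    moreover have "i < r" if "(i, x, y) \<in> removable D" for i x y
      using that D(3) by (auto simp: removable_def)
    ultimately show "b \<in> addable r D" by (auto simp: add rem)
  qed
  moreover have fR: "finite (removable D)" using D(1) by (auto simp: removable_def)
  moreover have "card (?A \<union> ?B) = card ?A + card ?B" by (rule card_Un_disjoint) (use fR in auto)
  moreover have "card ?A = r" by (subst card_image) (auto simp: inj_on_def)
  moreover have "inj_on (\<lambda>(i, x, y). (i, Suc x, row_len D i (Suc x))) (removable D)"
    by (auto simp: inj_on_def rem)
  ultimately show "card (addable r D) = card (removable D) + r" "finite (addable r D)" "finite (removable D)"
    by (auto simp: card_image)
qed

definition up_set :: "nat \<Rightarrow> nat \<Rightarrow> diagram_box set \<Rightarrow> diagram_box set set" where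
  "up_set r n D = {E \<in> diagrams r (Suc n). D \<subseteq> E}"

definition down_set :: "nat \<Rightarrow> nat \<Rightarrow> diagram_box set \<Rightarrow> diagram_box set set" where
  "down_set r n E = {D \<in> diagrams r n. D \<subseteq> E}"

lemma up_set_eq:
  assumes "D \<in> diagrams r n"
  shows "up_set r n D = (\<lambda>b. insert b D) ` addable r D"
proof (intro equalityI subsetI)
  fix E assume "E \<in> up_set r n D"
  then have E: "E \<in> diagrams r (Suc n)" "D \<subseteq> E" by (auto simp: up_set_def)
  obtain b where b: "b \<notin> D" "E = insert b D" using diagrams_cover_iff[OF assms E] .
  then have "b \<in> addable r D" "E = insert b D" using E by (auto simp: addable_def diagrams_def)
  then show "E \<in> (\<lambda>b. insert b D) ` addable r D" by blast
next
  fix E assume "E \<in> (\<lambda>b. insert b D) ` addable r D"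
  then obtain b where "b \<notin> D" "fst b < r" "down_closed (insert b D)" "E = insert b D"
    by (auto simp: addable_def)
  then show "E \<in> up_set r n D" using assms by (simp add: up_set_def diagrams_def) blast
qed

lemma down_set_eq:
  assumes "E \<in> diagrams r (Suc n)"
  shows "down_set r n E = (\<lambda>b. E - {b}) ` removable E"
proof (intro equalityI subsetI)
  fix D assume "D \<in> down_set r n E"
  then have D: "D \<in> diagrams r n" "D \<subseteq> E" by (auto simp: down_set_def)
  obtain b where b: "b \<notin> D" "E = insert b D" using diagrams_cover_iff[OF D(1) assms D(2)] .
  then have "E - {b} = D" by auto
  moreover have "b \<in> removable E"
    using b D(1) \<open>E - {b} = D\<close> by (simp add: removable_def diagrams_def)
  ultimately show "D \<in> (\<lambda>b. E - {b}) ` removable E" by blast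
next
  fix D assume "D \<in> (\<lambda>b. E - {b}) ` removable E"
  then obtain b where "b \<in> E" "down_closed (E - {b})" "D = E - {b}" by (auto simp: removable_def)
  moreover have "fst ` (E - {b}) \<subseteq> fst ` E" by blast
  ultimately show "D \<in> down_set r n E"
    using assms by (auto simp add: down_set_def diagrams_def simp del: split_paired_All)
qed

text \<open>This is the diagonal part of the commutation relation between adding and removing a box;
  the off-diagonal part is the matching of neighbours in \<open>sum_up_set\<close>.\<close>

lemma card_up_set:
  assumes "D \<in> diagrams r (Suc n)"
  shows "card (up_set r (Suc n) D) = card (down_set r n D) + r"
proof -
  have "card (up_set r (Suc n) D) = card (addable r D)"
    unfolding up_set_eq[OF assms] by (intro card_image inj_onI) (unfold addable_def, blast)
  moreover have "card (down_set r n D) = card (removable D)"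
    unfolding down_set_eq[OF assms] by (intro card_image inj_onI) (unfold removable_def, blast)
  ultimately show ?thesis using card_addable[OF assms] by simp
qed

section \<open>Counting standard tableaux\<close>

lemma std_0: "std 0 {} = {\<lambda>k. undefined}"
  by (auto simp: std_def extensional_def bij_betw_def)

lemma std_bij: "L \<in> std n D \<Longrightarrow> bij_betw L {1..n} D"
  and std_extensional: "L \<in> std n D \<Longrightarrow> L \<in> extensional {1..n}"
  and std_le: "L \<in> std n D \<Longrightarrow> k \<in> {1..n} \<Longrightarrow> l \<in> {1..n} \<Longrightarrow> box_le (L k) (L l) \<Longrightarrow> k \<le> l"
  unfolding std_def by blast+

lemma stdI:
  assumes "L \<in> extensional {1..n}" "bij_betw L {1..n} D"
    and "\<And>k l. k \<in> {1..n} \<Longrightarrow> l \<in> {1..n} \<Longrightarrow> box_le (L k) (L l) \<Longrightarrow> k \<le> l"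
  shows "L \<in> std n D"
  using assms unfolding std_def by blast

lemma std_last_removable:
  assumes "E \<in> diagrams r (Suc n)" "L \<in> std (Suc n) E"
  shows "L (Suc n) \<in> removable E" "restrict L {1..n} \<in> std n (E - {L (Suc n)})"
proof -
  note L = std_bij[OF assms(2)] std_le[OF assms(2)]
  have inE: "L (Suc n) \<in> E" using bij_betwE[OF L(1)] by simp
  have "b' \<noteq> L (Suc n)" if "b \<in> E" "b \<noteq> L (Suc n)" "box_le b' b" for b b'
  proof
    assume b': "b' = L (Suc n)"
    obtain k where k: "k \<in> {1..Suc n}" "b = L k" using L(1) \<open>b \<in> E\<close> by (auto simp: bij_betw_def)
    have "Suc n \<le> k" using L(2)[of "Suc n" k] k that(3) b' by simp
    then show False using k that(2) by auto
  qed
  then show "L (Suc n) \<in> removable E"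
    using inE assms(1) unfolding removable_def diagrams_def down_closed_def by blast
  have "bij_betw L ({1..Suc n} - {Suc n}) (E - {L (Suc n)})"
    using L(1) by (intro bij_betw_DiffI) (auto simp: bij_betw_def)
  moreover have "{1..Suc n} - {Suc n} = {1..n}" by auto
  ultimately have "bij_betw L {1..n} (E - {L (Suc n)})" by metis
  then have "bij_betw (restrict L {1..n}) {1..n} (E - {L (Suc n)})"
    by (rule bij_betw_cong[THEN iffD1, rotated]) simp
  then show "restrict L {1..n} \<in> std n (E - {L (Suc n)})"
  proof (rule stdI[rotated])
    fix k l assume "k \<in> {1..n}" "l \<in> {1..n}" "box_le (restrict L {1..n} k) (restrict L {1..n} l)"
    then show "k \<le> l" using L(2)[of k l] by simp
  qed simp
qed

lemma std_extend:
  assumes "E \<in> diagrams r (Suc n)" "b \<in> removable E" "M \<in> std n (E - {b})"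
  shows "M(Suc n := b) \<in> std (Suc n) E"
proof -
  let ?L = "M(Suc n := b)"
  note M = std_bij[OF assms(3)] std_extensional[OF assms(3)] std_le[OF assms(3)]
  have b: "b \<in> E" "down_closed (E - {b})" using assms(2) by (auto simp: removable_def)
  have "bij_betw ?L {1..n} (E - {b})" using M(1)
    by (rule bij_betw_cong[THEN iffD1, rotated]) simp
  then have "bij_betw ?L (insert (Suc n) {1..n}) (insert b (E - {b}))"
    using notIn_Un_bij_betw[of "Suc n" "{1..n}" ?L "E - {b}"] by simp
  moreover have "insert (Suc n) {1..n} = {1..Suc n}" "insert b (E - {b}) = E" using b by auto
  ultimately have "bij_betw ?L {1..Suc n} E" by simp
  moreover have "k \<le> l" if kl: "k \<in> {1..Suc n}" "l \<in> {1..Suc n}" "box_le (?L k) (?L l)" for k l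
  proof -
    have "M l \<in> E - {b}" if "l \<in> {1..n}" for l using bij_betwE[OF M(1)] that by blast
    then have "\<not> box_le b (M l)" if "l \<in> {1..n}" for l
      using down_closedD[OF b(2)] that by blast
    then show ?thesis using kl M(3)[of k l] by (auto split: if_splits)
  qed
  moreover have "?L \<in> extensional {1..Suc n}" using M(2) by (auto simp: extensional_def)
  ultimately show ?thesis by (intro stdI)
qed

lemma finite_std: "finite D \<Longrightarrow> finite (std n D)"
proof (rule finite_subset)
  show "std n D \<subseteq> {1..n} \<rightarrow>\<^sub>E D" unfolding std_def PiE_def by (auto simp: bij_betw_def)
qed (intro finite_PiE, auto)

lemma card_std_Suc:
  assumes "E \<in> diagrams r (Suc n)"
  shows "card (std (Suc n) E) = (\<Sum>D\<in>down_set r n E. card (std n D))"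
proof -
  have fE: "finite E" using assms by (simp add: diagrams_def)
  have fR: "finite (removable E)" using fE by (simp add: removable_def)
  have "bij_betw (\<lambda>L. (L (Suc n), restrict L {1..n})) (std (Suc n) E)
      (Sigma (removable E) (\<lambda>b. std n (E - {b})))"
  proof (rule bij_betw_byWitness[where f' = "\<lambda>(b, M). M(Suc n := b)"])
    show "\<forall>L\<in>std (Suc n) E. (case (L (Suc n), restrict L {1..n}) of (b, M) \<Rightarrow> M(Suc n := b)) = L"
    proof
      fix L assume "L \<in> std (Suc n) E"
      then have "L k = undefined" if "k \<notin> {1..Suc n}" for k
        using std_extensional[of L] that unfolding extensional_def by blast
      then show "(case (L (Suc n), restrict L {1..n}) of (b, M) \<Rightarrow> M(Suc n := b)) = L"
        by (auto simp: fun_eq_iff)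
    qed
    show "\<forall>p\<in>Sigma (removable E) (\<lambda>b. std n (E - {b})).
        ((case p of (b, M) \<Rightarrow> M(Suc n := b)) (Suc n), restrict (case p of (b, M) \<Rightarrow> M(Suc n := b)) {1..n}) = p"
    proof
      fix p assume "p \<in> Sigma (removable E) (\<lambda>b. std n (E - {b}))"
      then obtain b M where p: "p = (b, M)" "M \<in> std n (E - {b})" by blast
      then have "M k = undefined" if "k \<notin> {1..n}" for k
        using std_extensional[of M] that unfolding extensional_def by blast
      then show "((case p of (b, M) \<Rightarrow> M(Suc n := b)) (Suc n),
          restrict (case p of (b, M) \<Rightarrow> M(Suc n := b)) {1..n}) = p"
        using p(1) by (auto simp: fun_eq_iff)
    qed
    show "(\<lambda>L. (L (Suc n), restrict L {1..n})) ` std (Suc n) E \<subseteq> Sigma (removable E) (\<lambda>b. std n (E - {b}))"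
      using std_last_removable[OF assms] by blast
    show "(\<lambda>(b, M). M(Suc n := b)) ` Sigma (removable E) (\<lambda>b. std n (E - {b})) \<subseteq> std (Suc n) E"
    proof (rule image_subsetI)
      fix p assume "p \<in> Sigma (removable E) (\<lambda>b. std n (E - {b}))"
      then obtain b M where "p = (b, M)" "b \<in> removable E" "M \<in> std n (E - {b})" by blast
      then show "(case p of (b, M) \<Rightarrow> M(Suc n := b)) \<in> std (Suc n) E"
        using std_extend[OF assms] by simp
    qed
  qed
  then have "card (std (Suc n) E) = card (Sigma (removable E) (\<lambda>b. std n (E - {b})))"
    by (rule bij_betw_same_card)
  also have "\<dots> = (\<Sum>b\<in>removable E. card (std n (E - {b})))"
    using fR fE by (intro card_SigmaI) (auto intro: finite_std)
  also have "\<dots> = (\<Sum>D\<in>down_set r n E. card (std n D))"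
    unfolding down_set_eq[OF assms]
    by (subst sum.reindex) (unfold inj_on_def removable_def, blast, simp)
  finally show ?thesis .
qed

text \<open>From D the same neighbours D' are reached by a step up and a step down, through the
  union, as by a step down and a step up, through the intersection. Only the returns to D itself
  differ, by r, so the claim for D follows from the claims for the diagrams below it.\<close>

lemma sum_up_set:
  assumes "D \<in> diagrams r n"
  shows "(\<Sum>E\<in>up_set r n D. card (std (Suc n) E)) = r * Suc n * card (std n D)"
  using assms
proof (induction n arbitrary: D)
  case 0
  then have D: "D = {}" by (auto simp: diagrams_def)
  have d: "diagrams r 0 = {{}}" by (auto simp: diagrams_def down_closed_def)
  have "card (up_set r 0 {}) = r"
    unfolding up_set_eq[OF 0[unfolded D]]
    using card_addable[OF 0[unfolded D]]
    by (subst card_image) (auto simp: inj_on_def removable_def)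
  moreover have "card (std (Suc 0) E) = 1" if "E \<in> up_set r 0 {}" for E
  proof -
    have "down_set r 0 E = {{}}" by (auto simp: down_set_def d)
    then show ?thesis using card_std_Suc[of E r 0] that by (simp add: up_set_def std_0)
  qed
  ultimately show ?case by (simp add: D std_0)
next
  case (Suc m)
  let ?f = "\<lambda>D. card (std (Suc m) D)"
  have fin: "finite D" "card D = Suc m" using Suc.prems by (auto simp: diagrams_def)
  have fup: "finite (up_set r k D')" and fdown: "finite (down_set r k D')" for k D'
    using finite_diagrams by (simp_all add: up_set_def down_set_def)
  define P where "P = {D' \<in> diagrams r (Suc m). D' \<noteq> D \<and> D \<union> D' \<in> diagrams r (Suc (Suc m))}"
  \<comment> \<open>The sizes of union and intersection add up to twice the size of D, so one of
    them has the right size exactly when the other has.\<close>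
  have P': "P = {D' \<in> diagrams r (Suc m). D' \<noteq> D \<and> D \<inter> D' \<in> diagrams r m}"
  proof -
    have "D \<union> D' \<in> diagrams r (Suc (Suc m)) \<longleftrightarrow> D \<inter> D' \<in> diagrams r m" if "D' \<in> diagrams r (Suc m)" for D'
    proof -
      have "card D + card D' = card (D \<union> D') + card (D \<inter> D')"
        using that fin by (intro card_Un_Int) (auto simp: diagrams_def)
      then show ?thesis using that Suc.prems
        by (auto simp: diagrams_def intro: down_closed_Un down_closed_Int)
    qed
    then show ?thesis unfolding P_def by blast
  qed
  have fP: "finite P" using finite_diagrams by (simp add: P_def)
  have U: "D \<union> D' = E" if "E \<in> diagrams r (Suc (Suc m))" "D \<subseteq> E"
    "D' \<in> diagrams r (Suc m)" "D' \<subseteq> E" "D' \<noteq> D" for D' E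
  proof -
    have "\<not> D' \<subseteq> D" using that fin card_subset_eq[of D D'] by (auto simp: diagrams_def)
    then have "D \<subset> D \<union> D'" by blast
    moreover have "finite (D \<union> D')" using that fin by (auto simp: diagrams_def)
    ultimately have "card E \<le> card (D \<union> D')"
      using psubset_card_mono[of "D \<union> D'" D] that fin by (auto simp: diagrams_def)
    then show ?thesis using that by (intro card_seteq) (auto simp: diagrams_def)
  qed
  have up: "(\<Sum>E\<in>up_set r (Suc m) D. card (std (Suc (Suc m)) E))
      = card (up_set r (Suc m) D) * ?f D + sum ?f P"
  proof -
    have "(\<Sum>E\<in>up_set r (Suc m) D. card (std (Suc (Suc m)) E))
      = (\<Sum>E\<in>up_set r (Suc m) D. ?f D + (\<Sum>D'\<in>down_set r (Suc m) E - {D}. ?f D'))"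
    proof (rule sum.cong[OF refl])
      fix E assume "E \<in> up_set r (Suc m) D"
      then have E: "E \<in> diagrams r (Suc (Suc m))" "D \<in> down_set r (Suc m) E"
        using Suc.prems by (auto simp: up_set_def down_set_def)
      show "card (std (Suc (Suc m)) E) = ?f D + (\<Sum>D'\<in>down_set r (Suc m) E - {D}. ?f D')"
        unfolding card_std_Suc[OF E(1)] using E(2) fdown by (subst sum.remove[of _ D]) auto
    qed
    also have "\<dots> = card (up_set r (Suc m) D) * ?f D
        + (\<Sum>(E, D')\<in>Sigma (up_set r (Suc m) D) (\<lambda>E. down_set r (Suc m) E - {D}). ?f D')"
      using fup fdown by (simp add: sum.distrib sum.Sigma)
    also have "(\<Sum>(E, D')\<in>Sigma (up_set r (Suc m) D) (\<lambda>E. down_set r (Suc m) E - {D}). ?f D') = sum ?f P"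
    proof (rule sum.reindex_bij_witness[of _ "\<lambda>D'. (D \<union> D', D')" snd], goal_cases)
      case (1 p)
      then show ?case using U by (cases p) (simp add: up_set_def down_set_def)
    next
      case (2 p)
      obtain E D' where p: "p = (E, D')" by (cases p)
      then have "D \<union> D' = E" using 2 by (intro U) (simp_all add: up_set_def down_set_def)
      then show ?case using 2 p by (simp add: P_def up_set_def down_set_def)
    qed (use Suc.prems in \<open>auto simp: P_def up_set_def down_set_def\<close>)
    finally show ?thesis .
  qed
  have down: "(\<Sum>K\<in>down_set r m D. \<Sum>D'\<in>up_set r m K. ?f D') = card (down_set r m D) * ?f D + sum ?f P"
  proof -
    have "(\<Sum>K\<in>down_set r m D. \<Sum>D'\<in>up_set r m K. ?f D')
      = (\<Sum>K\<in>down_set r m D. ?f D + (\<Sum>D'\<in>up_set r m K - {D}. ?f D'))"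
    proof (rule sum.cong[OF refl])
      fix K assume "K \<in> down_set r m D"
      then have "D \<in> up_set r m K" using Suc.prems by (auto simp: up_set_def down_set_def)
      then show "(\<Sum>D'\<in>up_set r m K. ?f D') = ?f D + (\<Sum>D'\<in>up_set r m K - {D}. ?f D')"
        using fup by (subst sum.remove[of _ D]) auto
    qed
    also have "\<dots> = card (down_set r m D) * ?f D
        + (\<Sum>(K, D')\<in>Sigma (down_set r m D) (\<lambda>K. up_set r m K - {D}). ?f D')"
      using fup fdown by (simp add: sum.distrib sum.Sigma)
    also have "(\<Sum>(K, D')\<in>Sigma (down_set r m D) (\<lambda>K. up_set r m K - {D}). ?f D') = sum ?f P"
    proof -
      have K: "D \<inter> D' = K" if "K \<in> diagrams r m" "K \<subseteq> D" "D' \<in> diagrams r (Suc m)" "K \<subseteq> D'" "D' \<noteq> D" for K D'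
      proof -
        have "\<not> D \<subseteq> D'" using that fin card_subset_eq[of D' D] by (auto simp: diagrams_def)
        then have "D \<inter> D' \<subset> D" by blast
        then have "card (D \<inter> D') \<le> card K"
          using psubset_card_mono[of D "D \<inter> D'"] that fin by (auto simp: diagrams_def)
        then show ?thesis using that fin by (intro card_seteq[symmetric]) auto
      qed
      show ?thesis
      proof (rule sum.reindex_bij_witness[of _ "\<lambda>D'. (D \<inter> D', D')" snd], goal_cases)
        case (1 p)
        then show ?case using K by (cases p) (simp add: up_set_def down_set_def)
      next
        case (2 p)
        obtain K' D' where p: "p = (K', D')" by (cases p)
        then have "D \<inter> D' = K'" using 2 by (intro K) (simp_all add: up_set_def down_set_def)
        then show ?case using 2 p by (simp add: P' up_set_def down_set_def)
      next
        case (4 D')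
        then show ?case using Suc.prems by (simp add: P' up_set_def down_set_def)
      qed (simp_all add: split_beta)
    qed
    finally show ?thesis .
  qed
  have "(\<Sum>K\<in>down_set r m D. \<Sum>D'\<in>up_set r m K. ?f D') = (\<Sum>K\<in>down_set r m D. r * Suc m * card (std m K))"
    by (rule sum.cong[OF refl], rule Suc.IH) (simp add: down_set_def)
  also have "\<dots> = r * Suc m * ?f D"
    unfolding card_std_Suc[OF Suc.prems] by (simp add: sum_distrib_left)
  finally have "card (down_set r m D) * ?f D + sum ?f P = r * Suc m * ?f D" using down by simp
  then show ?case unfolding up card_up_set[OF Suc.prems] by (simp add: algebra_simps)
qed

text \<open>Branching one factor downwards and exchanging the two sums turns the other factor into a
  sum over the diagrams above, which \<open>sum_up_set\<close> evaluates.\<close>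

theorem sum_card_std_squares:
  "(\<Sum>D\<in>diagrams r n. card (std n D) * card (std n D)) = r ^ n * fact n"
proof (induction n)
  case 0
  have "diagrams r 0 = {{}}" by (auto simp: diagrams_def down_closed_def)
  then show ?case by (simp add: std_0)
next
  case (Suc n)
  let ?f = "\<lambda>n D. card (std n D)"
  have "(\<Sum>E\<in>diagrams r (Suc n). ?f (Suc n) E * ?f (Suc n) E)
      = (\<Sum>E\<in>diagrams r (Suc n). \<Sum>D\<in>{D. D \<in> diagrams r n \<and> D \<subseteq> E}. ?f (Suc n) E * ?f n D)"
    by (rule sum.cong[OF refl]) (simp add: card_std_Suc sum_distrib_left down_set_def)
  also have "\<dots> = (\<Sum>D\<in>diagrams r n. \<Sum>E\<in>{E. E \<in> diagrams r (Suc n) \<and> D \<subseteq> E}. ?f (Suc n) E * ?f n D)"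
    by (rule sum.swap_restrict) (simp_all add: finite_diagrams)
  also have "\<dots> = (\<Sum>D\<in>diagrams r n. r * Suc n * ?f n D * ?f n D)"
    by (rule sum.cong[OF refl]) (use sum_up_set in \<open>simp add: sum_distrib_right[symmetric] up_set_def\<close>)
  also have "\<dots> = r * Suc n * (r ^ n * fact n)"
    unfolding Suc.IH[symmetric] by (simp add: sum_distrib_left mult_ac)
  finally show ?case by (simp add: algebra_simps)
qed

section \<open>Existence and connectedness of standard tableaux\<close>

lemma removable_nonempty:
  assumes "finite D" "down_closed D" "D \<noteq> {}"
  shows "removable D \<noteq> {}"
proof -
  let ?g = "\<lambda>b :: diagram_box. fst (snd b) + snd (snd b)"
  \<comment> \<open>A box with the largest sum of coordinates has no other box of the diagram above
    it in the order, hence is removable.\<close>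
  have "Max (?g ` D) \<in> ?g ` D" using assms by (intro Max_in) simp_all
  then obtain b where b: "Max (?g ` D) = ?g b" "b \<in> D" by (rule imageE)
  have max: "?g b' \<le> ?g b" if "b' \<in> D" for b'
    unfolding b(1)[symmetric] using assms(1) that by (intro Max_ge) simp_all
  have "b' \<noteq> b" if "a \<in> D" "a \<noteq> b" "box_le b' a" for a b'
    using max[OF that(1)] that by (cases a; cases b) (auto simp: box_le_def)
  then have "down_closed (D - {b})"
    using down_closedD[OF assms(2)] unfolding down_closed_def by blast
  then show ?thesis using b(2) unfolding removable_def by blast
qed

lemma removable_diagram:
  assumes "E \<in> diagrams r (Suc n)" "b \<in> removable E"
  shows "E - {b} \<in> diagrams r n"
proof -
  have "E - {b} \<in> down_set r n E" unfolding down_set_eq[OF assms(1)] using assms(2) by blast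
  then show ?thesis by (simp add: down_set_def)
qed

lemma std_nonempty: "D \<in> diagrams r n \<Longrightarrow> std n D \<noteq> {}"
proof (induction n arbitrary: D)
  case 0
  then have "D = {}" by (auto simp: diagrams_def)
  then show ?case by (simp add: std_0)
next
  case (Suc n)
  then have "finite D" "down_closed D" "D \<noteq> {}" by (auto simp: diagrams_def)
  then obtain b where b: "b \<in> removable D" using removable_nonempty by blast
  then show ?case using Suc.IH[OF removable_diagram[OF Suc.prems b]] std_extend[OF Suc.prems b] by blast
qed

text \<open>If the last boxes of the two tableaux agree, that box is deleted. If they are b and b',
  both can be removed together, so some tableau ends with b', b, and one swap makes it end with b,
  b'. The set \<open>S\<close> is arbitrary because the induction is applied to the set of those
  tableaux whose extension by the last entry lies in \<open>S\<close>.\<close>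

lemma std_connected:
  assumes "D \<in> diagrams r n" "L \<in> std n D" "M \<in> std n D" "L \<in> S"
    and "\<And>N i. N \<in> S \<Longrightarrow> N \<in> std n D \<Longrightarrow> i \<in> {2..n} \<Longrightarrow> swap_entries i N \<in> std n D \<Longrightarrow> swap_entries i N \<in> S"
  shows "M \<in> S"
  using assms
proof (induction n arbitrary: D L M S)
  case 0
  then have "D = {}" by (auto simp: diagrams_def)
  then show ?case using 0 by (simp add: std_0)
next
  case (Suc n)
  have ext: "(restrict L {1..n})(Suc n := L (Suc n)) = L" if "L \<in> std (Suc n) D" for L
  proof -
    have "L k = undefined" if "k \<notin> {1..Suc n}" for k
      using std_extensional[OF \<open>L \<in> std (Suc n) D\<close>] that unfolding extensional_def by blast
    then show ?thesis by (auto simp: fun_eq_iff)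
  qed
  have same_last: "M \<in> S" if L: "L \<in> std (Suc n) D" "L \<in> S" and M: "M \<in> std (Suc n) D"
    and eq: "L (Suc n) = M (Suc n)" for L M
  proof -
    define b where "b = L (Suc n)"
    have b: "b \<in> removable D" "restrict L {1..n} \<in> std n (D - {b})" "restrict M {1..n} \<in> std n (D - {b})"
      using std_last_removable[OF Suc.prems(1) L(1)] std_last_removable[OF Suc.prems(1) M] eq
      by (simp_all add: b_def)
    have "restrict M {1..n} \<in> {N. N(Suc n := b) \<in> S}"
    proof (rule Suc.IH[OF removable_diagram[OF Suc.prems(1) b(1)] b(2,3)])
      show "restrict L {1..n} \<in> {N. N(Suc n := b) \<in> S}" using ext[OF L(1)] L(2) by (simp add: b_def)
    next
      fix N i assume N: "N \<in> {N. N(Suc n := b) \<in> S}" "N \<in> std n (D - {b})" "i \<in> {2..n}"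
        "swap_entries i N \<in> std n (D - {b})"
      have eq: "(swap_entries i N)(Suc n := b) = swap_entries i (N(Suc n := b))"
        using N(3) by (auto simp: swap_entries_def fun_eq_iff transpose_def)
      define N' where "N' = N(Suc n := b)"
      have "N' \<in> S" "N' \<in> std (Suc n) D" "i \<in> {2..Suc n}" "swap_entries i N' \<in> std (Suc n) D"
        using N std_extend[OF Suc.prems(1) b(1) N(2)] std_extend[OF Suc.prems(1) b(1) N(4)]
        unfolding eq N'_def by simp_all
      then have "swap_entries i N' \<in> S" by (rule Suc.prems(5))
      then show "swap_entries i N \<in> {N. N(Suc n := b) \<in> S}" using eq by (simp add: N'_def)
    qed
    then show ?thesis using ext[OF M] eq by (simp add: b_def)
  qed
  show ?case
  proof (cases "L (Suc n) = M (Suc n)")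
    case True
    then show ?thesis using same_last Suc.prems by blast
  next
    case False
    define b b' where "b = L (Suc n)" and "b' = M (Suc n)"
    have bb: "b \<noteq> b'" using False by (simp add: b_def b'_def)
    have rem: "b \<in> removable D" "b' \<in> removable D"
      using std_last_removable[OF Suc.prems(1)] Suc.prems(2,3) by (auto simp: b_def b'_def)
    have D1: "D - {b} \<in> diagrams r n" "D - {b'} \<in> diagrams r n"
      using removable_diagram[OF Suc.prems(1)] rem by auto
    have dc: "down_closed (D - {b} - {b'})"
    proof -
      have "D - {b} - {b'} = (D - {b}) \<inter> (D - {b'})" by blast
      then show ?thesis using rem down_closed_Int by (auto simp: removable_def)
    qed
    have r': "b' \<in> removable (D - {b})" "b \<in> removable (D - {b'})"
      using rem bb dc by (simp_all add: removable_def Diff_insert2[symmetric] insert_commute)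
    have "n \<noteq> 0"
    proof
      assume "n = 0"
      then have "D - {b} = {}" using D1(1) unfolding diagrams_def by auto
      then show False using r'(1) unfolding removable_def by blast
    qed
    then obtain m where m: "n = Suc m" by (cases n) auto
    have "D - {b} - {b'} \<in> diagrams r m" using removable_diagram[OF D1(1)[unfolded m] r'(1)] .
    then obtain N where N: "N \<in> std m (D - {b} - {b'})" using std_nonempty by blast
    have N': "N \<in> std m (D - {b'} - {b})" using N by (simp add: Diff_insert2[symmetric] insert_commute)
    define N1 N2 where "N1 = N(Suc m := b', Suc (Suc m) := b)" and "N2 = N(Suc m := b, Suc (Suc m) := b')"
    have N1: "N1 \<in> std (Suc n) D"
      unfolding N1_def m using std_extend[OF Suc.prems(1)[unfolded m] rem(1)]
        std_extend[OF D1(1)[unfolded m] r'(1) N] by blast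
    have N2: "N2 \<in> std (Suc n) D"
      unfolding N2_def m using std_extend[OF Suc.prems(1)[unfolded m] rem(2)]
        std_extend[OF D1(2)[unfolded m] r'(2) N'] by blast
    have sw: "swap_entries (Suc n) N1 = N2"
      by (auto simp: swap_entries_def N1_def N2_def fun_eq_iff transpose_def m)
    have "N1 \<in> S"
      by (rule same_last[OF Suc.prems(2,4) N1]) (simp add: N1_def m b_def)
    then have "N2 \<in> S" using Suc.prems(5)[of N1 "Suc n"] N1 N2 sw m by simp
    then show ?thesis
      by (rule same_last[OF N2 _ Suc.prems(3)]) (simp add: N2_def m b'_def)
  qed
qed

section \<open>Multipartitions and diagrams\<close>

lemma partition_nth_le:
  assumes "is_partition p" "x \<le> x'" "x' < length p"
  shows "p ! x' \<le> p ! x"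
  using assms by (cases "x = x'") (auto simp: is_partition_def sorted_wrt_iff_nth_less)

lemma partition_nth_pos: "is_partition p \<Longrightarrow> x < length p \<Longrightarrow> 0 < p ! x"
  unfolding is_partition_def by (metis bot_nat_0.not_eq_extremum nth_mem)

lemma mem_boxes: "(i, x, y) \<in> boxes lam \<longleftrightarrow> i < length lam \<and> x < length (lam ! i) \<and> y < lam ! i ! x"
  by (simp add: boxes_def)

lemma card_boxes: "card (boxes lam) = sum_list (map sum_list lam)"
proof -
  have "boxes lam = Sigma {..<length lam} (\<lambda>i. Sigma {..<length (lam ! i)} (\<lambda>x. {..<lam ! i ! x}))"
    by (auto simp: boxes_def)
  then have "card (boxes lam) = (\<Sum>i<length lam. \<Sum>x<length (lam ! i). lam ! i ! x)"
    by simp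
  also have "\<dots> = sum_list (map sum_list lam)"
    by (simp add: sum_list_sum_nth atLeast0LessThan)
  finally show ?thesis .
qed

lemma boxes_in_diagrams:
  assumes "lam \<in> multipartitions r n"
  shows "boxes lam \<in> diagrams r n"
proof -
  have part: "is_partition (lam ! i)" if "i < length lam" for i
    using assms that by (simp add: multipartitions_def)
  have "down_closed (boxes lam)" unfolding down_closed_def
  proof (intro ballI allI impI)
    fix b b' assume b: "b \<in> boxes lam" "box_le b' b"
    obtain i x' y' x y where e: "b = (i, x', y')" "b' = (i, x, y)" "x \<le> x'" "y \<le> y'"
      using b(2) by (cases b; cases b') (auto simp: box_le_def)
    then have "lam ! i ! x' \<le> lam ! i ! x"
      using b(1) part by (intro partition_nth_le) (auto simp: mem_boxes)
    then show "b' \<in> boxes lam" using e b(1) by (auto simp: mem_boxes)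
  qed
  moreover have "fst ` boxes lam \<subseteq> {..<r}"
    using assms by (auto simp: boxes_def multipartitions_def)
  ultimately show ?thesis
    using assms by (simp add: diagrams_def finite_boxes card_boxes multipartitions_def)
qed

lemma boxes_inj:
  assumes "lam \<in> multipartitions r n" "mu \<in> multipartitions r n" "boxes lam = boxes mu"
  shows "lam = mu"
proof (rule nth_equalityI)
  show len: "length lam = length mu" using assms by (simp add: multipartitions_def)
  fix i assume i: "i < length lam"
  have part: "is_partition (lam ! i)" "is_partition (mu ! i)"
    using assms i len by (simp_all add: multipartitions_def)
  have eq: "x < length (lam ! i) \<and> y < lam ! i ! x \<longleftrightarrow> x < length (mu ! i) \<and> y < mu ! i ! x" for x y
    using mem_boxes[of i x y lam] mem_boxes[of i x y mu] assms(3) i len by simp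
  have "x < length (lam ! i) \<longleftrightarrow> x < length (mu ! i)" for x
    using eq[of x 0] partition_nth_pos[OF part(1), of x] partition_nth_pos[OF part(2), of x] by blast
  then have l: "length (lam ! i) = length (mu ! i)" by (metis linorder_neqE_nat less_irrefl)
  show "lam ! i = mu ! i"
  proof (rule nth_equalityI[OF l])
    fix x assume x: "x < length (lam ! i)"
    then show "lam ! i ! x = mu ! i ! x"
      using eq[of x] l by (metis linorder_neqE_nat less_irrefl)
  qed
qed

lemma boxes_surj:
  assumes "D \<in> diagrams r n"
  obtains lam where "lam \<in> multipartitions r n" "boxes lam = D"
proof -
  have D: "finite D" "down_closed D" "fst ` D \<subseteq> {..<r}" "card D = n"
    using assms by (simp_all add: diagrams_def)
  define rows where "rows i = (LEAST x. row_len D i x = 0)" for i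
  have ex: "\<exists>x. row_len D i x = 0" for i
  proof -
    have "(\<lambda>x. (i, x, 0)) ` {x. (i, x, 0) \<in> D} \<subseteq> D" by blast
    then have "finite ((\<lambda>x. (i, x, 0::nat)) ` {x. (i, x, 0) \<in> D})" using D(1) finite_subset by blast
    then have "finite {x. (i, x, 0) \<in> D}" by (rule finite_imageD) (simp add: inj_on_def)
    then obtain x where "x \<notin> {x. (i, x, 0) \<in> D}" using ex_new_if_finite[OF infinite_UNIV_nat] by blast
    then show ?thesis using mem_iff_row_len[OF D(1,2), of i x 0] by auto
  qed
  have rows: "x < rows i \<longleftrightarrow> row_len D i x \<noteq> 0" for i x
  proof
    show "x < rows i \<Longrightarrow> row_len D i x \<noteq> 0" unfolding rows_def by (rule not_less_Least)
    assume "row_len D i x \<noteq> 0"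
    moreover have "row_len D i (rows i) = 0" unfolding rows_def by (rule LeastI_ex[OF ex])
    ultimately show "x < rows i"
      using row_len_antimono[OF D(1,2), of "rows i" x i] by (metis le_zero_eq not_le)
  qed
  define lam where "lam = map (\<lambda>i. map (row_len D i) [0..<rows i]) [0..<r]"
  have "boxes lam = D"
  proof -
    have "(i, x, y) \<in> boxes lam \<longleftrightarrow> (i, x, y) \<in> D" for i x y
    proof -
      have "(i, x, y) \<in> boxes lam \<longleftrightarrow> i < r \<and> x < rows i \<and> y < row_len D i x"
        by (auto simp: mem_boxes lam_def)
      also have "\<dots> \<longleftrightarrow> i < r \<and> (i, x, y) \<in> D"
        using rows[of x i] mem_iff_row_len[OF D(1,2), of i x y] by auto
      also have "\<dots> \<longleftrightarrow> (i, x, y) \<in> D" using D(3) by force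
      finally show ?thesis .
    qed
    then show ?thesis by auto
  qed
  moreover have "is_partition (map (row_len D i) [0..<rows i])" for i
  proof -
    have "0 \<notin> row_len D i ` {0..<rows i}" using rows[of _ i] by fastforce
    moreover have "sorted_wrt (\<ge>) (map (row_len D i) [0..<rows i])"
      using row_len_antimono[OF D(1,2), of _ _ i] by (simp add: sorted_wrt_iff_nth_less)
    ultimately show ?thesis by (simp add: is_partition_def)
  qed
  then have "\<forall>p\<in>set lam. is_partition p" by (auto simp: lam_def)
  moreover have "sum_list (map sum_list lam) = n"
    using card_boxes[of lam] \<open>boxes lam = D\<close> D(4) by simp
  ultimately show ?thesis using that[of lam] by (simp add: multipartitions_def lam_def)
qed

text \<open>The rules for rows and for columns imply the rule for any two comparable boxes by way of
  the corner box \<open>(i, x, y')\<close>, which belongs to the diagram by down-closedness.\<close>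

lemma standard_tableaux_eq_std:
  assumes "lam \<in> multipartitions r n"
  shows "standard_tableaux n lam = std n (boxes lam)"
proof (intro equalityI subsetI)
  fix L assume "L \<in> standard_tableaux n lam"
  then have L: "L \<in> extensional {1..n}" "bij_betw L {1..n} (boxes lam)"
    and row: "\<And>k l i x y y'. k \<in> {1..n} \<Longrightarrow> l \<in> {1..n} \<Longrightarrow> L k = (i, x, y) \<Longrightarrow> L l = (i, x, y') \<Longrightarrow>
      y < y' \<Longrightarrow> k < l"
    and col: "\<And>k l i x x' y. k \<in> {1..n} \<Longrightarrow> l \<in> {1..n} \<Longrightarrow> L k = (i, x, y) \<Longrightarrow> L l = (i, x', y) \<Longrightarrow>
      x < x' \<Longrightarrow> k < l"
    unfolding standard_tableaux_def by blast+
  have inj: "k = l" if "L k = L l" "k \<in> {1..n}" "l \<in> {1..n}" for k l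
    using L(2) that by (meson bij_betw_imp_inj_on inj_onD)
  show "L \<in> std n (boxes lam)"
  proof (rule stdI[OF L])
    fix k l assume kl: "k \<in> {1..n}" "l \<in> {1..n}" "box_le (L k) (L l)"
    obtain i x y x' y' where e: "L k = (i, x, y)" "L l = (i, x', y')" "x \<le> x'" "y \<le> y'"
      using kl(3) by (cases "L k"; cases "L l") (auto simp: box_le_def)
    have "L l \<in> boxes lam" using bij_betwE[OF L(2)] kl(2) by blast
    then have "(i, x, y') \<in> boxes lam"
      using boxes_in_diagrams[OF assms] e down_closedD[of "boxes lam" "L l" "(i, x, y')"]
      by (simp add: diagrams_def box_le_def)
    then obtain m where m: "m \<in> {1..n}" "L m = (i, x, y')"
      using L(2) unfolding bij_betw_def by (metis imageE)
    have "k \<le> m"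
    proof (cases "y = y'")
      case True
      then show ?thesis using inj[of k m] kl m e by simp
    next
      case False
      then have "k < m" using e(4) by (intro row[OF kl(1) m(1) e(1) m(2)]) simp
      then show ?thesis by simp
    qed
    also have "m \<le> l"
    proof (cases "x = x'")
      case True
      then show ?thesis using inj[of m l] kl m e by simp
    next
      case False
      then have "m < l" using e(3) by (intro col[OF m(1) kl(2) m(2) e(2)]) simp
      then show ?thesis by simp
    qed
    finally show "k \<le> l" .
  qed
next
  fix L assume L: "L \<in> std n (boxes lam)"
  have lt: "k < l" if "k \<in> {1..n}" "l \<in> {1..n}" "L k = (i, x, y)" "L l = (i, x', y')" "x \<le> x'" "y \<le> y'"
    "(x, y) \<noteq> (x', y')" for k l i x x' y y'
  proof -
    have "k \<le> l" using that by (intro std_le[OF L]) (simp_all add: box_le_def)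
    moreover have "k \<noteq> l" using that by auto
    ultimately show ?thesis by simp
  qed
  show "L \<in> standard_tableaux n lam"
    unfolding standard_tableaux_def mem_Collect_eq
  proof (intro conjI ballI allI impI; (elim conjE)?)
    fix k l i x y y' assume "k \<in> {1..n}" "l \<in> {1..n}" "L k = (i, x, y)" "L l = (i, x, y')" "y < y'"
    then show "k < l" by (intro lt[of k l i x y x y']) simp_all
  next
    fix k l i x x' y assume "k \<in> {1..n}" "l \<in> {1..n}" "L k = (i, x, y)" "L l = (i, x', y)" "x < x'"
    then show "k < l" by (intro lt[of k l i x y x' y]) simp_all
  qed (rule std_extensional[OF L], rule std_bij[OF L])
qed

section \<open>Separation of the parameters, forced by a tensor representation\<close>

section \<open>Operators exchanging adjacent entries\<close>

text \<open>Both the tensor representation and the seminormal representation act in this way on functions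
  of a sequence \<open>w\<close>, so that the relations reduce to identities for the coefficients.\<close>

definition exch :: "('c \<Rightarrow> 'c \<Rightarrow> complex) \<Rightarrow> ('c \<Rightarrow> 'c \<Rightarrow> complex) \<Rightarrow> nat
    \<Rightarrow> ((nat \<Rightarrow> 'c) \<Rightarrow> complex) \<Rightarrow> (nat \<Rightarrow> 'c) \<Rightarrow> complex" where
  "exch al be i f w = al (w (i - 1)) (w i) * f w + be (w (i - 1)) (w i) * f (w \<circ> transpose (i - 1) i)"

lemma comp_transpose_twice [simp]: "w \<circ> transpose a b \<circ> transpose a b = w"
  by (simp add: comp_assoc)

lemma exch_quadratic:
  assumes "i \<ge> 1"
    and "be (w (i - 1)) (w i) \<noteq> 0 \<Longrightarrow> al (w (i - 1)) (w i) + al (w i) (w (i - 1)) = h"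
    and "al (w (i - 1)) (w i) ^ 2 + be (w (i - 1)) (w i) * be (w i) (w (i - 1)) = h * al (w (i - 1)) (w i) + 1"
  shows "exch al be i (exch al be i f) w = h * exch al be i f w + f w"
proof -
  let ?a = "w (i - 1)" and ?b = "w i" and ?w = "w \<circ> transpose (i - 1) i"
  have "exch al be i (exch al be i f) w =
      (al ?a ?b ^ 2 + be ?a ?b * be ?b ?a) * f w + be ?a ?b * (al ?a ?b + al ?b ?a) * f ?w"
    by (simp add: exch_def algebra_simps power2_eq_square)
  also have "\<dots> = (h * al ?a ?b + 1) * f w + be ?a ?b * h * f ?w"
    using assms(2,3) by (cases "be ?a ?b = 0") simp_all
  finally show ?thesis by (simp add: exch_def algebra_simps)
qed

lemma exch_commute:
  assumes "i \<ge> 1" "j \<ge> 1" "\<bar>int i - int j\<bar> > 1"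
  shows "exch al be i (exch al be j f) w = exch al be j (exch al be i f) w"
proof -
  have ne: "i \<noteq> j" "i \<noteq> j - 1" "i - 1 \<noteq> j" "i - 1 \<noteq> j - 1" using assms by auto
  have "w \<circ> transpose (i - 1) i \<circ> transpose (j - 1) j = w \<circ> transpose (j - 1) j \<circ> transpose (i - 1) i"
    using ne by (auto simp: fun_eq_iff transpose_def)
  then show ?thesis using ne by (simp add: exch_def algebra_simps)
qed

text \<open>Both sides are combinations of the values of \<open>f\<close> at the six rearrangements
  of three entries. The coefficients at the two 3-cycles and at the longest element agree
  identically; the hypotheses compare those at the two adjacent transpositions and at the
  identity.\<close>

lemma exch_braid:
  fixes al be :: "'c \<Rightarrow> 'c \<Rightarrow> complex"
  assumes "i \<ge> 1" and w: "a = w (i - 1)" "b = w i" "c = w (Suc i)"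
    and "be a b * (al a b * al b c + al a c * al b a - al b c * al a c) = 0"
    and "be b c * (al a b * al a c - al b c * al a b - al a c * al c b) = 0"
    and "al a b ^ 2 * al b c + be a b * be b a * al a c = al b c ^ 2 * al a b + be b c * be c b * al a c"
  shows "exch al be i (exch al be (Suc i) (exch al be i f)) w =
    exch al be (Suc i) (exch al be i (exch al be (Suc i) f)) w"
proof -
  let ?s = "transpose (i - 1) i" and ?t = "transpose i (Suc i)"
  have ne: "i - 1 \<noteq> i" using assms(1) by simp
  have tt: "w \<circ> ?t \<circ> ?s \<circ> ?t = w \<circ> ?s \<circ> ?t \<circ> ?s"
    using ne by (auto simp: fun_eq_iff transpose_def)
  have v: "(w \<circ> ?s) (i - 1) = b" "(w \<circ> ?s) i = a" "(w \<circ> ?s) (Suc i) = c"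
    "(w \<circ> ?t) (i - 1) = a" "(w \<circ> ?t) i = c" "(w \<circ> ?t) (Suc i) = b"
    "(w \<circ> ?s \<circ> ?t) (i - 1) = b" "(w \<circ> ?s \<circ> ?t) i = c" "(w \<circ> ?s \<circ> ?t) (Suc i) = a"
    "(w \<circ> ?t \<circ> ?s) (i - 1) = c" "(w \<circ> ?t \<circ> ?s) i = a" "(w \<circ> ?t \<circ> ?s) (Suc i) = b"
    using w ne by auto
  define f1 f2 f3 f4 f5 where "f1 = f (w \<circ> ?s)" and "f2 = f (w \<circ> ?t)" and "f3 = f (w \<circ> ?s \<circ> ?t)"
    and "f4 = f (w \<circ> ?t \<circ> ?s)" and "f5 = f (w \<circ> ?s \<circ> ?t \<circ> ?s)"
  note fs = f1_def[symmetric] f2_def[symmetric] f3_def[symmetric] f4_def[symmetric] f5_def[symmetric]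
  have l: "exch al be i (exch al be (Suc i) (exch al be i f)) w =
      al a b * (al b c * (al a b * f w + be a b * f1) + be b c * (al a c * f2 + be a c * f4))
      + be a b * (al a c * (al b a * f1 + be b a * f w) + be a c * (al b c * f3 + be b c * f5))"
    by (simp only: exch_def diff_Suc_1 v w[symmetric] comp_transpose_twice fs)
  have r: "exch al be (Suc i) (exch al be i (exch al be (Suc i) f)) w =
      al b c * (al a b * (al b c * f w + be b c * f2) + be a b * (al a c * f1 + be a c * f3))
      + be b c * (al a c * (al c b * f2 + be c b * f w) + be a c * (al a b * f4 + be a b * f5))"
    by (simp only: exch_def diff_Suc_1 v w[symmetric] comp_transpose_twice tt fs)
  have "exch al be i (exch al be (Suc i) (exch al be i f)) w
      - exch al be (Suc i) (exch al be i (exch al be (Suc i) f)) w =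
      be a b * (al a b * al b c + al a c * al b a - al b c * al a c) * f1
      + be b c * (al a b * al a c - al b c * al a b - al a c * al c b) * f2
      + (al a b ^ 2 * al b c + be a b * be b a * al a c
         - (al b c ^ 2 * al a b + be b c * be c b * al a c)) * f w"
    unfolding l r by (simp add: algebra_simps power2_eq_square)
  then show ?thesis using assms(5-7) by simp
qed

section \<open>The tensor representation\<close>

text \<open>This is the action on the \<open>n\<close>-th tensor power of a two-dimensional space by the \<open>R\<close>-matrix of
  type \<open>A\<close> and a solution \<open>K\<close> of the reflection equation with eigenvalues \<open>u\<close> and \<open>v\<close>.\<close>

definition tensor_diag :: "complex \<Rightarrow> bool \<Rightarrow> bool \<Rightarrow> complex" where
  "tensor_diag q x y = (if x = y then q else if x then q - inverse q else 0)"

definition tensor_off :: "bool \<Rightarrow> bool \<Rightarrow> complex" where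
  "tensor_off x y = (if x = y then 0 else 1)"

text \<open>The companion matrix of (X - u)(X - v) on the first tensor factor. Unlike a diagonal
  matrix it remains a nontrivial Jordan block for u = v, which lets the argument exclude equal
  parameters as well.\<close>

definition reflection_op :: "complex \<Rightarrow> complex \<Rightarrow> ((nat \<Rightarrow> bool) \<Rightarrow> complex) \<Rightarrow> (nat \<Rightarrow> bool) \<Rightarrow> complex" where
  "reflection_op u v f w = (if w 1 then f (w(1 := False))
     else (u + v) * f (w(1 := False)) - u * v * f (w(1 := True)))"

definition tensor_op :: "complex \<Rightarrow> complex \<Rightarrow> complex \<Rightarrow> nat \<Rightarrow> ((nat \<Rightarrow> bool) \<Rightarrow> complex)
    \<Rightarrow> (nat \<Rightarrow> bool) \<Rightarrow> complex" where
  "tensor_op q u v i = (if i = 1 then reflection_op u v else exch (tensor_diag q) tensor_off i)"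

lemma linear_op_exch: "linear_op (exch al be i)"
  by (simp add: linear_op_def exch_def fun_eq_iff algebra_simps)

lemma linear_op_tensor: "linear_op (tensor_op q u v i)"
  by (cases "i = 1") (simp_all add: tensor_op_def linear_op_exch, simp add: linear_op_def reflection_op_def
    fun_eq_iff algebra_simps)

lemma reflection_op_quadratic:
  "reflection_op u v (reflection_op u v f) w = (u + v) * reflection_op u v f w - u * v * f w"
  by (cases "w 1") (simp_all add: reflection_op_def algebra_simps fun_upd_idem)

lemma fun_upd_transpose: "w(Suc 0 := x, 2 := y) \<circ> transpose (Suc 0) 2 = w(Suc 0 := y, 2 := x)"
  by (auto simp: fun_eq_iff transpose_def)

lemma reflection_equation:
  assumes "q \<noteq> 0"
  shows "reflection_op u v (exch (tensor_diag q) tensor_off 2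
      (reflection_op u v (exch (tensor_diag q) tensor_off 2 f))) w =
    exch (tensor_diag q) tensor_off 2 (reflection_op u v
      (exch (tensor_diag q) tensor_off 2 (reflection_op u v f))) w"
proof -
  define F where "F x y = f (w(1 := x, 2 := y))" for x y
  have tw: "Suc 0 \<noteq> 2" by simp
  have f: "f (w(1 := x, 2 := y)) = F x y" "f (w(2 := y, 1 := x)) = F x y" for x y
    unfolding F_def by (simp_all add: fun_upd_twist[OF tw])
  have e: "exch (tensor_diag q) tensor_off 2 g (w(1 := x, 2 := y)) =
    (if x = y then q * g (w(1 := x, 2 := y)) else (if x then (q - inverse q) * g (w(1 := x, 2 := y)) else 0)
       + g (w(1 := y, 2 := x)))" for g x y
    by (simp add: exch_def fun_upd_transpose tensor_diag_def tensor_off_def)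
  have k: "reflection_op u v g (w(1 := x, 2 := y)) = (if x then g (w(1 := False, 2 := y))
     else (u + v) * g (w(1 := False, 2 := y)) - u * v * g (w(1 := True, 2 := y)))" for g x y
    by (simp add: reflection_op_def fun_upd_twist[OF tw])
  have w: "w = w(1 := w 1, 2 := w 2)" by simp
  show ?thesis
    apply (subst (1 2) w)
    apply (simp only: e k f)
    using assms by (cases "w 1"; cases "w 2") (simp_all add: field_simps)
qed

lemma reflection_commute:
  assumes "i \<ge> 3"
  shows "reflection_op u v (exch al be i f) w = exch al be i (reflection_op u v f) w"
proof -
  have "w(1 := x) \<circ> transpose (i - 1) i = (w \<circ> transpose (i - 1) i)(1 := x)" for x
    using assms by (auto simp: fun_eq_iff transpose_def)
  moreover have "(w \<circ> transpose (i - 1) i) 1 = w 1" using assms by (auto simp: transpose_def)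
  moreover have "i - Suc 0 \<noteq> Suc 0" "i \<noteq> Suc 0" using assms by auto
  ultimately show ?thesis by (simp add: reflection_op_def exch_def algebra_simps)
qed

definition shift_prod :: "(('x \<Rightarrow> complex) \<Rightarrow> 'x \<Rightarrow> complex) \<Rightarrow> complex list \<Rightarrow> ('x \<Rightarrow> complex) \<Rightarrow> 'x \<Rightarrow> complex" where
  "shift_prod F us f = foldr (\<lambda>z g x. F g x - z * g x) us f"

lemma shift_prod_commute:
  assumes "linear_op F"
  shows "shift_prod F us (\<lambda>x. F f x - y * f x) = (\<lambda>x. F (shift_prod F us f) x - y * shift_prod F us f x)"
  by (induction us) (simp_all add: shift_prod_def linear_opD[OF assms] algebra_simps)

lemma shift_prod_pull:
  assumes "linear_op F"
  shows "shift_prod F (xs @ y # ys) f = shift_prod F (y # xs @ ys) f"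
  using shift_prod_commute[OF assms, of xs "shift_prod F ys f" y] by (simp add: shift_prod_def)

text \<open>The factors commute, so those at positions i and j may be brought together, where they
  form the quadratic polynomial that \<open>F\<close> satisfies.\<close>

lemma shift_prod_eq_zero:
  assumes "linear_op F" and ij: "i < j" "j < length us"
    and *: "\<And>g x. F (F g) x = (us ! i + us ! j) * F g x - us ! i * us ! j * g x"
  shows "shift_prod F us f = (\<lambda>x. 0)"
proof -
  let ?xs = "take i us" and ?zs = "drop (Suc i) us"
  have 1: "us = ?xs @ us ! i # ?zs" using ij by (intro id_take_nth_drop) simp
  have 2: "?zs = take (j - Suc i) ?zs @ us ! j # drop (Suc (j - Suc i)) ?zs"
    using ij id_take_nth_drop[of "j - Suc i" ?zs] by simp
  obtain ys zs where "us = ?xs @ us ! i # ys @ us ! j # zs" using 1 2 by metis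
  then have "shift_prod F us f = shift_prod F (us ! i # (?xs @ ys) @ us ! j # zs) f"
    using shift_prod_pull[OF assms(1), of ?xs "us ! i" "ys @ us ! j # zs"] by simp
  also have "\<dots> = shift_prod F [us ! i] (shift_prod F ((?xs @ ys) @ us ! j # zs) f)"
    by (simp add: shift_prod_def)
  also have "\<dots> = shift_prod F [us ! i, us ! j] (shift_prod F ((?xs @ ys) @ zs) f)"
    unfolding shift_prod_pull[OF assms(1)] by (simp add: shift_prod_def)
  also have "\<dots> = (\<lambda>x. 0)"
    by (simp add: shift_prod_def linear_opD[OF assms(1)] * algebra_simps)
  finally show ?thesis .
qed

lemma tensor_braid:
  assumes "q \<noteq> 0" "i \<ge> 1"
  shows "exch (tensor_diag q) tensor_off i (exch (tensor_diag q) tensor_off (Suc i) (exch (tensor_diag q) tensor_off i f)) w =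
    exch (tensor_diag q) tensor_off (Suc i) (exch (tensor_diag q) tensor_off i (exch (tensor_diag q) tensor_off (Suc i) f)) w"
  by (rule exch_braid[OF assms(2) refl refl refl])
     (use assms(1) in \<open>auto simp: tensor_diag_def tensor_off_def field_simps power2_eq_square\<close>)

lemma tensor_quadratic:
  assumes "q \<noteq> 0" "i \<ge> 1"
  shows "exch (tensor_diag q) tensor_off i (exch (tensor_diag q) tensor_off i f) w =
    (q - inverse q) * exch (tensor_diag q) tensor_off i f w + f w"
  by (rule exch_quadratic[OF assms(2)])
     (use assms(1) in \<open>auto simp: tensor_diag_def tensor_off_def field_simps power2_eq_square\<close>)

lemma hecke_rep_tensor:
  assumes "n \<ge> 1" "q \<noteq> 0" "i < j" "j < length us"
    and uv: "(u = us ! i \<and> v = us ! j) \<or> (u = us ! j \<and> v = us ! i)"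
  shows "hecke_rep n us q (tensor_op q u v) UNIV"
proof
  show "linear_op (tensor_op q u v i)" for i by (rule linear_op_tensor)
  show "fun_subspace (UNIV :: ((nat \<Rightarrow> bool) \<Rightarrow> complex) set)" by (simp add: fun_subspace_def)
  fix f :: "(nat \<Rightarrow> bool) \<Rightarrow> complex"
  show "tensor_op q u v i (tensor_op q u v j f) = tensor_op q u v j (tensor_op q u v i f)"
    if "i \<in> {1..n}" "j \<in> {1..n}" "\<bar>int i - int j\<bar> > 1" for i j
    using that exch_commute[of i j] by (auto simp: tensor_op_def fun_eq_iff reflection_commute)
  show "tensor_op q u v i (tensor_op q u v (i + 1) (tensor_op q u v i f)) =
      tensor_op q u v (i + 1) (tensor_op q u v i (tensor_op q u v (i + 1) f))"
    if "2 \<le> i" "i + 1 \<le> n" for i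
    using that tensor_braid[OF assms(2), of i] by (simp add: tensor_op_def fun_eq_iff)
  show "tensor_op q u v 1 (tensor_op q u v 2 (tensor_op q u v 1 (tensor_op q u v 2 f))) =
      tensor_op q u v 2 (tensor_op q u v 1 (tensor_op q u v 2 (tensor_op q u v 1 f)))"
    using reflection_equation[OF assms(2)] by (simp add: tensor_op_def fun_eq_iff)
  show "tensor_op q u v i (tensor_op q u v i f) = (\<lambda>x. (q - inverse q) * tensor_op q u v i f x + f x)"
    if "2 \<le> i" "i \<le> n" for i
    using that tensor_quadratic[OF assms(2), of i] by (simp add: tensor_op_def fun_eq_iff)
  have "shift_prod (tensor_op q u v 1) us f = (\<lambda>x. 0)"
  proof (rule shift_prod_eq_zero[OF linear_op_tensor assms(3,4)])
    show "tensor_op q u v 1 (tensor_op q u v 1 g) x =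
        (us ! i + us ! j) * tensor_op q u v 1 g x - us ! i * us ! j * g x" for g x
      using uv reflection_op_quadratic[of u v g x] by (auto simp: tensor_op_def algebra_simps)
  qed
  then show "foldr (\<lambda>z g x. tensor_op q u v 1 g x - z * g x) us f = (\<lambda>x. 0)"
    by (simp add: shift_prod_def)
qed (use assms in simp_all)

section \<open>Elements of the Hecke algebra\<close>

context
  fixes n :: nat and us :: "complex list" and q :: complex
  assumes n: "n \<ge> 1"
begin

lemma hecke_class_hom: "hecke_class n us q \<in> ring_hom (free_algebra n) (hecke n us q)"
  using ideal.rcos_ring_hom[OF ideal_hecke_ideal[OF n, of us q]]
  by (simp add: hecke_def hecke_class_def[abs_def])

lemma hecke_carrier: "carrier (hecke n us q) = hecke_class n us q ` carrier (free_algebra n)"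
  by (auto simp: hecke_def hecke_class_def FactRing_def A_RCOSETS_def')

lemma hecke_class_closed: "a \<in> carrier (free_algebra n) \<Longrightarrow> hecke_class n us q a \<in> carrier (hecke n us q)"
  by (simp add: hecke_carrier)

lemma hecke_class_mult:
  "a \<in> carrier (free_algebra n) \<Longrightarrow> b \<in> carrier (free_algebra n) \<Longrightarrow>
    hecke_class n us q (a \<otimes>\<^bsub>free_algebra n\<^esub> b) = hecke_class n us q a \<otimes>\<^bsub>hecke n us q\<^esub> hecke_class n us q b"
  by (rule ring_hom_mult[OF hecke_class_hom])

lemma hecke_class_add:
  "a \<in> carrier (free_algebra n) \<Longrightarrow> b \<in> carrier (free_algebra n) \<Longrightarrow>
    hecke_class n us q (a \<oplus>\<^bsub>free_algebra n\<^esub> b) = hecke_class n us q a \<oplus>\<^bsub>hecke n us q\<^esub> hecke_class n us q b"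
  by (rule ring_hom_add[OF hecke_class_hom])

lemma hecke_class_one: "hecke_class n us q \<one>\<^bsub>free_algebra n\<^esub> = \<one>\<^bsub>hecke n us q\<^esub>"
  by (rule ring_hom_one[OF hecke_class_hom])

lemma hecke_class_zero: "hecke_class n us q \<zero>\<^bsub>free_algebra n\<^esub> = \<zero>\<^bsub>hecke n us q\<^esub>"
  by (rule ring_hom_zero[OF hecke_class_hom ring_free_algebra ring_hecke[OF n]])

lemma mem_hecke_class:
  "b \<in> hecke_class n us q a \<longleftrightarrow> (\<exists>i\<in>hecke_ideal n us q. b = i \<oplus>\<^bsub>free_algebra n\<^esub> a)"
  by (auto simp: hecke_class_def a_r_coset_def')

lemma hecke_ideal_carrier: "a \<in> hecke_ideal n us q \<Longrightarrow> a \<in> carrier (free_algebra n)"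
  using additive_subgroup.a_subset[OF ideal.axioms(1)[OF ideal_hecke_ideal[OF n, of us q]]] by blast

lemma hecke_class_self: "a \<in> carrier (free_algebra n) \<Longrightarrow> a \<in> hecke_class n us q a"
proof -
  interpret A: ring "free_algebra n" by (rule ring_free_algebra)
  interpret I: ideal "hecke_ideal n us q" "free_algebra n" by (rule ideal_hecke_ideal[OF n])
  show "a \<in> carrier (free_algebra n) \<Longrightarrow> a \<in> hecke_class n us q a"
    unfolding mem_hecke_class by (intro bexI[of _ "\<zero>\<^bsub>free_algebra n\<^esub>"]) simp_all
qed

lemma hecke_class_eqI:
  assumes "a \<in> carrier (free_algebra n)" "b \<in> carrier (free_algebra n)"
    and "a \<ominus>\<^bsub>free_algebra n\<^esub> b \<in> hecke_ideal n us q"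
  shows "hecke_class n us q a = hecke_class n us q b"
proof -
  interpret A: ring "free_algebra n" by (rule ring_free_algebra)
  interpret H: ring "hecke n us q" by (rule ring_hecke[OF n])
  interpret I: ideal "hecke_ideal n us q" "free_algebra n" by (rule ideal_hecke_ideal[OF n])
  have "a = (a \<ominus>\<^bsub>free_algebra n\<^esub> b) \<oplus>\<^bsub>free_algebra n\<^esub> b"
    using assms(1,2) by (simp add: free_minus[of b n] free_add)
  then have "hecke_class n us q a =
      hecke_class n us q (a \<ominus>\<^bsub>free_algebra n\<^esub> b) \<oplus>\<^bsub>hecke n us q\<^esub> hecke_class n us q b"
    using assms(1,2) hecke_class_add[of "a \<ominus>\<^bsub>free_algebra n\<^esub> b" b] by simp
  also have "hecke_class n us q (a \<ominus>\<^bsub>free_algebra n\<^esub> b) = \<zero>\<^bsub>hecke n us q\<^esub>"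
    using I.a_rcos_const[OF assms(3)] by (simp add: hecke_class_def hecke_def FactRing_def)
  finally show ?thesis using hecke_class_closed[OF assms(2)] by simp
qed

end

context hecke_rep
begin

text \<open>The form repeats the scalar multiplication of \<open>H_tilde\<close>, so that the two
  can be compared directly.\<close>

definition class_act :: "(nat list \<Rightarrow> complex) set \<Rightarrow> ('x \<Rightarrow> complex) \<Rightarrow> 'x \<Rightarrow> complex" where
  "class_act X f = the_elem ((\<lambda>a. word_act Op a f) ` X)"

lemma class_act_class:
  assumes a: "a \<in> carrier (free_algebra n)" and f: "f \<in> U"
  shows "class_act (hecke_class n us q a) f = word_act Op a f"
proof -
  have "word_act Op b f = word_act Op a f" if "b \<in> hecke_class n us q a" for b
  proof -
    obtain i where i: "i \<in> hecke_ideal n us q" "b = i \<oplus>\<^bsub>free_algebra n\<^esub> a"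
      using \<open>b \<in> hecke_class n us q a\<close> mem_hecke_class[OF n] by blast
    then show ?thesis
      using hecke_ideal_acts_zero[OF i(1) f] word_act_add[OF hecke_ideal_carrier[OF n i(1)] a, of Op f] by simp
  qed
  then have "(\<lambda>a. word_act Op a f) ` hecke_class n us q a = {word_act Op a f}"
    using hecke_class_self[OF n a] by blast
  then show ?thesis by (simp add: class_act_def)
qed

lemma class_act_closed:
  assumes "X \<in> carrier (hecke n us q)" "f \<in> U"
  shows "class_act X f \<in> U"
  using assms word_act_closed[OF U] by (auto simp: hecke_carrier[OF n] class_act_class)

lemma class_act_mult:
  assumes "X \<in> carrier (hecke n us q)" "Y \<in> carrier (hecke n us q)" "f \<in> U"
  shows "class_act (X \<otimes>\<^bsub>hecke n us q\<^esub> Y) f = class_act X (class_act Y f)"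
proof -
  obtain a b where ab: "a \<in> carrier (free_algebra n)" "b \<in> carrier (free_algebra n)"
    "X = hecke_class n us q a" "Y = hecke_class n us q b"
    using assms(1,2) by (auto simp: hecke_carrier[OF n])
  have "a \<otimes>\<^bsub>free_algebra n\<^esub> b \<in> carrier (free_algebra n)" using ab free_algebra_mult_closed by blast
  moreover have "word_act Op b f \<in> U" by (rule word_act_closed[OF U ab(2) assms(3)])
  ultimately show ?thesis
    using ab assms(3) by (simp add: hecke_class_mult[OF n, symmetric] class_act_class word_act_mult[OF lin])
qed

lemma class_act_add:
  assumes "X \<in> carrier (hecke n us q)" "Y \<in> carrier (hecke n us q)" "f \<in> U"
  shows "class_act (X \<oplus>\<^bsub>hecke n us q\<^esub> Y) f = (\<lambda>x. class_act X f x + class_act Y f x)"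
proof -
  obtain a b where ab: "a \<in> carrier (free_algebra n)" "b \<in> carrier (free_algebra n)"
    "X = hecke_class n us q a" "Y = hecke_class n us q b"
    using assms(1,2) by (auto simp: hecke_carrier[OF n])
  moreover have "a \<oplus>\<^bsub>free_algebra n\<^esub> b \<in> carrier (free_algebra n)"
    using ab abelian_groupE(1)[OF ring.is_abelian_group[OF ring_free_algebra]] by blast
  ultimately show ?thesis
    using assms(3) by (simp add: hecke_class_add[OF n, symmetric] class_act_class word_act_add)
qed

lemma class_act_one: "f \<in> U \<Longrightarrow> class_act \<one>\<^bsub>hecke n us q\<^esub> f = f"
  using class_act_class[OF ring.ring_simprules(6)[OF ring_free_algebra]]
  by (simp add: hecke_class_one[OF n, symmetric])

lemma class_act_zero: "f \<in> U \<Longrightarrow> class_act \<zero>\<^bsub>hecke n us q\<^esub> f = (\<lambda>x. 0)"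
  using class_act_class[OF ring.ring_simprules(2)[OF ring_free_algebra]]
  by (simp add: hecke_class_zero[OF n, symmetric] free_zero)

text \<open>A simple summand of the regular module on which \<open>x \<mapsto> \<psi> (x f0)\<close> does not vanish is one-dimensional
  with character \<open>\<chi>\<close>, because the kernel of this map is a submodule.\<close>

lemma semisimple_eigenvector:
  assumes ss: "semisimple_ring (hecke n us q)"
    and \<psi>: "\<And>f g. \<psi> (\<lambda>x. f x + g x) = \<psi> f + \<psi> g" "\<And>z f. \<psi> (\<lambda>x. z * f x) = z * \<psi> f"
    and \<chi>: "\<And>i f. i \<in> {1..n} \<Longrightarrow> f \<in> U \<Longrightarrow> \<psi> (Op i f) = \<chi> i * \<psi> f"
    and f0: "f0 \<in> U" "\<psi> f0 \<noteq> (0::complex)"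
  shows "\<exists>w\<in>U. \<psi> w \<noteq> 0 \<and> (\<forall>i\<in>{1..n}. Op i w = (\<lambda>x. \<chi> i * w x))"
proof -
  let ?R = "hecke n us q" and ?A = "free_algebra n"
  let ?M = "regular_module ?R"
  interpret A: ring ?A by (rule ring_free_algebra)
  interpret R: ring ?R by (rule ring_hecke[OF n])
  have M [simp]: "carrier ?M = carrier ?R" "add ?M = add ?R" "zero ?M = zero ?R" "smult ?M = mult ?R"
    by (simp_all add: regular_module_def)
  have \<psi>0: "\<psi> (\<lambda>x. 0) = 0" using \<psi>(2)[of 0 f0] by simp
  have \<psi>sum: "\<psi> (\<lambda>x. \<Sum>w\<in>W. c w * g w x) = (\<Sum>w\<in>W. c w * \<psi> (g w))"
    for W :: "nat list set" and c and g :: "nat list \<Rightarrow> 'x \<Rightarrow> complex"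
    by (induction W rule: infinite_finite_induct) (simp_all add: \<psi> \<psi>0)
  \<comment> \<open>The kernel of \<open>\<psi>\<close> in \<open>U\<close> is invariant under the
    generators, since each of them only multiplies \<open>\<psi>\<close> by a number.\<close>
  have kill: "\<psi> (word_act Op a f) = 0" if a: "a \<in> carrier ?A" and f: "f \<in> U" "\<psi> f = 0" for a f
  proof -
    have "foldr Op w f \<in> U \<and> \<psi> (foldr Op w f) = 0" if "set w \<subseteq> {1..n}" for w
      using that by (induction w) (use f U in \<open>simp_all add: \<chi>\<close>)
    then show ?thesis
      unfolding word_act_def pairing_def \<psi>sum using free_letters[OF a] by (simp add: sum.neutral)
  qed
  obtain S where S: "left_module ?R ?M" "\<And>N. N \<in> S \<Longrightarrow> submodule N ?R ?M"
      "\<And>N. N \<in> S \<Longrightarrow> simple_left_module ?R (?M\<lparr>carrier := N\<rparr>)" "internal_direct_sum ?M S"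
    using ss unfolding semisimple_ring_def semisimple_left_module_def by blast
  interpret M: left_module ?R ?M by (rule S(1))
  obtain F e where F: "finite F" "F \<subseteq> S" "\<And>N. N \<in> F \<Longrightarrow> e N \<in> N" "\<one>\<^bsub>?R\<^esub> = finsum ?M e F"
    using S(4) R.one_closed unfolding internal_direct_sum_def M by metis
  have sub: "N \<subseteq> carrier ?R" if "N \<in> S" for N
    using subgroup.subset[OF submodule.axioms(1)[OF S(2)[OF that]]] by simp
  \<comment> \<open>The unit is the sum of its components \<open>e N\<close>; if all of them gave 0,
    so would \<open>\<psi> f0\<close>.\<close>
  have "\<exists>N\<in>F. \<psi> (class_act (e N) f0) \<noteq> 0"
  proof (rule ccontr)
    assume no: "\<not> (\<exists>N\<in>F. \<psi> (class_act (e N) f0) \<noteq> 0)"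
    have "finsum ?M e F' \<in> carrier ?R \<and> \<psi> (class_act (finsum ?M e F') f0) = 0" if "F' \<subseteq> F" for F'
      using finite_subset[OF that F(1)] that
    proof (induction F')
      case empty
      then show ?case using class_act_zero[OF f0(1)] \<psi>0 M.finsum_empty[of e] by simp
    next
      case (insert N F')
      have e: "e \<in> F' \<rightarrow> carrier ?M" "e N \<in> carrier ?M"
        using insert.prems F(2,3) sub by auto
      have "finsum ?M e (insert N F') = e N \<oplus>\<^bsub>?M\<^esub> finsum ?M e F'"
        using insert.hyps e by (intro M.finsum_insert)
      then show ?case
        using insert.IH insert.prems e no by (auto simp: class_act_add[OF _ _ f0(1)] \<psi>)
    qed
    then have "\<psi> (class_act \<one>\<^bsub>?R\<^esub> f0) = 0" unfolding F(4) by blast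
    then show False using class_act_one[OF f0(1)] f0(2) by simp
  qed
  then obtain N where N: "N \<in> F" "N \<in> S" "\<psi> (class_act (e N) f0) \<noteq> 0" using F(2) by blast
  define N0 where "N0 = {x \<in> N. \<psi> (class_act x f0) = 0}"
  have smult: "X \<otimes>\<^bsub>?R\<^esub> x \<in> N" if "X \<in> carrier ?R" "x \<in> N" for X x
    using submodule.smult_closed[OF S(2)[OF N(2)], of X x] that by simp
  have kill_class: "\<psi> (class_act (X \<otimes>\<^bsub>?R\<^esub> x) f0) = 0"
    if X: "X \<in> carrier ?R" and x: "x \<in> carrier ?R" "\<psi> (class_act x f0) = 0" for X x
  proof -
    obtain a where "a \<in> carrier ?A" "X = hecke_class n us q a" using X by (auto simp: hecke_carrier[OF n])
    then show ?thesis
      unfolding class_act_mult[OF X x(1) f0(1)]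
      using kill[of a "class_act x f0"] class_act_closed[OF x(1) f0(1)] x
      by (simp add: class_act_class)
  qed
  have "submodule N0 ?R (?M\<lparr>carrier := N\<rparr>)"
  proof (intro submodule.intro submodule_axioms.intro)
    have lm: "left_module ?R (?M\<lparr>carrier := N\<rparr>)" using S(3)[OF N(2)] by (simp add: simple_left_module_def)
    then interpret N: abelian_group "?M\<lparr>carrier := N\<rparr>" by (simp add: left_module_def)
    show "subgroup N0 (add_monoid (?M\<lparr>carrier := N\<rparr>))"
    proof
      show "N0 \<subseteq> carrier (add_monoid (?M\<lparr>carrier := N\<rparr>))" by (auto simp: N0_def)
      have "\<zero>\<^bsub>?R\<^esub> \<in> N" using N.zero_closed by simp
      then show "\<one>\<^bsub>add_monoid (?M\<lparr>carrier := N\<rparr>)\<^esub> \<in> N0"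
        using class_act_zero[OF f0(1)] \<psi>0 by (simp add: N0_def)
    next
      fix x y assume xy: "x \<in> N0" "y \<in> N0"
      then have "x \<oplus>\<^bsub>?R\<^esub> y \<in> N" using N.a_closed[of x y] by (simp add: N0_def)
      moreover have "\<psi> (class_act (x \<oplus>\<^bsub>?R\<^esub> y) f0) = 0"
        using xy sub[OF N(2)] by (subst class_act_add[OF _ _ f0(1)]) (auto simp: N0_def \<psi>)
      ultimately show "x \<otimes>\<^bsub>add_monoid (?M\<lparr>carrier := N\<rparr>)\<^esub> y \<in> N0" by (simp add: N0_def)
    next
      fix x assume x: "x \<in> N0"
      let ?y = "inv\<^bsub>add_monoid (?M\<lparr>carrier := N\<rparr>)\<^esub> x"
      have y: "?y \<in> N" "x \<oplus>\<^bsub>?R\<^esub> ?y = \<zero>\<^bsub>?R\<^esub>"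
        using N.a_inv_closed[of x] N.r_neg[of x] x by (simp_all add: a_inv_def N0_def)
      have "\<psi> (class_act x f0) + \<psi> (class_act ?y f0) = \<psi> (class_act (x \<oplus>\<^bsub>?R\<^esub> ?y) f0)"
        using x y sub[OF N(2)] by (subst class_act_add[OF _ _ f0(1)]) (auto simp: N0_def \<psi>)
      also have "\<dots> = 0" using y(2) class_act_zero[OF f0(1)] \<psi>0 by simp
      finally show "?y \<in> N0" using x y(1) by (simp add: N0_def)
    qed
    fix X x assume "X \<in> carrier ?R" "x \<in> N0"
    then show "X \<odot>\<^bsub>?M\<lparr>carrier := N\<rparr>\<^esub> x \<in> N0"
      using smult[of X x] kill_class[of X x] sub[OF N(2)] by (auto simp: N0_def)
  qed
  then have "N0 = {\<zero>\<^bsub>?R\<^esub>} \<or> N0 = N"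
    using S(3)[OF N(2)] by (simp add: simple_left_module_def)
  moreover have "e N \<in> N" using F(3)[OF N(1)] .
  ultimately have N0: "N0 = {\<zero>\<^bsub>?R\<^esub>}" using N(3) by (auto simp: N0_def)
  define w where "w = class_act (e N) f0"
  have eN: "e N \<in> carrier ?R" using \<open>e N \<in> N\<close> sub[OF N(2)] by blast
  have wU: "w \<in> U" unfolding w_def by (rule class_act_closed[OF eN f0(1)])
  have "Op i w = (\<lambda>x. \<chi> i * w x)" if i: "i \<in> {1..n}" for i
  proof -
    \<comment> \<open>T_i - \<chi>(i) moves \<open>e N\<close> into the kernel \<open>N0\<close>,
      which is zero by simplicity, so \<open>e N\<close> applied to \<open>f0\<close> is an
      eigenvector.\<close>
    let ?a = "gen i \<ominus>\<^bsub>?A\<^esub> scal (\<chi> i)"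
    have a: "?a \<in> carrier ?A" using i by (intro A.minus_closed gen_carrier scal_carrier)
    have act: "class_act (hecke_class n us q ?a \<otimes>\<^bsub>?R\<^esub> e N) f0 = (\<lambda>x. Op i w x - \<chi> i * w x)"
      using class_act_mult[OF hecke_class_closed[OF n a] eN f0(1)] class_act_class[OF a wU]
        word_act_minus[OF gen_carrier[OF i] scal_carrier, of Op "\<chi> i" w]
      by (simp add: w_def)
    have "\<psi> (\<lambda>x. Op i w x - \<chi> i * w x) = \<psi> (\<lambda>x. Op i w x + (- \<chi> i) * w x)" by simp
    also have "\<dots> = 0" unfolding \<psi> \<chi>[OF i wU] by simp
    finally have "hecke_class n us q ?a \<otimes>\<^bsub>?R\<^esub> e N \<in> N0"
      using smult[OF hecke_class_closed[OF n a] \<open>e N \<in> N\<close>] by (simp add: N0_def act)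
    then have "(\<lambda>x. Op i w x - \<chi> i * w x) = (\<lambda>x. 0)"
      using act class_act_zero[OF f0(1)] N0 by simp
    then show ?thesis by (simp add: fun_eq_iff)
  qed
  then show ?thesis using wU N(3) by (intro bexI[of _ w]) (simp_all add: w_def)
qed

end

section \<open>Parameters of a semisimple algebra\<close>

text \<open>For \<open>\<eta> j = - v q\<^sup>1\<^sup>-\<^sup>j\<close> this functional spans those on which \<open>T\<^sub>1\<close> acts by \<open>u\<close> and the
  other generators act by \<open>q\<close>. The vectors with these eigenvalues form a line, on which
  the functional vanishes as soon as \<open>v = u q\<^sup>2\<^sup>k\<close> for some \<open>k < n\<close>.\<close>

definition tensor_functional :: "nat \<Rightarrow> (nat \<Rightarrow> complex) \<Rightarrow> ((nat \<Rightarrow> bool) \<Rightarrow> complex) \<Rightarrow> complex" where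
  "tensor_functional n \<eta> f = (\<Sum>S\<in>Pow {1..n}. (\<Prod>j\<in>S. \<eta> j) * f (\<lambda>k. k \<in> S))"

lemma sum_Pow_split:
  assumes "finite A" "j \<in> A"
  shows "sum g (Pow A) = (\<Sum>S\<in>Pow (A - {j}). g S + g (insert j S))"
proof -
  have A: "A = insert j (A - {j})" using assms by auto
  have "Pow A = Pow (A - {j}) \<union> insert j ` Pow (A - {j})"
    using Pow_insert[of j "A - {j}"] A by simp
  moreover have "Pow (A - {j}) \<inter> insert j ` Pow (A - {j}) = {}" by auto
  ultimately have "sum g (Pow A) = sum g (Pow (A - {j})) + sum g (insert j ` Pow (A - {j}))"
    using assms(1) by (simp add: sum.union_disjoint)
  also have "sum g (insert j ` Pow (A - {j})) = (\<Sum>S\<in>Pow (A - {j}). g (insert j S))"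
    by (rule sum.reindex_cong[of "insert j"]) (auto simp: inj_on_def)
  finally show ?thesis by (simp add: sum.distrib)
qed

lemma tensor_functional_split:
  assumes "j \<in> {1..n}"
  shows "tensor_functional n \<eta> f =
    (\<Sum>S\<in>Pow ({1..n} - {j}). (\<Prod>k\<in>S. \<eta> k) * (f ((\<lambda>k. k \<in> S)(j := False)) + \<eta> j * f ((\<lambda>k. k \<in> S)(j := True))))"
  unfolding tensor_functional_def
proof (subst sum_Pow_split[OF _ assms], simp, rule sum.cong[OF refl])
  fix S assume S: "S \<in> Pow ({1..n} - {j})"
  then have "finite S" "j \<notin> S" using finite_subset[of S "{1..n}"] by auto
  moreover from this have "(\<lambda>k. k \<in> S) = (\<lambda>k. k \<in> S)(j := False)"
    "(\<lambda>k. k \<in> insert j S) = (\<lambda>k. k \<in> S)(j := True)" by (auto simp: fun_eq_iff)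
  ultimately show "(\<Prod>j\<in>S. \<eta> j) * f (\<lambda>k. k \<in> S) + (\<Prod>j\<in>insert j S. \<eta> j) * f (\<lambda>k. k \<in> insert j S) =
      (\<Prod>k\<in>S. \<eta> k) * (f ((\<lambda>k. k \<in> S)(j := False)) + \<eta> j * f ((\<lambda>k. k \<in> S)(j := True)))"
    by (simp add: algebra_simps)
qed

lemma tensor_functional_split2:
  assumes "i \<in> {2..n}"
  shows "tensor_functional n \<eta> f =
    (\<Sum>S\<in>Pow ({1..n} - {i} - {i - 1}). (\<Prod>k\<in>S. \<eta> k) *
      (f ((\<lambda>k. k \<in> S)(i - 1 := False, i := False)) + \<eta> i * f ((\<lambda>k. k \<in> S)(i - 1 := False, i := True))
       + \<eta> (i - 1) * f ((\<lambda>k. k \<in> S)(i - 1 := True, i := False))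
       + \<eta> (i - 1) * \<eta> i * f ((\<lambda>k. k \<in> S)(i - 1 := True, i := True))))"
proof -
  let ?g = "\<lambda>S. (\<Prod>k\<in>S. \<eta> k) * (f ((\<lambda>k. k \<in> S)(i := False)) + \<eta> i * f ((\<lambda>k. k \<in> S)(i := True)))"
  have i: "i \<in> {1..n}" "i - 1 \<in> {1..n} - {i}" using assms by auto
  have "tensor_functional n \<eta> f = (\<Sum>S\<in>Pow ({1..n} - {i}). ?g S)"
    by (rule tensor_functional_split[OF i(1)])
  also have "\<dots> = (\<Sum>S\<in>Pow ({1..n} - {i} - {i - 1}). ?g S + ?g (insert (i - 1) S))"
    by (rule sum_Pow_split[OF _ i(2)]) simp
  also have "\<dots> = (\<Sum>S\<in>Pow ({1..n} - {i} - {i - 1}). (\<Prod>k\<in>S. \<eta> k) *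
      (f ((\<lambda>k. k \<in> S)(i - 1 := False, i := False)) + \<eta> i * f ((\<lambda>k. k \<in> S)(i - 1 := False, i := True))
       + \<eta> (i - 1) * f ((\<lambda>k. k \<in> S)(i - 1 := True, i := False))
       + \<eta> (i - 1) * \<eta> i * f ((\<lambda>k. k \<in> S)(i - 1 := True, i := True))))"
  proof (rule sum.cong[OF refl])
    fix S assume S: "S \<in> Pow ({1..n} - {i} - {i - 1})"
    then have "finite S" "i - 1 \<notin> S" using finite_subset[of S "{1..n}"] by auto
    moreover from this have "(\<lambda>k. k \<in> S)(i := b) = (\<lambda>k. k \<in> S)(i - 1 := False, i := b)"
      "(\<lambda>k. k \<in> insert (i - 1) S)(i := b) = (\<lambda>k. k \<in> S)(i - 1 := True, i := b)" for b
      by (auto simp: fun_eq_iff)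
    ultimately show "?g S + ?g (insert (i - 1) S) = (\<Prod>k\<in>S. \<eta> k) *
      (f ((\<lambda>k. k \<in> S)(i - 1 := False, i := False)) + \<eta> i * f ((\<lambda>k. k \<in> S)(i - 1 := False, i := True))
       + \<eta> (i - 1) * f ((\<lambda>k. k \<in> S)(i - 1 := True, i := False))
       + \<eta> (i - 1) * \<eta> i * f ((\<lambda>k. k \<in> S)(i - 1 := True, i := True)))"
      by (simp only: prod.insert if_False) (simp add: algebra_simps)
  qed
  finally show ?thesis .
qed

lemma tensor_exch_upd:
  assumes "i \<ge> 1"
  shows "exch (tensor_diag q) tensor_off i g (w(i - 1 := x, i := y)) =
    (if x = y then q * g (w(i - 1 := x, i := y)) else (if x then (q - inverse q) * g (w(i - 1 := x, i := y)) else 0)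
       + g (w(i - 1 := y, i := x)))"
proof -
  have "w(i - 1 := x, i := y) \<circ> transpose (i - 1) i = w(i - 1 := y, i := x)"
    using assms by (auto simp: fun_eq_iff transpose_def)
  then show ?thesis using assms by (auto simp: exch_def tensor_diag_def tensor_off_def)
qed

theorem semisimple_parameters:
  assumes n: "n \<ge> 1" and q: "q \<noteq> 0" and ss: "semisimple_ring (hecke n us q)"
    and ij: "i < length us" "j < length us" "i \<noteq> j" and nz: "us ! i \<noteq> 0" and k: "k < n"
  shows "us ! j \<noteq> us ! i * q ^ (2 * k)"
proof
  define u v where "u = us ! i" and "v = us ! j"
  assume "us ! j = us ! i * q ^ (2 * k)"
  then have v: "v = u * q ^ (2 * k)" by (simp add: u_def v_def)
  have "hecke_rep n us q (tensor_op q u v) UNIV"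
    using hecke_rep_tensor[OF n q, of i j us u v] hecke_rep_tensor[OF n q, of j i us u v] ij
    by (cases "i < j") (simp_all add: u_def v_def)
  then interpret T: hecke_rep n us q "tensor_op q u v" UNIV .
  define \<eta> where "\<eta> j = - v / q ^ (j - 1)" for j
  define \<chi> where "\<chi> i = (if i = 1 then u else q)" for i :: nat
  define f0 :: "(nat \<Rightarrow> bool) \<Rightarrow> complex" where "f0 w = (if w = (\<lambda>k. False) then 1 else 0)" for w
  have "\<exists>w\<in>UNIV. tensor_functional n \<eta> w \<noteq> 0 \<and> (\<forall>i\<in>{1..n}. tensor_op q u v i w = (\<lambda>x. \<chi> i * w x))"
  proof (rule T.semisimple_eigenvector[OF ss])
    fix i f assume i: "i \<in> {1..n}"
    show "tensor_functional n \<eta> (tensor_op q u v i f) = \<chi> i * tensor_functional n \<eta> f"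
    proof (cases "i = 1")
      case True
      have \<eta>1: "\<eta> 1 = - v" by (simp add: \<eta>_def)
      show ?thesis unfolding tensor_functional_split[OF i] sum_distrib_left
        by (rule sum.cong[OF refl]) (simp add: True tensor_op_def reflection_op_def \<chi>_def \<eta>1[simplified] algebra_simps)
    next
      case False
      then have i2: "i \<in> {2..n}" "i \<ge> 1" using i by auto
      have \<eta>i: "\<eta> (i - 1) = q * \<eta> i"
      proof -
        have "i - 1 = Suc (i - 1 - 1)" using i2 by auto
        then have "q ^ (i - 1) = q * q ^ (i - 1 - 1)" by (metis power_Suc)
        then show ?thesis using q by (simp add: \<eta>_def field_simps)
      qed
      show ?thesis unfolding tensor_functional_split2[OF i2(1)] sum_distrib_left \<eta>i
        using False q
        by (intro sum.cong[OF refl])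
           (simp add: tensor_op_def \<chi>_def tensor_exch_upd[OF i2(2)] field_simps del: One_nat_def)
    qed
  next
    have "tensor_functional n \<eta> f0 = (\<Sum>S\<in>Pow {1..n}. if S = {} then 1 else 0)"
      unfolding tensor_functional_def by (rule sum.cong[OF refl]) (auto simp: f0_def fun_eq_iff)
    also have "\<dots> = 1" by simp
    finally show "tensor_functional n \<eta> f0 \<noteq> 0" by simp
  qed (simp_all add: tensor_functional_def distrib_left sum.distrib sum_distrib_left mult_ac)
  then obtain w where w: "tensor_functional n \<eta> w \<noteq> 0"
    "\<And>i. i \<in> {1..n} \<Longrightarrow> tensor_op q u v i w = (\<lambda>x. \<chi> i * w x)" by blast
  \<comment> \<open>The eigenvector equations determine \<open>w\<close> on {1..n} up to a scalar:
    T_1 fixes the ratio of the two entries at position 1, and each further generator passes the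
    ratio on to the next position, multiplied by q.\<close>
  have step: "w (s(j := False)) = u * q ^ (j - 1) * w (s(j := True))" if "1 \<le> j" "j \<le> n" for j s
    using that
  proof (induction j arbitrary: s rule: dec_induct)
    case base
    have "tensor_op q u v 1 w (s(1 := True)) = u * w (s(1 := True))"
      using w(2)[of 1] n by (simp add: \<chi>_def)
    then have "w (s(1 := False)) = u * q ^ (1 - 1) * w (s(1 := True))"
      by (simp add: tensor_op_def reflection_op_def)
    then show ?case .
  next
    case (step j)
    have "tensor_op q u v (Suc j) w (s(j := False, Suc j := True)) = q * w (s(j := False, Suc j := True))"
      using w(2)[of "Suc j"] step by (simp add: \<chi>_def)
    then have ex: "w (s(j := True, Suc j := False)) = q * w (s(j := False, Suc j := True))"
      using tensor_exch_upd[of "Suc j" q w s False True] step by (simp add: tensor_op_def)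
    have IH: "w (s(j := False, Suc j := b)) = u * q ^ (j - 1) * w (s(j := True, Suc j := b))" for b
    proof -
      have tw: "s(j := c, Suc j := b) = s(Suc j := b, j := c)" for c
        by (auto simp: fun_eq_iff)
      show ?thesis unfolding tw by (rule step.IH) (use step in simp)
    qed
    have p: "q * q ^ (j - 1) = q ^ j" using step by (metis Suc_pred' less_eq_Suc_le One_nat_def power_Suc)
    have "w (s(j := c, Suc j := False)) = u * q ^ j * w (s(j := c, Suc j := True))" for c
      using ex IH p by (cases c) (simp_all add: mult_ac flip: p)
    from this[of "s j"]
    have "w (s(Suc j := False)) = u * q ^ (Suc j - 1) * w (s(Suc j := True))" by simp
    then show ?case .
  qed
  \<comment> \<open>At position k + 1 the functional has the weights 1 and \<eta>(k+1) = - v q^(-k)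
    = - u q^k, while the entries of \<open>w\<close> are in the ratio u q^k to 1, so every summand
    cancels.\<close>
  have "tensor_functional n \<eta> w = 0"
  proof -
    have k1: "Suc k \<in> {1..n}" using k by simp
    have "u * q ^ k + \<eta> (Suc k) = 0"
      using q by (simp add: \<eta>_def v mult_2 power_add)
    then have "u * q ^ k * x + \<eta> (Suc k) * x = 0" for x
      by (simp add: distrib_right[symmetric])
    then show ?thesis
      unfolding tensor_functional_split[OF k1] using step[of "Suc k"] k by (intro sum.neutral) simp
  qed
  then show False using w(1) by simp
qed

section \<open>Contents of tableaux and the seminormal representation\<close>

section \<open>Contents of standard tableaux\<close>

definition cont :: "diagram_box \<Rightarrow> int" where
  "cont b = int (snd (snd b)) - int (fst (snd b))"

text \<open>Down-closedness puts the column above the box and the row to its left into the diagram,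
  and the longer of the two already has enough boxes.\<close>

lemma card_ge_abs_cont:
  assumes "finite D" "down_closed D" "b \<in> D"
  shows "\<bar>cont b\<bar> + 1 \<le> int (card {b' \<in> D. fst b' = fst b})"
proof -
  obtain i x y where b: "b = (i, x, y)" by (cases b)
  let ?C = "{b' \<in> D. fst b' = fst b}"
  have "(\<lambda>x'. (i, x', y)) ` {..x} \<subseteq> ?C" "(\<lambda>y'. (i, x, y')) ` {..y} \<subseteq> ?C"
    using assms(3) b by (auto intro!: down_closedD[OF assms(2,3)] simp: box_le_def)
  then have "card ((\<lambda>x'. (i, x', y)) ` {..x}) \<le> card ?C" "card ((\<lambda>y'. (i, x, y')) ` {..y}) \<le> card ?C"
    using assms(1) by (auto intro!: card_mono)
  then have "Suc x \<le> card ?C" "Suc y \<le> card ?C" by (simp_all add: card_image inj_on_def)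
  then show ?thesis by (simp add: cont_def b)
qed

text \<open>The two components are disjoint, so their sizes add up. The bound leaves room for a
  shift by one: even then the difference of the contents stays below n in absolute value, the range
  in which the parameters are separated.\<close>

lemma abs_cont_sum_le:
  assumes "D \<in> diagrams r n" "b \<in> D" "b' \<in> D" "fst b \<noteq> fst b'"
  shows "\<bar>cont b\<bar> + \<bar>cont b'\<bar> + 2 \<le> int n"
proof -
  have D: "finite D" "down_closed D" "card D = n" using assms(1) by (simp_all add: diagrams_def)
  let ?C = "\<lambda>b. {b' \<in> D. fst b' = fst b}"
  have "card (?C b) + card (?C b') = card (?C b \<union> ?C b')"
    using D(1) assms(4) by (intro card_Un_disjoint[symmetric]) auto
  also have "\<dots> \<le> n" unfolding D(3)[symmetric] using D(1) by (intro card_mono) auto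
  finally show ?thesis
    using card_ge_abs_cont[OF D(1,2) assms(2)] card_ge_abs_cont[OF D(1,2) assms(3)] by linarith
qed

lemma std_prefix_down_closed:
  assumes "L \<in> std n D" "down_closed D" "k \<le> n"
  shows "down_closed (L ` {1..k})"
  unfolding down_closed_def
proof (intro ballI allI impI)
  fix b b' assume b: "b \<in> L ` {1..k}" "box_le b' b"
  then obtain l where l: "l \<in> {1..k}" "b = L l" by blast
  have ln: "l \<in> {1..n}" using l assms(3) by simp
  then have "L l \<in> D" using bij_betwE[OF std_bij[OF assms(1)]] by blast
  then have "b' \<in> D" using down_closedD[OF assms(2)] b(2) l(2) by blast
  then obtain m where m: "m \<in> {1..n}" "b' = L m"
    using std_bij[OF assms(1)] unfolding bij_betw_def by blast
  have "m \<le> l" using std_le[OF assms(1) m(1) ln] b(2) l(2) m(2) by simp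
  then show "b' \<in> L ` {1..k}" using m l by auto
qed

text \<open>Of two incomparable boxes in one component, one lies strictly below and strictly to the
  left of the other, and each direction contributes at least one.\<close>

lemma incomparable_cont:
  assumes "\<not> box_le b b'" "\<not> box_le b' b" "fst b = fst b'"
  shows "\<bar>cont b - cont b'\<bar> \<ge> 2"
  using assms by (cases b; cases b') (auto simp: box_le_def cont_def)

lemma swap_std_iff:
  assumes L: "L \<in> std n D" and i: "i \<in> {2..n}"
  shows "swap_entries i L \<in> std n D \<longleftrightarrow> \<not> box_le (L (i - 1)) (L i)"
proof
  assume s: "swap_entries i L \<in> std n D"
  show "\<not> box_le (L (i - 1)) (L i)"
  proof
    assume "box_le (L (i - 1)) (L i)"
    then have "box_le (swap_entries i L i) (swap_entries i L (i - 1))"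
      by (simp add: swap_entries_def)
    moreover have "i \<in> {1..n}" "i - 1 \<in> {1..n}" using i by auto
    ultimately have "i \<le> i - 1" using std_le[OF s] by blast
    moreover have "2 \<le> i" using i by simp
    ultimately show False by linarith
  qed
next
  assume nle: "\<not> box_le (L (i - 1)) (L i)"
  let ?t = "transpose (i - 1) i"
  have t: "?t k \<in> {1..n}" if "k \<in> {1..n}" for k using that i by (auto simp: transpose_def)
  have "bij_betw ?t {1..n} {1..n}"
    by (rule bij_betw_byWitness[where f' = ?t]) (use t in \<open>auto simp: image_subset_iff\<close>)
  then have "bij_betw (L \<circ> ?t) {1..n} D" using std_bij[OF L] by (rule bij_betw_trans)
  moreover have "L \<circ> ?t \<in> extensional {1..n}"
  proof -
    have "L (?t k) = undefined" if "k \<notin> {1..n}" for k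
    proof -
      have "?t k = k" using that i by (auto simp: transpose_def)
      then show ?thesis using std_extensional[OF L] that by (simp add: extensional_def)
    qed
    then show ?thesis unfolding extensional_def by (simp del: atLeastAtMost_iff)
  qed
  moreover have "k \<le> l" if k: "k \<in> {1..n}" and l: "l \<in> {1..n}" and le: "box_le ((L \<circ> ?t) k) ((L \<circ> ?t) l)" for k l
  proof (rule ccontr)
    assume "\<not> k \<le> l"
    moreover have "?t k \<le> ?t l" using std_le[OF L t[OF k] t[OF l]] le by simp
    ultimately have "k = i" "l = i - 1" by (auto simp: transpose_def split: if_splits)
    then show False using nle le by simp
  qed
  ultimately show "swap_entries i L \<in> std n D"
    unfolding swap_entries_def by (intro stdI)
qed

text \<open>Two boxes on a diagonal enclose at least two others, whose entries lie strictly between.\<close>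

lemma std_cont_neq:
  assumes L: "L \<in> std n D" and D: "down_closed D" and kl: "k \<in> {1..n}" "l \<in> {1..n}" "k < l" "l \<le> k + 2"
    and fst: "fst (L k) = fst (L l)"
  shows "cont (L k) \<noteq> cont (L l)"
proof
  assume eq: "cont (L k) = cont (L l)"
  obtain i x y x' y' where e: "L k = (i, x, y)" "L l = (i, x', y')"
    using fst by (cases "L k"; cases "L l") auto
  have inj: "a = b" if "L a = L b" "a \<in> {1..n}" "b \<in> {1..n}" for a b
    using std_bij[OF L] that by (meson bij_betw_imp_inj_on inj_onD)
  have "\<not> x' \<le> x"
  proof
    assume "x' \<le> x"
    then have "box_le (L l) (L k)" using eq e by (simp add: box_le_def cont_def)
    then have "l \<le> k" by (rule std_le[OF L kl(2,1)])
    then show False using kl(3) by simp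
  qed
  then have xy: "x < x'" "y < y'" using eq e by (auto simp: cont_def)
  have LD: "L l \<in> D" using bij_betwE[OF std_bij[OF L]] kl(2) by blast
  have mid: "\<exists>m\<in>{1..n}. L m = b \<and> k < m \<and> m < l" if b: "box_le (L k) b" "box_le b (L l)" "b \<noteq> L k" "b \<noteq> L l" for b
  proof -
    have "b \<in> D" using down_closedD[OF D LD b(2)] .
    then obtain m where m: "m \<in> {1..n}" "b = L m" using std_bij[OF L] unfolding bij_betw_def by blast
    have "k \<le> m" "m \<le> l" using std_le[OF L kl(1) m(1)] std_le[OF L m(1) kl(2)] b m by auto
    moreover have "k \<noteq> m" "m \<noteq> l" using b m by auto
    ultimately show ?thesis using m by auto
  qed
  obtain m where m: "L m = (i, x, y')" "k < m" "m < l"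
    using mid[of "(i, x, y')"] xy e by (auto simp: box_le_def)
  obtain m' where m': "L m' = (i, x', y)" "k < m'" "m' < l"
    using mid[of "(i, x', y)"] xy e by (auto simp: box_le_def)
  have "m = m'" using m m' kl by linarith
  then show False using m m' xy by simp
qed

text \<open>A box between the two would carry an entry strictly between i - 1 and i, so they are
  neighbours in a row or a column.\<close>

lemma std_adjacent:
  assumes L: "L \<in> std n D" and D: "down_closed D" and i: "i \<in> {2..n}" and le: "box_le (L (i - 1)) (L i)"
  shows "\<bar>cont (L (i - 1)) - cont (L i)\<bar> = 1"
proof -
  have i': "i - 1 \<in> {1..n}" "i \<in> {1..n}" "i - 1 < i" using i by auto
  obtain j x y x' y' where e: "L (i - 1) = (j, x, y)" "L i = (j, x', y')" "x \<le> x'" "y \<le> y'"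
    using le by (cases "L (i - 1)"; cases "L i") (auto simp: box_le_def)
  have LD: "L i \<in> D" using bij_betwE[OF std_bij[OF L]] i' by blast
  have mid: "b = L (i - 1) \<or> b = L i" if b: "box_le (L (i - 1)) b" "box_le b (L i)" for b
  proof -
    have "b \<in> D" using down_closedD[OF D LD b(2)] .
    then obtain m where m: "m \<in> {1..n}" "b = L m" using std_bij[OF L] unfolding bij_betw_def by blast
    have "i - 1 \<le> m" "m \<le> i" using std_le[OF L i'(1) m(1)] std_le[OF L m(1) i'(2)] b m by auto
    then have "m = i - 1 \<or> m = i" using i'(3) by linarith
    then show ?thesis using m(2) by blast
  qed
  have ne: "(x, y) \<noteq> (x', y')"
    using std_bij[OF L] i' e unfolding bij_betw_def inj_on_def by (metis less_irrefl prod.inject)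
  show ?thesis
  proof (cases "x = x'")
    case True
    then have "y < y'" using ne e by simp
    then have "y' = Suc y" using mid[of "(j, x, Suc y)"] e True by (auto simp: box_le_def)
    then show ?thesis using e True by (simp add: cont_def)
  next
    case False
    then have "x < x'" using e by simp
    then have "x' = Suc x \<and> y = y'" using mid[of "(j, Suc x, y)"] e by (auto simp: box_le_def)
    then show ?thesis using e by (simp add: cont_def)
  qed
qed

lemma std_swap_cont:
  assumes L: "L \<in> std n D" and D: "down_closed D" and i: "i \<in> {2..n}"
    and sw: "swap_entries i L \<in> std n D" and fst: "fst (L (i - 1)) = fst (L i)"
  shows "\<bar>cont (L (i - 1)) - cont (L i)\<bar> \<ge> 2"
proof (rule incomparable_cont[OF _ _ fst])
  show "\<not> box_le (L (i - 1)) (L i)" using swap_std_iff[OF L i] sw by blast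
  show "\<not> box_le (L i) (L (i - 1))"
  proof
    assume "box_le (L i) (L (i - 1))"
    moreover have "i \<in> {1..n}" "i - 1 \<in> {1..n}" using i by auto
    ultimately have "i \<le> i - 1" using std_le[OF L] by blast
    moreover have "2 \<le> i" using i by simp
    ultimately show False by linarith
  qed
qed

locale separated_parameters =
  fixes q :: real and n r :: nat and us :: "complex list"
  assumes q: "q > 0" "q \<noteq> 1" and n: "n \<ge> 1" and len: "length us = r" and nz: "0 \<notin> set us"
    and sep: "\<And>i j k. i < r \<Longrightarrow> j < r \<Longrightarrow> i \<noteq> j \<Longrightarrow> k < n \<Longrightarrow>
      us ! j \<noteq> us ! i * complex_of_real q ^ (2 * k)"
begin

text \<open>The number q^(2c(b)) in closed form. It depends neither on the choice of a content
  function nor on a multipartition containing the box, so one \<open>ct\<close> serves all shapes at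
  once.\<close>

definition ct :: "diagram_box \<Rightarrow> complex" where
  "ct b = us ! fst b * complex_of_real (q powr (2 * of_int (cont b)))"

lemma us_nz: "i < r \<Longrightarrow> us ! i \<noteq> 0"
  using nz len nth_mem by metis

lemma ct_nz: "fst b < r \<Longrightarrow> ct b \<noteq> 0"
  using us_nz q by (simp add: ct_def)

lemma ct_shift_same:
  assumes "fst b = fst b'" "fst b < r"
  shows "ct b = complex_of_real (q powr (2 * of_int e)) * ct b' \<longleftrightarrow> cont b = cont b' + e"
proof -
  have "ct b = complex_of_real (q powr (2 * of_int e)) * ct b' \<longleftrightarrow>
      complex_of_real (q powr (2 * of_int (cont b))) = complex_of_real (q powr (2 * of_int e) * q powr (2 * of_int (cont b')))"
    using assms us_nz by (simp add: ct_def)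
  also have "\<dots> \<longleftrightarrow> q powr (2 * of_int (cont b)) = q powr (2 * of_int (cont b' + e))"
    by (simp only: of_real_eq_iff powr_add[symmetric]) (simp add: algebra_simps)
  also have "\<dots> \<longleftrightarrow> 2 * real_of_int (cont b) = 2 * real_of_int (cont b' + e)"
    using q by (intro powr_inj) simp_all
  also have "\<dots> \<longleftrightarrow> real_of_int (cont b) = real_of_int (cont b' + e)"
    by (simp only: mult_cancel_left) simp
  also have "\<dots> \<longleftrightarrow> cont b = cont b' + e"
    by (rule of_int_eq_iff)
  finally show ?thesis .
qed

text \<open>The separation hypothesis speaks of nonnegative exponents; the other sign is obtained by
  exchanging the two components.\<close>

lemma ct_shift_neq:
  assumes "fst b \<noteq> fst b'" "fst b < r" "fst b' < r" "\<bar>cont b - cont b' - e\<bar> < int n"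
  shows "ct b \<noteq> complex_of_real (q powr (2 * of_int e)) * ct b'"
proof
  let ?p = "\<lambda>a. complex_of_real (q powr (2 * of_int a))"
  have pw: "?p (int k) = complex_of_real q ^ (2 * k)" for k
    using q by (simp add: powr_realpow[symmetric] powr_powr flip: of_real_power)
  have pa: "?p (a + b) = ?p a * ?p b" for a b
    by (simp add: powr_add[symmetric] algebra_simps flip: of_real_mult)
  have p0: "?p a \<noteq> 0" for a using q by simp
  assume "ct b = ?p e * ct b'"
  then have *: "us ! fst b * ?p (cont b) = us ! fst b' * ?p (cont b' + e)"
    unfolding ct_def pa by (simp add: mult_ac)
  show False
  proof (cases "cont b \<le> cont b' + e")
    case True
    define k where "k = nat (cont b' + e - cont b)"
    have "cont b' + e = cont b + int k" using True by (simp add: k_def)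
    then have "us ! fst b = us ! fst b' * complex_of_real q ^ (2 * k)"
      using * p0[of "cont b"] unfolding pw[symmetric] by (simp add: pa del: of_int_add)
    moreover have "k < n" using True assms(4) by (simp add: k_def)
    ultimately show False using sep[of "fst b'" "fst b" k] assms(1-3) by simp
  next
    case False
    define k where "k = nat (cont b - cont b' - e)"
    have "cont b = cont b' + e + int k" using False by (simp add: k_def)
    then have "us ! fst b' = us ! fst b * complex_of_real q ^ (2 * k)"
      using * p0[of "cont b' + e"] unfolding pw[symmetric] by (simp add: pa del: of_int_add)
    moreover have "k < n" using False assms(4) by (simp add: k_def)
    ultimately show False using sep[of "fst b" "fst b'" k] assms(1-3) by simp
  qed
qed

definition near :: "complex \<Rightarrow> complex \<Rightarrow> bool" where
  "near A B \<longleftrightarrow> A = of_real (q ^ 2) * B \<or> B = of_real (q ^ 2) * A"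

lemma near_ct:
  "near (ct b) (ct b') \<longleftrightarrow> ct b = of_real (q powr (2 * of_int 1)) * ct b' \<or> ct b = of_real (q powr (2 * of_int (- 1))) * ct b'"
proof -
  have 1: "q powr (2 * of_int 1) = q ^ 2" "q powr (2 * of_int (- 1)) = inverse (q ^ 2)"
    using q powr_minus[of q 2] by simp_all
  have "ct b' = of_real (q ^ 2) * ct b \<longleftrightarrow> ct b = of_real (inverse (q ^ 2)) * ct b'"
    using q by (auto simp: field_simps)
  then show ?thesis unfolding near_def 1 by blast
qed

definition STD :: "tableau set" where
  "STD = (\<Union>D\<in>diagrams r n. std n D)"

lemma STD_std:
  assumes "L \<in> STD"
  shows "L ` {1..n} \<in> diagrams r n" "L \<in> std n (L ` {1..n})"
proof -
  obtain D where D: "D \<in> diagrams r n" "L \<in> std n D" using assms by (auto simp: STD_def)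
  have "L ` {1..n} = D" using std_bij[OF D(2)] by (simp add: bij_betw_def)
  then show "L ` {1..n} \<in> diagrams r n" "L \<in> std n (L ` {1..n})" using D by simp_all
qed

lemma STD_I: "D \<in> diagrams r n \<Longrightarrow> L \<in> std n D \<Longrightarrow> L \<in> STD"
  by (auto simp: STD_def)

lemma std_image: "L \<in> std n D \<Longrightarrow> L ` {1..n} = D"
  using std_bij[of L n D] by (simp add: bij_betw_def)

lemma STD_finite: "finite STD"
  unfolding STD_def by (intro finite_UN_I finite_diagrams finite_std) (simp add: diagrams_def)

lemma STD_down: "L \<in> STD \<Longrightarrow> down_closed (L ` {1..n})"
  using STD_std(1) by (simp add: diagrams_def)

lemma STD_fst: "L \<in> STD \<Longrightarrow> k \<in> {1..n} \<Longrightarrow> fst (L k) < r"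
  using STD_std(1)[of L] unfolding diagrams_def by blast

lemma swap_image:
  assumes "i \<in> {2..n}"
  shows "swap_entries i L ` {1..n} = L ` {1..n}"
proof -
  have "transpose (i - 1) i ` {1..n} = {1..n}"
    using assms by (intro transpose_image_eq) auto
  then show ?thesis unfolding swap_entries_def image_comp[symmetric] by simp
qed

lemma swap_STD_iff:
  assumes "L \<in> STD" "i \<in> {2..n}"
  shows "swap_entries i L \<in> STD \<longleftrightarrow> \<not> box_le (L (i - 1)) (L i)"
  using swap_std_iff[OF STD_std(2)[OF assms(1)] assms(2)] STD_std[of "swap_entries i L"] swap_image[OF assms(2)]
    STD_I[OF STD_std(1)[OF assms(1)]] by metis

text \<open>Within one component \<open>std_cont_neq\<close> applies, between components the
  separation of the parameters. The gap of two covers the three entries that occur in a braid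
  relation.\<close>

lemma STD_ct_neq:
  assumes L: "L \<in> STD" and kl: "k \<in> {1..n}" "l \<in> {1..n}" "k < l" "l \<le> k + 2"
  shows "ct (L k) \<noteq> ct (L l)"
proof (cases "fst (L k) = fst (L l)")
  case True
  have "cont (L k) \<noteq> cont (L l)"
    by (rule std_cont_neq[OF STD_std(2)[OF L] STD_down[OF L] kl True])
  then show ?thesis using ct_shift_same[OF True, of 0] STD_fst[OF L kl(1)] q by simp
next
  case False
  have "\<bar>cont (L k)\<bar> + \<bar>cont (L l)\<bar> + 2 \<le> int n"
    using False kl by (intro abs_cont_sum_le[OF STD_std(1)[OF L]]) auto
  then show ?thesis using ct_shift_neq[OF False, of 0] STD_fst[OF L] kl q by simp
qed

text \<open>This ties the coefficients to the combinatorics: together with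
  \<open>swap_STD_iff\<close> it says that \<open>near\<close> holds at i - 1 and i exactly when
  exchanging these entries leaves the standard tableaux.\<close>

lemma STD_near_iff:
  assumes L: "L \<in> STD" and i: "i \<in> {2..n}"
  shows "near (ct (L (i - 1))) (ct (L i)) \<longleftrightarrow> box_le (L (i - 1)) (L i)"
proof -
  have i': "i - 1 \<in> {1..n}" "i \<in> {1..n}" using i by auto
  note f = STD_fst[OF L i'(1)] STD_fst[OF L i'(2)]
  show ?thesis
  proof (cases "fst (L (i - 1)) = fst (L i)")
    case True
    have "near (ct (L (i - 1))) (ct (L i)) \<longleftrightarrow> \<bar>cont (L (i - 1)) - cont (L i)\<bar> = 1"
      unfolding near_ct ct_shift_same[OF True f(1)] by linarith
    then show ?thesis
      using std_adjacent[OF STD_std(2)[OF L] STD_down[OF L] i]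
        std_swap_cont[OF STD_std(2)[OF L] STD_down[OF L] i _ True] swap_std_iff[OF STD_std(2)[OF L] i]
      by force
  next
    case False
    have "\<bar>cont (L (i - 1))\<bar> + \<bar>cont (L i)\<bar> + 2 \<le> int n"
      using False i' by (intro abs_cont_sum_le[OF STD_std(1)[OF L]]) auto
    then have "\<not> near (ct (L (i - 1))) (ct (L i))"
      unfolding near_ct using ct_shift_neq[OF False f, of 1] ct_shift_neq[OF False f, of "- 1"] by auto
    moreover have "\<not> box_le (L (i - 1)) (L i)" using False by (auto simp: box_le_def split: prod.splits)
    ultimately show ?thesis by simp
  qed
qed

text \<open>At the first entry that lies in different boxes, both boxes extend the same smaller
  diagram. Within one component they are therefore incomparable, and their contents differ by at
  least two.\<close>

lemma STD_separated:
  assumes L: "L \<in> STD" and M: "M \<in> STD" and ne: "L \<noteq> M"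
  shows "\<exists>k\<in>{1..n}. ct (L k) \<noteq> ct (M k)"
proof -
  have ex: "\<exists>k. k \<in> {1..n} \<and> L k \<noteq> M k"
  proof (rule ccontr)
    assume "\<not> ?thesis"
    then have "L k = M k" for k
      using std_extensional[OF STD_std(2)[OF L]] std_extensional[OF STD_std(2)[OF M]]
      by (cases "k \<in> {1..n}") (auto simp: extensional_def)
    then show False using ne by auto
  qed
  define k where "k = (LEAST k. k \<in> {1..n} \<and> L k \<noteq> M k)"
  have k: "k \<in> {1..n}" "L k \<noteq> M k" using LeastI_ex[OF ex] by (simp_all add: k_def)
  have below: "L m = M m" if "m \<in> {1..k - 1}" for m
    using not_less_Least[of m "\<lambda>k. k \<in> {1..n} \<and> L k \<noteq> M k"] that k(1) by (auto simp: k_def)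
  let ?P = "L ` {1..k - 1}"
  have PM: "?P = M ` {1..k - 1}" using below by (intro image_cong) auto
  have ins: "insert (N k) (N ` {1..k - 1}) = N ` {1..k}" for N :: tableau
  proof -
    have "{1..k} = insert k {1..k - 1}" using k(1) by auto
    then show ?thesis by auto
  qed
  have notin: "N k \<notin> N ` {1..k - 1}" if "N \<in> STD" for N
  proof
    assume "N k \<in> N ` {1..k - 1}"
    then obtain m where m: "m \<in> {1..k - 1}" "N k = N m" by blast
    have "k \<le> m" using m k(1) by (intro std_le[OF STD_std(2)[OF that]]) auto
    moreover have "m \<le> k - 1" "1 \<le> k" using m(1) k(1) by auto
    ultimately show False by linarith
  qed
  have down: "down_closed (N ` {1..k})" if "N \<in> STD" for N
    using std_prefix_down_closed[OF STD_std(2)[OF that] STD_down[OF that]] k(1) by simp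
  have inc: "\<not> box_le (N k) (N' k)" if "N \<in> STD" "N' \<in> STD" "N ` {1..k - 1} = N' ` {1..k - 1}" "N k \<noteq> N' k" for N N'
  proof
    assume "box_le (N k) (N' k)"
    moreover have "N' k \<in> N' ` {1..k}" using k(1) by simp
    ultimately have "N k \<in> N' ` {1..k}" using down_closedD[OF down[OF that(2)]] by blast
    then have "N k \<in> N ` {1..k - 1}" using ins[of N'] that(3,4) by blast
    then show False using notin[OF that(1)] by blast
  qed
  have "ct (L k) \<noteq> ct (M k)"
  proof (cases "fst (L k) = fst (M k)")
    case True
    have "\<bar>cont (L k) - cont (M k)\<bar> \<ge> 2"
      using inc[OF L M PM k(2)] inc[OF M L PM[symmetric] k(2)[symmetric]] True
      by (intro incomparable_cont)
    then show ?thesis using ct_shift_same[OF True, of 0] STD_fst[OF L k(1)] q by auto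
  next
    case False
    \<comment> \<open>The two boxes need not lie in a common diagram with \<open>n\<close> boxes, but both components
      have enough room in the common part.\<close>
    let ?C = "\<lambda>b. {b' \<in> ?P. fst b' = fst b}"
    have fP: "finite ?P" by simp
    have c: "\<bar>cont (N k)\<bar> \<le> int (card (?C (N k)))" if "N \<in> STD" "?P = N ` {1..k - 1}" for N
    proof -
      have "\<bar>cont (N k)\<bar> + 1 \<le> int (card {b' \<in> N ` {1..k}. fst b' = fst (N k)})"
        using k(1) by (intro card_ge_abs_cont[OF _ down[OF that(1)]]) auto
      also have "{b' \<in> N ` {1..k}. fst b' = fst (N k)} = insert (N k) (?C (N k))"
        using ins[of N] that(2) by auto
      finally show ?thesis using notin[OF that(1)] that(2) by simp
    qed
    have "card (?C (L k)) + card (?C (M k)) = card (?C (L k) \<union> ?C (M k))"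
      using fP False by (intro card_Un_disjoint[symmetric]) auto
    also have "\<dots> \<le> card ?P" using fP by (intro card_mono) auto
    also have "\<dots> \<le> k - 1" using card_image_le[of "{1..k - 1}" L] by simp
    finally have "\<bar>cont (L k)\<bar> + \<bar>cont (M k)\<bar> < int n"
      using c[OF L refl] c[OF M PM] k(1) by auto
    then show ?thesis using ct_shift_neq[OF False, of 0] STD_fst[OF L k(1)] STD_fst[OF M k(1)] q by simp
  qed
  then show ?thesis using k(1) by blast
qed

end

section \<open>The seminormal representation\<close>

context separated_parameters
begin

abbreviation Q :: complex where "Q \<equiv> complex_of_real q"
abbreviation h :: complex where "h \<equiv> Q - inverse Q"

definition sdiag :: "diagram_box \<Rightarrow> diagram_box \<Rightarrow> complex" where
  "sdiag b b' = h / (1 - ct b / ct b')"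

text \<open>Operators act on coordinates, so the coefficient of \<open>f\<close> at the exchanged
  tableau is computed from that tableau; hence the reversed arguments in \<open>sdiag b' b\<close>.
  For standard tableaux \<open>near\<close> means that the exchanged filling is not standard. The
  formula vanishes by itself in only one of the two cases of \<open>near\<close>; setting it to zero
  in both cuts off the nonstandard fillings.\<close>

definition soff :: "diagram_box \<Rightarrow> diagram_box \<Rightarrow> complex" where
  "soff b b' = (if near (ct b) (ct b') then 0 else inverse Q + sdiag b' b)"

lemma Q_facts: "Q \<noteq> 0" "1 - Q ^ 2 \<noteq> 0" "Q ^ 2 - 1 \<noteq> 0"
proof -
  have "q ^ 2 \<noteq> 1" using q by (simp add: power2_eq_1_iff)
  then have "complex_of_real (q ^ 2) \<noteq> 1" by (simp only: of_real_eq_1_iff) simp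
  then show "1 - Q ^ 2 \<noteq> 0" "Q ^ 2 - 1 \<noteq> 0" by auto
  show "Q \<noteq> 0" using q by simp
qed

lemma sdiag_alt: "ct b' \<noteq> 0 \<Longrightarrow> sdiag b b' = h * ct b' / (ct b' - ct b)"
  by (simp add: sdiag_def field_simps)

lemma near_sym: "near A B \<longleftrightarrow> near B A"
  by (auto simp: near_def)

context
  fixes a b c :: diagram_box
  assumes nz: "ct a \<noteq> 0" "ct b \<noteq> 0" "ct c \<noteq> 0"
begin

lemma sdiag_sum:
  assumes "ct a \<noteq> ct b"
  shows "sdiag a b + sdiag b a = h"
proof -
  have "ct b / (ct b - ct a) + ct a / (ct a - ct b) = 1"
    using assms by (simp add: divide_simps) (simp add: algebra_simps)
  then have "h * (ct b / (ct b - ct a) + ct a / (ct a - ct b)) = h" by simp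
  then show ?thesis using nz by (simp add: sdiag_alt distrib_left)
qed

lemma sdiag_weighted:
  assumes "ct a \<noteq> ct b"
  shows "sdiag a b * ct a + sdiag b a * ct b = 0"
proof -
  have "ct b / (ct b - ct a) * ct a + ct a / (ct a - ct b) * ct b = 0"
    using assms by (simp add: divide_simps) (simp add: algebra_simps)
  then have "h * (ct b / (ct b - ct a) * ct a + ct a / (ct a - ct b) * ct b) = 0" by simp
  then show ?thesis using nz by (simp add: sdiag_alt distrib_left mult.assoc)
qed

text \<open>Up to powers of h this is the partial fraction identity x y = z (x + y - 1) for x =
  B/(B-A), y = C/(C-B), z = C/(C-A), where A, B, C are the values of \<open>ct\<close>. It is behind
  all three conditions of \<open>exch_braid\<close>.\<close>

lemma sdiag_triple:
  assumes "ct a \<noteq> ct b" "ct b \<noteq> ct c" "ct a \<noteq> ct c"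
  shows "sdiag a b * sdiag b c = sdiag a c * (sdiag a b + sdiag b c - h)"
proof -
  define x y z where "x = ct b / (ct b - ct a)" and "y = ct c / (ct c - ct b)" and "z = ct c / (ct c - ct a)"
  have "x * y = z * (x + y - 1)"
    unfolding x_def y_def z_def using assms by (simp add: divide_simps) (simp add: algebra_simps)
  then have "k * k * (x * y) = k * k * (z * (x + y - 1))" for k by simp
  then have "k * x * (k * y) = k * z * (k * x + k * y - k)" for k
    by (simp add: algebra_simps)
  moreover have "sdiag a b = h * x" "sdiag b c = h * y" "sdiag a c = h * z"
    using nz by (simp_all add: sdiag_alt x_def y_def z_def)
  ultimately show ?thesis by metis
qed

text \<open>The right side is -(X - Q)(X + 1/Q) at X = \<open>sdiag a b\<close>. When
  \<open>near\<close> holds, \<open>sdiag a b\<close> is one of the two eigenvalues and both sides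
  vanish; otherwise \<open>sdiag_sum\<close> rewrites the left side.\<close>

lemma soff_product:
  assumes "ct a \<noteq> ct b"
  shows "soff a b * soff b a = h * sdiag a b + 1 - sdiag a b ^ 2"
proof (cases "near (ct a) (ct b)")
  case True
  then consider "ct a = Q ^ 2 * ct b" | "ct b = Q ^ 2 * ct a" by (auto simp: near_def)
  then have "sdiag a b = - inverse Q \<or> sdiag a b = Q"
  proof cases
    case 1
    then have "sdiag a b = (Q - inverse Q) / (1 - Q ^ 2)" using nz by (simp add: sdiag_def)
    also have "\<dots> = - inverse Q"
      using Q_facts by (simp add: field_simps power2_eq_square)
    finally show ?thesis by simp
  next
    case 2
    then have "sdiag a b = (Q - inverse Q) / (1 - inverse (Q ^ 2))" using nz by (simp add: sdiag_def inverse_eq_divide)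
    also have "\<dots> = Q"
      using Q_facts by (simp add: field_simps power2_eq_square)
    finally show ?thesis by simp
  qed
  then have "h * sdiag a b + 1 - sdiag a b ^ 2 = 0"
  proof
    assume s: "sdiag a b = - inverse Q"
    show ?thesis unfolding s using Q_facts by (simp add: field_simps power2_eq_square)
  next
    assume s: "sdiag a b = Q"
    show ?thesis unfolding s using Q_facts by (simp add: field_simps power2_eq_square)
  qed
  then show ?thesis using True by (simp add: soff_def)
next
  case False
  define x where "x = sdiag a b"
  have "sdiag b a = h - x" using sdiag_sum[OF assms] by (simp add: x_def algebra_simps)
  then have "soff a b * soff b a = (inverse Q + (h - x)) * (inverse Q + x)"
    using False near_sym by (simp add: soff_def x_def)
  also have "\<dots> = h * x + 1 - x ^ 2"
    using Q_facts by (simp add: field_simps power2_eq_square)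
  finally show ?thesis by (simp add: x_def)
qed

end

definition full_op :: "nat \<Rightarrow> (tableau \<Rightarrow> complex) \<Rightarrow> tableau \<Rightarrow> complex" where
  "full_op i = (if i = 1 then (\<lambda>f L. ct (L 1) * f L) else exch sdiag soff i)"

definition sop :: "nat \<Rightarrow> (tableau \<Rightarrow> complex) \<Rightarrow> tableau \<Rightarrow> complex" where
  "sop i f L = (if L \<in> STD then full_op i f L else 0)"

definition W :: "(tableau \<Rightarrow> complex) set" where
  "W = {f. \<forall>L. L \<notin> STD \<longrightarrow> f L = 0}"

lemma linear_op_full: "linear_op (full_op i)"
  by (cases "i = 1") (simp_all add: full_op_def linear_op_exch, simp add: linear_op_def algebra_simps)

lemma linear_op_sop: "linear_op (sop i)"
  using linear_op_full[of i] by (auto simp: linear_op_def sop_def fun_eq_iff)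

lemma STD_ct_nz: "L \<in> STD \<Longrightarrow> k \<in> {1..n} \<Longrightarrow> ct (L k) \<noteq> 0"
  by (intro ct_nz STD_fst)

text \<open>The coefficient leading from a standard to a nonstandard tableau vanishes, so the relations may
  be checked as if all fillings were standard.\<close>

lemma sop_full_op:
  assumes L: "L \<in> STD" and i: "i \<in> {1..n}" and fg: "\<And>M. M \<in> STD \<Longrightarrow> f M = g M"
  shows "sop i f L = full_op i g L"
proof (cases "i = 1")
  case True
  then show ?thesis using L fg by (simp add: sop_def full_op_def)
next
  case False
  then have i2: "i \<in> {2..n}" using i by auto
  have "soff (L (i - 1)) (L i) * f (swap_entries i L) = soff (L (i - 1)) (L i) * g (swap_entries i L)"
  proof (cases "swap_entries i L \<in> STD")
    case True
    then show ?thesis using fg by simp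
  next
    case F: False
    then have "near (ct (L (i - 1))) (ct (L i))"
      using swap_STD_iff[OF L i2] STD_near_iff[OF L i2] by blast
    then show ?thesis by (simp add: soff_def)
  qed
  then show ?thesis using False L fg[OF L] by (simp add: sop_def full_op_def exch_def swap_entries_def)
qed

lemma sop_closed: "sop i f \<in> W"
  by (simp add: W_def sop_def)

lemma W_subspace: "fun_subspace W"
  by (auto simp: fun_subspace_def W_def)

lemma W_eqI: "f \<in> W \<Longrightarrow> g \<in> W \<Longrightarrow> (\<And>L. L \<in> STD \<Longrightarrow> f L = g L) \<Longrightarrow> f = g"
proof (rule ext)
  fix L
  assume "f \<in> W" "g \<in> W" and "\<And>L. L \<in> STD \<Longrightarrow> f L = g L"
  then show "f L = g L" by (cases "L \<in> STD") (simp_all add: W_def)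
qed

lemma shift_prod_sop:
  assumes "f \<in> W"
  shows "shift_prod (sop 1) vs f L = prod_list (map (\<lambda>z. ct (L 1) - z) vs) * f L"
proof (induction vs)
  case (Cons z vs)
  have "f L = 0" if "L \<notin> STD" using assms that by (simp add: W_def)
  then show ?case using Cons by (auto simp: shift_prod_def sop_def full_op_def algebra_simps)
qed (simp add: shift_prod_def)

lemma STD_first: 
  assumes "L \<in> STD"
  shows "ct (L 1) \<in> set us"
proof -
  obtain i x y where e: "L 1 = (i, x, y)" by (cases "L 1")
  have "down_closed (L ` {1..1})"
    using std_prefix_down_closed[OF STD_std(2)[OF assms] STD_down[OF assms] n] .
  then have "(i, 0, 0) \<in> {L 1}"
    using down_closedD[of "{L 1}" "L 1" "(i, 0, 0)"] e by (simp add: box_le_def)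
  then have "L 1 = (i, 0, 0)" by simp
  then have "ct (L 1) = us ! i" using q by (simp add: ct_def cont_def)
  moreover have "i < r" using STD_fst[OF assms, of 1] n e by simp
  ultimately show ?thesis using len by simp
qed

theorem hecke_rep_sop: "hecke_rep n us Q sop W"
proof
  show "fun_subspace W" by (rule W_subspace)
  fix f :: "tableau \<Rightarrow> complex" assume f: "f \<in> W"
  note ee = sop_full_op
  have one: "1 \<in> {1..n}" using n by simp
  have full1: "full_op 1 g L = ct (L 1) * g L" for g L by (simp add: full_op_def)
  have full2: "full_op i = exch sdiag soff i" if "i \<ge> 2" for i using that by (simp add: full_op_def)
  show "sop i (sop j f) = sop j (sop i f)"
    if ij: "i \<in> {1..n}" "j \<in> {1..n}" "\<bar>int i - int j\<bar> > 1" for i j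
  proof (rule W_eqI[OF sop_closed sop_closed])
    fix L assume L: "L \<in> STD"
    have "sop i (sop j f) L = full_op i (full_op j f) L" by (intro ee L ij) simp_all
    also have "\<dots> = full_op j (full_op i f) L"
    proof -
      have sw: "(L \<circ> transpose (k - 1) k) 1 = L 1" if "k \<ge> 3" for k
        using that by (auto simp: transpose_def)
      consider "i = 1" "j \<ge> 3" | "j = 1" "i \<ge> 3" | "i \<ge> 2" "j \<ge> 2"
        using ij by fastforce
      then show ?thesis
      proof cases
        case 1
        then show ?thesis using sw[of j] by (simp add: full_op_def exch_def algebra_simps)
      next
        case 2
        then show ?thesis using sw[of i] by (simp add: full_op_def exch_def algebra_simps)
      next
        case 3
        then show ?thesis using ij exch_commute[of i j] by (simp add: full2)
      qed
    qed
    also have "\<dots> = sop j (sop i f) L" by (intro ee[symmetric] ee L ij) simp_all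
    finally show "sop i (sop j f) L = sop j (sop i f) L" .
  qed
  show "sop i (sop (i + 1) (sop i f)) = sop (i + 1) (sop i (sop (i + 1) f))"
    if i: "2 \<le> i" "i + 1 \<le> n" for i
  proof (rule W_eqI[OF sop_closed sop_closed])
    fix L assume L: "L \<in> STD"
    have i': "i \<in> {1..n}" "i + 1 \<in> {1..n}" "i - 1 \<in> {1..n}" using i by auto
    have "sop i (sop (i + 1) (sop i f)) L = full_op i (full_op (i + 1) (full_op i f)) L"
      by (intro ee L i') simp_all
    also have "\<dots> = full_op (i + 1) (full_op i (full_op (i + 1) f)) L"
    proof -
      define a b c where "a = L (i - 1)" and "b = L i" and "c = L (Suc i)"
      have nz: "ct a \<noteq> 0" "ct b \<noteq> 0" "ct c \<noteq> 0"
        using STD_ct_nz[OF L] i' by (simp_all add: a_def b_def c_def)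
      have ne: "ct a \<noteq> ct b" "ct b \<noteq> ct c" "ct a \<noteq> ct c"
        using STD_ct_neq[OF L, of "i - 1" i] STD_ct_neq[OF L, of i "Suc i"] STD_ct_neq[OF L, of "i - 1" "Suc i"] i i'
        by (simp_all add: a_def b_def c_def)
      define x y z where "x = sdiag a b" and "y = sdiag b c" and "z = sdiag a c"
      have xyz: "x * y = z * (x + y - h)" using sdiag_triple[OF nz ne] by (simp add: x_def y_def z_def)
      have ba: "sdiag b a = h - x" and cb: "sdiag c b = h - y"
        using sdiag_sum[OF nz(1,2,3) ne(1)] sdiag_sum[OF nz(2,3,1) ne(2)]
        by (simp_all add: x_def y_def algebra_simps)
      have p: "soff a b * soff b a = h * x + 1 - x ^ 2" "soff b c * soff c b = h * y + 1 - y ^ 2"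
        using soff_product[OF nz(1,2,3) ne(1)] soff_product[OF nz(2,3,1) ne(2)] by (simp_all add: x_def y_def)
      have c1: "x * y + z * (h - x) - y * z = 0" and c2: "x * z - y * x - z * (h - y) = 0"
        using xyz by (simp_all add: algebra_simps)
      \<comment> \<open>The condition at the identity permutation is the triple identity multiplied
        by x - y.\<close>
      have "x * y * (x - y) = z * (x + y - h) * (x - y)" by (simp only: xyz)
      then have c3: "x ^ 2 * y + (h * x + 1 - x ^ 2) * z = y ^ 2 * x + (h * y + 1 - y ^ 2) * z"
        by (simp add: algebra_simps power2_eq_square)
      have "exch sdiag soff i (exch sdiag soff (Suc i) (exch sdiag soff i f)) L =
          exch sdiag soff (Suc i) (exch sdiag soff i (exch sdiag soff (Suc i) f)) L"
      proof (rule exch_braid[of i a L b c])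
        show "soff a b * (sdiag a b * sdiag b c + sdiag a c * sdiag b a - sdiag b c * sdiag a c) = 0"
          using c1 by (simp add: ba flip: x_def y_def z_def)
        show "soff b c * (sdiag a b * sdiag a c - sdiag b c * sdiag a b - sdiag a c * sdiag c b) = 0"
          using c2 by (simp add: cb flip: x_def y_def z_def)
        show "sdiag a b ^ 2 * sdiag b c + soff a b * soff b a * sdiag a c =
            sdiag b c ^ 2 * sdiag a b + soff b c * soff c b * sdiag a c"
          using c3 by (simp add: p flip: x_def y_def z_def)
      qed (use i in \<open>simp_all add: a_def b_def c_def\<close>)
      then show ?thesis using i by (simp add: full2)
    qed
    also have "\<dots> = sop (i + 1) (sop i (sop (i + 1) f)) L"
      by (intro ee[symmetric] ee L i') simp_all
    finally show "sop i (sop (i + 1) (sop i f)) L = sop (i + 1) (sop i (sop (i + 1) f)) L" .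
  qed
  show "sop 1 (sop 2 (sop 1 (sop 2 f))) = sop 2 (sop 1 (sop 2 (sop 1 f)))" if n2: "2 \<le> n"
  proof (rule W_eqI[OF sop_closed sop_closed])
    fix L assume L: "L \<in> STD"
    have two: "2 \<in> {1..n}" using n2 by simp
    define a b where "a = L 1" and "b = L 2"
    have nz: "ct a \<noteq> 0" "ct b \<noteq> 0" using STD_ct_nz[OF L] one two by (simp_all add: a_def b_def)
    have ne: "ct a \<noteq> ct b" using STD_ct_neq[OF L, of 1 2] n2 by (simp add: a_def b_def)
    note w = sdiag_weighted[OF nz nz(1) ne]
    let ?s = "L \<circ> transpose (Suc 0) 2"
    have s: "?s (Suc 0) = b" "?s 2 = a" by (simp_all add: a_def b_def)
    have e2: "full_op 2 g L = sdiag a b * g L + soff a b * g ?s"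
      "full_op 2 g ?s = sdiag b a * g ?s + soff b a * g L" for g
      by (simp_all add: full_op_def exch_def s a_def[simplified, symmetric] b_def[symmetric])
    have e1: "full_op 1 g L = ct a * g L" "full_op 1 g ?s = ct b * g ?s" for g
      by (simp_all add: full1[simplified] a_def b_def)
    have "sop 1 (sop 2 (sop 1 (sop 2 f))) L = full_op 1 (full_op 2 (full_op 1 (full_op 2 f))) L"
      by (intro ee L one two) simp_all
    also have "\<dots> = ct a * ((sdiag a b ^ 2 * ct a + soff a b * soff b a * ct b) * f L
        + soff a b * (sdiag a b * ct a + sdiag b a * ct b) * f ?s)"
      unfolding e1 e2 by (simp add: algebra_simps power2_eq_square)
    \<comment> \<open>The mixed coefficient vanishes by \<open>sdiag_weighted\<close>, so the scalar
      in front of it may be changed from \<open>ct a\<close> to \<open>ct b\<close>.\<close>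
    also have "\<dots> = ct a * (sdiag a b ^ 2 * ct a + soff a b * soff b a * ct b) * f L
        + soff a b * (sdiag a b * ct a + sdiag b a * ct b) * ct b * f ?s"
      unfolding w by (simp add: mult.assoc)
    also have "\<dots> = full_op 2 (full_op 1 (full_op 2 (full_op 1 f))) L"
      unfolding e1 e2 by (simp add: algebra_simps power2_eq_square)
    also have "\<dots> = sop 2 (sop 1 (sop 2 (sop 1 f))) L"
      by (intro ee[symmetric] ee L one two) simp_all
    finally show "sop 1 (sop 2 (sop 1 (sop 2 f))) L = sop 2 (sop 1 (sop 2 (sop 1 f))) L" .
  qed
  show "sop i (sop i f) = (\<lambda>x. h * sop i f x + f x)" if i: "2 \<le> i" "i \<le> n" for i
  proof (rule W_eqI[OF sop_closed])
    show "(\<lambda>x. h * sop i f x + f x) \<in> W" using f by (simp add: W_def sop_def)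
    fix L assume L: "L \<in> STD"
    have i': "i \<in> {1..n}" "i - 1 \<in> {1..n}" using i by auto
    define a b where "a = L (i - 1)" and "b = L i"
    have nz: "ct a \<noteq> 0" "ct b \<noteq> 0" using STD_ct_nz[OF L] i' by (simp_all add: a_def b_def)
    have ne: "ct a \<noteq> ct b" using STD_ct_neq[OF L, of "i - 1" i] i i' by (simp add: a_def b_def)
    have "sop i (sop i f) L = full_op i (full_op i f) L" by (intro ee L i') simp_all
    also have "\<dots> = h * full_op i f L + f L"
      unfolding full2[OF i(1)]
      by (rule exch_quadratic, unfold a_def[symmetric] b_def[symmetric])
         (use i sdiag_sum[OF nz nz(1) ne] soff_product[OF nz nz(1) ne] in simp_all)
    also have "full_op i f L = sop i f L" by (intro ee[symmetric] ee L i') simp_all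
    finally show "sop i (sop i f) L = h * sop i f L + f L" .
  qed
  have "shift_prod (sop 1) us f L = 0" for L
  proof (cases "L \<in> STD")
    case True
    then have "prod_list (map (\<lambda>z. ct (L 1) - z) us) = 0"
      using STD_first by (auto simp: prod_list_zero_iff)
    then show ?thesis unfolding shift_prod_sop[OF f] by simp
  next
    case False
    then show ?thesis using f unfolding shift_prod_sop[OF f] by (simp add: W_def)
  qed
  then show "foldr (\<lambda>z g x. sop 1 g x - z * g x) us f = (\<lambda>x. 0)"
    by (simp add: shift_prod_def fun_eq_iff)
qed (use n q linear_op_sop sop_closed in simp_all)

end

section \<open>Dual functionals, matrix units and faithfulness\<close>

section \<open>Functionals on the Hecke algebra\<close>

lemma pairing_ominus:
  assumes "a \<in> carrier (free_algebra n)" "b \<in> carrier (free_algebra n)"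
  shows "pairing \<phi> (a \<ominus>\<^bsub>free_algebra n\<^esub> b) = pairing \<phi> a - pairing \<phi> b"
  by (simp add: free_minus[OF assms(2)] pairing_minus[OF assms])

lemma pairing_oplus:
  assumes "a \<in> carrier (free_algebra n)" "b \<in> carrier (free_algebra n)"
  shows "pairing \<phi> (a \<oplus>\<^bsub>free_algebra n\<^esub> b) = pairing \<phi> a + pairing \<phi> b"
  by (simp add: free_add pairing_add[OF assms])

text \<open>The relation is a monic polynomial in T_1; its lower coefficients stay unnamed, since
  they only serve to reduce the power r of T_1.\<close>

lemma pairing_cyclotomic:
  assumes n: "n \<ge> 1"
  shows "cyclotomic_poly n us \<in> carrier (free_algebra n) \<and>
    (\<exists>p. \<forall>\<psi>. pairing \<psi> (cyclotomic_poly n us) =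
      \<psi> (replicate (length us) 1) + (\<Sum>j<length us. p j * \<psi> (replicate j 1)))"
proof (induction us)
  case Nil
  interpret A: ring "free_algebra n" by (rule ring_free_algebra)
  show ?case by (simp add: cyclotomic_poly_def) (simp add: free_one_eq_mon)
next
  case (Cons z us)
  interpret A: ring "free_algebra n" by (rule ring_free_algebra)
  let ?C = "cyclotomic_poly n us" and ?r = "length us"
  obtain p where C: "?C \<in> carrier (free_algebra n)"
    and p: "\<And>\<psi>. pairing \<psi> ?C = \<psi> (replicate ?r 1) + (\<Sum>j<?r. p j * \<psi> (replicate j 1))"
    using Cons by blast
  have g: "gen 1 \<in> carrier (free_algebra n)" using n by (intro gen_carrier) simp
  have gz: "gen 1 \<ominus>\<^bsub>free_algebra n\<^esub> scal z \<in> carrier (free_algebra n)"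
    using g scal_carrier by (intro A.minus_closed)
  have e: "cyclotomic_poly n (z # us) = (gen 1 \<ominus>\<^bsub>free_algebra n\<^esub> scal z) \<otimes>\<^bsub>free_algebra n\<^esub> ?C"
    by (simp add: cyclotomic_poly_def)
  define p' where "p' j = (if j = 0 then 0 else p (j - 1)) - z * (if j = ?r then 1 else p j)" for j
  have "pairing \<psi> (cyclotomic_poly n (z # us)) =
      \<psi> (replicate (Suc ?r) 1) + (\<Sum>j<Suc ?r. p' j * \<psi> (replicate j 1))" for \<psi>
  proof -
    have "pairing \<psi> (cyclotomic_poly n (z # us)) = pairing (\<lambda>v. \<psi> (1 # v)) ?C - z * pairing \<psi> ?C"
      unfolding e pairing_mult[OF gz C] pairing_ominus[OF g scal_carrier]
      by (simp add: gen_eq_mon)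
    also have "\<dots> = \<psi> (replicate (Suc ?r) 1) + (\<Sum>j<?r. p j * \<psi> (replicate (Suc j) 1))
        - z * (\<psi> (replicate ?r 1) + (\<Sum>j<?r. p j * \<psi> (replicate j 1)))"
      unfolding p by simp
    also have "(\<Sum>j<?r. p j * \<psi> (replicate (Suc j) 1)) =
        (\<Sum>j<Suc ?r. (if j = 0 then 0 else p (j - 1)) * \<psi> (replicate j 1))"
      unfolding sum.lessThan_Suc_shift by simp
    also have "\<psi> (replicate ?r 1) + (\<Sum>j<?r. p j * \<psi> (replicate j 1)) =
        (\<Sum>j<Suc ?r. (if j = ?r then 1 else p j) * \<psi> (replicate j 1))"
      by simp
    finally show ?thesis
      unfolding p'_def by (simp only: left_diff_distrib sum_subtractf sum_distrib_left mult.assoc) simp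
  qed
  moreover have "cyclotomic_poly n (z # us) \<in> carrier (free_algebra n)"
    unfolding e using gz C by simp
  ultimately show ?case by auto
qed

text \<open>A relation multiplied by words on both sides stays in the ideal, so a functional that
  kills the ideal satisfies the relation inside every word.\<close>

lemma annihilator_word_fun:
  assumes n: "n \<ge> 1" and q: "q \<noteq> 0" and ann: "\<And>a. a \<in> hecke_ideal n us q \<Longrightarrow> pairing \<phi> a = 0"
  shows "\<exists>p. hecke_word_fun n (length us) (q - inverse q) p \<phi>"
proof -
  let ?A = "free_algebra n"
  interpret A: ring ?A by (rule ring_free_algebra)
  interpret I: ideal "hecke_ideal n us q" ?A by (rule ideal_hecke_ideal[OF n])
  have rel: "pairing (\<lambda>u. \<phi> (x @ u @ y)) \<rho> = 0"
    if \<rho>: "\<rho> \<in> hecke_relations n us q" and xy: "set x \<subseteq> {1..n}" "set y \<subseteq> {1..n}" for \<rho> x y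
  proof -
    have \<rho>A: "\<rho> \<in> carrier ?A" using hecke_relations_carrier[OF n] \<rho> by blast
    have "\<rho> \<in> hecke_ideal n us q"
      unfolding hecke_ideal_def using A.genideal_self[OF hecke_relations_carrier[OF n]] \<rho> by blast
    then have "mon x \<otimes>\<^bsub>?A\<^esub> (\<rho> \<otimes>\<^bsub>?A\<^esub> mon y) \<in> hecke_ideal n us q"
      using xy by (intro I.I_l_closed I.I_r_closed mon_carrier)
    then have "pairing \<phi> (mon x \<otimes>\<^bsub>?A\<^esub> (\<rho> \<otimes>\<^bsub>?A\<^esub> mon y)) = 0" by (rule ann)
    then show ?thesis
      using xy \<rho>A by (simp add: pairing_mult[of _ n] mon_carrier)
  qed
  have gm: "gen i \<otimes>\<^bsub>?A\<^esub> mon w = mon (i # w)" "mon w \<otimes>\<^bsub>?A\<^esub> gen i = mon (w @ [i])"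
    if "i \<in> {1..n}" "set w \<subseteq> {1..n}" for i w
    using that by (simp_all add: gen_eq_mon mon_mult)
  have g2: "gen i \<otimes>\<^bsub>?A\<^esub> gen j = mon [i, j]" if "i \<in> {1..n}" "j \<in> {1..n}" for i j
    using that by (simp add: gen_eq_mon mon_mult)
  obtain p where p: "\<And>\<psi>. pairing \<psi> (cyclotomic_poly n us) =
      \<psi> (replicate (length us) 1) + (\<Sum>j<length us. p j * \<psi> (replicate j 1))"
    using pairing_cyclotomic[OF n, of us] by blast
  have "hecke_word_fun n (length us) (q - inverse q) (\<lambda>j. - p j) \<phi>"
  proof
    fix x y :: "nat list" assume xy: "set x \<subseteq> {1..n}" "set y \<subseteq> {1..n}"
    show "\<phi> (x @ i # j # y) = \<phi> (x @ j # i # y)"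
      if ij: "i \<in> {1..n}" "j \<in> {1..n}" "\<bar>int i - int j\<bar> > 1" for i j
    proof -
      have "gen i \<otimes>\<^bsub>?A\<^esub> gen j \<ominus>\<^bsub>?A\<^esub> gen j \<otimes>\<^bsub>?A\<^esub> gen i \<in> hecke_relations n us q"
        unfolding hecke_relations_def Let_def using ij by blast
      from rel[OF this xy] show ?thesis
        using ij by (simp add: g2 pairing_ominus[of _ n] mon_carrier)
    qed
    show "\<phi> (x @ i # Suc i # i # y) = \<phi> (x @ Suc i # i # Suc i # y)" if i: "2 \<le> i" "Suc i \<le> n" for i
    proof -
      have "gen i \<otimes>\<^bsub>?A\<^esub> gen (i + 1) \<otimes>\<^bsub>?A\<^esub> gen i \<ominus>\<^bsub>?A\<^esub> gen (i + 1) \<otimes>\<^bsub>?A\<^esub> gen i \<otimes>\<^bsub>?A\<^esub> gen (i + 1) \<in> hecke_relations n us q"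
        unfolding hecke_relations_def Let_def using i by auto
      from rel[OF this xy] show ?thesis
        using i by (simp add: g2 gm pairing_ominus[of _ n] mon_carrier)
    qed
    show "\<phi> (x @ 1 # 2 # 1 # 2 # y) = \<phi> (x @ 2 # 1 # 2 # 1 # y)" if n2: "2 \<le> n"
    proof -
      have "gen 1 \<otimes>\<^bsub>?A\<^esub> gen 2 \<otimes>\<^bsub>?A\<^esub> gen 1 \<otimes>\<^bsub>?A\<^esub> gen 2 \<ominus>\<^bsub>?A\<^esub> gen 2 \<otimes>\<^bsub>?A\<^esub> gen 1 \<otimes>\<^bsub>?A\<^esub> gen 2 \<otimes>\<^bsub>?A\<^esub> gen 1
          \<in> hecke_relations n us q"
        unfolding hecke_relations_def Let_def using n2 by simp
      from rel[OF this xy] show ?thesis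
        using n2 by (simp add: g2 gm pairing_ominus[of _ n] mon_carrier)
    qed
    show "\<phi> (x @ i # i # y) = (q - inverse q) * \<phi> (x @ i # y) + \<phi> (x @ y)" if i: "2 \<le> i" "i \<le> n" for i
    proof -
      have "(gen i \<ominus>\<^bsub>?A\<^esub> scal q) \<otimes>\<^bsub>?A\<^esub> (gen i \<oplus>\<^bsub>?A\<^esub> scal (inverse q)) \<in> hecke_relations n us q"
        unfolding hecke_relations_def Let_def using i by blast
      from rel[OF this xy] show ?thesis
        using i q by (simp add: pairing_mult[of _ n] pairing_ominus[of _ n] pairing_oplus[of _ n]
            gen_carrier scal_carrier gen_eq_mon mon_carrier algebra_simps)
    qed
    have "cyclotomic_poly n us \<in> hecke_relations n us q"
      unfolding hecke_relations_def Let_def by blast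
    from rel[OF this xy] show "\<phi> (x @ replicate (length us) 1 @ y) =
        (\<Sum>j<length us. - p j * \<phi> (x @ replicate j 1 @ y))"
      unfolding p by (simp add: sum_negf eq_neg_iff_add_eq_0)
  qed
  then show ?thesis by blast
qed

lemma hecke_ideal_scale:
  assumes n: "n \<ge> 1" and a: "a \<in> hecke_ideal n us q"
  shows "(\<lambda>w. z * a w) \<in> hecke_ideal n us q"
proof -
  interpret I: ideal "hecke_ideal n us q" "free_algebra n" by (rule ideal_hecke_ideal[OF n])
  show ?thesis using I.I_l_closed[OF a scal_carrier, of z] by (simp add: free_scal_mult)
qed

lemma sum_fun_apply: "(\<Sum>j\<in>J. F j) x = (\<Sum>j\<in>J. F j x)"
  by (induction J rule: infinite_finite_induct) simp_all

text \<open>A basis of the ideal stays independent when \<open>a\<close> is adjoined, and values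
  prescribed on an independent set extend linearly.\<close>

lemma separating_functional:
  assumes n: "n \<ge> 1" and a: "a \<in> carrier (free_algebra n)" "a \<notin> hecke_ideal n us q"
  shows "\<exists>\<phi>. (\<forall>b\<in>hecke_ideal n us q. pairing \<phi> b = 0) \<and> pairing \<phi> a = 1"
proof -
  let ?I = "hecke_ideal n us q"
  define sc :: "complex \<Rightarrow> (nat list \<Rightarrow> complex) \<Rightarrow> nat list \<Rightarrow> complex" where "sc z f = (\<lambda>w. z * f w)" for z f
  interpret V: vector_space sc
    by standard (simp_all add: sc_def fun_eq_iff algebra_simps)
  interpret C: vector_space "(*) :: complex \<Rightarrow> complex \<Rightarrow> complex"
    by standard (simp_all add: algebra_simps)
  interpret VC: vector_space_pair sc "(*) :: complex \<Rightarrow> complex \<Rightarrow> complex" ..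
  interpret I: ideal ?I "free_algebra n" by (rule ideal_hecke_ideal[OF n])
  have sub: "V.subspace ?I"
  proof (rule V.subspaceI)
    show "0 \<in> ?I" using additive_subgroup.zero_closed[OF I.additive_subgroup_axioms]
      by (simp add: free_zero zero_fun_def)
    fix x y assume "x \<in> ?I" "y \<in> ?I"
    then show "x + y \<in> ?I" using additive_subgroup.a_closed[OF I.additive_subgroup_axioms, of x y]
      by (simp add: free_add plus_fun_def)
  next
    fix z x assume "x \<in> ?I"
    then show "sc z x \<in> ?I" unfolding sc_def by (rule hecke_ideal_scale[OF n])
  qed
  obtain B where B: "B \<subseteq> ?I" "V.independent B" "?I \<subseteq> V.span B"
    using V.maximal_independent_subset by blast
  have "V.span B \<subseteq> ?I" using B(1) sub by (rule V.span_minimal)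
  then have "a \<notin> V.span B" using a(2) by blast
  then have "V.independent (insert a B)" using B(2) by (rule V.independent_insertI)
  then obtain g where g: "Vector_Spaces.linear sc (*) g" "\<And>x. x \<in> insert a B \<Longrightarrow> g x = (if x = a then 1 else 0)"
    using VC.linear_independent_extend[of "insert a B" "\<lambda>x. if x = a then 1 else 0"] by blast
  interpret g: Vector_Spaces.linear sc "(*)" g by (rule g(1))
  have aB: "a \<notin> B" using V.span_base \<open>a \<notin> V.span B\<close> by blast
  have gI: "g b = 0" if "b \<in> ?I" for b
  proof -
    have "B \<subseteq> {b. g b = 0}" using g(2) aB by auto
    moreover have "V.subspace {b. g b = 0}" by (rule g.subspace_kernel)
    ultimately have "V.span B \<subseteq> {b. g b = 0}" by (rule V.span_minimal)
    then show ?thesis using that B(3) by blast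
  qed
  \<comment> \<open>The ambient vector space consists of all functions on words. The finitely
    supported ones are combinations of words, so on them \<open>g\<close> is determined by its
    values on words.\<close>
  have pair: "pairing (\<lambda>w. g (mon w)) b = g b" if "b \<in> carrier (free_algebra n)" for b
  proof -
    let ?S = "{w. b w \<noteq> 0}"
    have "b = (\<Sum>w\<in>?S. sc (b w) (mon w))"
    proof
      fix v
      have "(\<Sum>w\<in>?S. sc (b w) (mon w)) v = (\<Sum>w\<in>?S. sc (b w) (mon w) v)"
        by (rule sum_fun_apply)
      also have "\<dots> = (\<Sum>w\<in>?S. if w = v then b v else 0)"
        by (rule sum.cong[OF refl]) (auto simp: sc_def mon_def)
      also have "\<dots> = b v" using free_finite[OF that] by simp
      finally show "b v = (\<Sum>w\<in>?S. sc (b w) (mon w)) v" by simp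
    qed
    then have "g b = (\<Sum>w\<in>?S. g (sc (b w) (mon w)))" using g.sum by metis
    then show ?thesis by (simp add: pairing_def g.scale)
  qed
  show ?thesis
    using pair[OF a(1)] g(2)[of a] pair gI hecke_ideal_carrier[OF n]
    by (intro exI[of _ "\<lambda>w. g (mon w)"]) simp
qed

text \<open>Fewer homogeneous equations than unknowns: the equation at \<open>b\<close> eliminates
  one unknown \<open>k0\<close>, and the remaining equations are solved by induction.\<close>

lemma nontrivial_relation:
  fixes v :: "'k \<Rightarrow> 'b \<Rightarrow> complex"
  assumes "finite B" "finite K" "card B < card K"
  shows "\<exists>c. (\<exists>k\<in>K. c k \<noteq> 0) \<and> (\<forall>b\<in>B. (\<Sum>k\<in>K. c k * v k b) = 0)"
  using assms
proof (induction B arbitrary: K v rule: finite_induct)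
  case empty
  then obtain k where "k \<in> K" by fastforce
  then show ?case by (intro exI[of _ "\<lambda>_. 1"]) auto
next
  case (insert b B)
  show ?case
  proof (cases "\<forall>k\<in>K. v k b = 0")
    case True
    obtain c where "\<exists>k\<in>K. c k \<noteq> 0" "\<forall>b\<in>B. (\<Sum>k\<in>K. c k * v k b) = 0"
      using insert.IH[of K v] insert.prems insert.hyps by auto
    then show ?thesis using True by (intro exI[of _ c]) auto
  next
    case False
    then obtain k0 where k0: "k0 \<in> K" "v k0 b \<noteq> 0" by blast
    define v' where "v' k x = v k x - v k b / v k0 b * v k0 x" for k x
    have "card B < card (K - {k0})" using insert.prems insert.hyps k0(1) by simp
    then obtain c where c: "\<exists>k\<in>K - {k0}. c k \<noteq> 0" "\<forall>x\<in>B. (\<Sum>k\<in>K - {k0}. c k * v' k x) = 0"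
      using insert.IH[of "K - {k0}" v'] insert.prems(1) by auto
    define s where "s = (\<Sum>k\<in>K - {k0}. c k * v k b / v k0 b)"
    define c' where "c' = c(k0 := - s)"
    have sum: "(\<Sum>k\<in>K. c' k * v k x) = (\<Sum>k\<in>K - {k0}. c k * v' k x)" for x
    proof -
      have "(\<Sum>k\<in>K. c' k * v k x) = - s * v k0 x + (\<Sum>k\<in>K - {k0}. c k * v k x)"
        using sum.remove[OF insert.prems(1) k0(1), of "\<lambda>k. c' k * v k x"] by (simp add: c'_def)
      moreover have "s * v k0 x = (\<Sum>k\<in>K - {k0}. c k * (v k b / v k0 b * v k0 x))"
        unfolding s_def sum_distrib_right by (rule sum.cong) simp_all
      then have "- s * v k0 x + (\<Sum>k\<in>K - {k0}. c k * v k x) = (\<Sum>k\<in>K - {k0}. c k * v' k x)"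
        by (simp add: v'_def right_diff_distrib sum_subtractf)
      ultimately show ?thesis by simp
    qed
    have "v' k b = 0" for k using k0 by (simp add: v'_def)
    then have "\<forall>x\<in>insert b B. (\<Sum>k\<in>K. c' k * v k x) = 0" using c(2) by (simp add: sum)
    moreover have "\<exists>k\<in>K. c' k \<noteq> 0" using c(1) by (auto simp: c'_def)
    ultimately show ?thesis by blast
  qed
qed

section \<open>Jucys--Murphy elements and matrix units\<close>

fun jm :: "nat \<Rightarrow> nat list" where
  "jm 0 = []"
| "jm (Suc 0) = [1]"
| "jm (Suc (Suc k)) = Suc (Suc k) # jm (Suc k) @ [Suc (Suc k)]"

lemma set_jm: "set (jm k) \<subseteq> {1..k}"
  by (induction k rule: jm.induct) auto

context separated_parameters
begin

interpretation S: hecke_rep n us Q sop W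
  by (rule hecke_rep_sop)

definition delta :: "tableau \<Rightarrow> tableau \<Rightarrow> complex" where
  "delta L = (\<lambda>M. if M = L then 1 else 0)"

lemma delta_W: "L \<in> STD \<Longrightarrow> delta L \<in> W"
  by (auto simp: delta_def W_def)

lemma foldr_sop_W: "f \<in> W \<Longrightarrow> foldr sop w f \<in> W"
  by (cases w) (simp_all add: sop_closed)

lemma word_act_W: "a \<in> carrier (free_algebra n) \<Longrightarrow> f \<in> W \<Longrightarrow> word_act sop a f \<in> W"
  by (rule word_act_closed[OF S.U])

text \<open>Multiplying by T_(k+1) on both sides moves the eigenvalue from entry k to entry k + 1:
  the mixed term cancels by \<open>sdiag_weighted\<close>, and \<open>soff_product\<close> reduces
  the diagonal term to the new content.\<close>

lemma jm_act:
  assumes "1 \<le> k" "k \<le> n" "f \<in> W" "L \<in> STD"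
  shows "foldr sop (jm k) f L = ct (L k) * f L"
  using assms
proof (induction k arbitrary: f L rule: dec_induct)
  case base
  then show ?case by (simp add: sop_def full_op_def)
next
  case (step k)
  obtain k' where k': "k = Suc k'" using step.hyps(1) by (cases k) auto
  let ?i = "Suc k"
  have i: "?i \<in> {1..n}" "?i \<ge> 2" "k \<in> {1..n}" using step.prems step.hyps by auto
  have IH: "foldr sop (jm k) (sop ?i f) M = ct (M k) * full_op ?i f M" if "M \<in> STD" for M
    using step.IH[OF _ sop_closed that] i sop_full_op[OF that i(1), of f f] by simp
  define a b where "a = L k" and "b = L ?i"
  have nz: "ct a \<noteq> 0" "ct b \<noteq> 0" using STD_ct_nz[OF step.prems(3)] i by (simp_all add: a_def b_def)
  have ne: "ct a \<noteq> ct b" using STD_ct_neq[OF step.prems(3), of k ?i] i by (simp add: a_def b_def)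
  let ?s = "L \<circ> transpose k ?i"
  have s: "?s k = b" "?s ?i = a" by (simp_all add: a_def b_def)
  have "foldr sop (jm ?i) f L = sop ?i (foldr sop (jm k) (sop ?i f)) L" by (simp add: k')
  also have "\<dots> = full_op ?i (\<lambda>M. ct (M k) * full_op ?i f M) L"
    by (rule sop_full_op[OF step.prems(3) i(1) IH])
  also have "\<dots> = sdiag a b * (ct a * (sdiag a b * f L + soff a b * f ?s))
      + soff a b * (ct b * (sdiag b a * f ?s + soff b a * f L))"
    using i(2) by (simp add: full_op_def exch_def s flip: a_def b_def)
  also have "\<dots> = (sdiag a b ^ 2 * ct a + soff a b * soff b a * ct b) * f L
      + soff a b * (sdiag a b * ct a + sdiag b a * ct b) * f ?s"
    by (simp add: algebra_simps power2_eq_square)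
  also have "\<dots> = (sdiag a b ^ 2 * ct a + (h * sdiag a b + 1 - sdiag a b ^ 2) * ct b) * f L"
    unfolding sdiag_weighted[OF nz nz(1) ne] soff_product[OF nz nz(1) ne] by simp
  also have "sdiag a b ^ 2 * ct a + (h * sdiag a b + 1 - sdiag a b ^ 2) * ct b = ct b"
  proof -
    have "sdiag a b * (ct b - ct a) = h * ct b" using nz ne by (simp add: sdiag_alt)
    then have "sdiag a b * (sdiag a b * (ct b - ct a)) = sdiag a b * (h * ct b)" by simp
    then show ?thesis by (simp add: algebra_simps power2_eq_square)
  qed
  finally show ?case by (simp add: b_def)
qed

lemma jm_carrier: "k \<le> n \<Longrightarrow> mon (jm k) \<in> carrier (free_algebra n)"
  using set_jm[of k] by (intro mon_carrier) auto

text \<open>Lagrange interpolation: every other tableau M is separated from L by some Jucys--Murphy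
  element J_k, and the factor (J_k - ct (M k)) / (ct (L k) - ct (M k)) is 1 at L and 0 at M. All
  factors are diagonal, so their product is the projection.\<close>

lemma projection_exists:
  assumes L: "L \<in> STD"
  shows "\<exists>a\<in>carrier (free_algebra n). \<forall>f\<in>W. word_act sop a f = (\<lambda>M. if M = L then f L else 0)"
proof -
  let ?A = "free_algebra n"
  interpret A: ring ?A by (rule ring_free_algebra)
  have "\<exists>a\<in>carrier ?A. \<exists>d. d L = 1 \<and> (\<forall>M\<in>X. d M = 0) \<and>
      (\<forall>f\<in>W. word_act sop a f = (\<lambda>M. d M * f M))" if "finite X" "X \<subseteq> STD - {L}" for X
    using that
  proof (induction X rule: finite_induct)
    case empty
    show ?case by (intro bexI[of _ "\<one>\<^bsub>?A\<^esub>"] exI[of _ "\<lambda>_. 1"]) simp_all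
  next
    case (insert M X)
    then obtain a d where a: "a \<in> carrier ?A" "d L = 1" "\<forall>M\<in>X. d M = 0"
      "\<forall>f\<in>W. word_act sop a f = (\<lambda>M. d M * f M)" by auto
    have M: "M \<in> STD" "M \<noteq> L" using insert.prems by auto
    obtain k where k: "k \<in> {1..n}" "ct (L k) \<noteq> ct (M k)" using STD_separated[OF L M(1)] M(2) by blast
    define y where "y = inverse (ct (L k) - ct (M k))"
    define b where "b = scal y \<otimes>\<^bsub>?A\<^esub> (mon (jm k) \<ominus>\<^bsub>?A\<^esub> scal (ct (M k)))"
    have jc: "mon (jm k) \<in> carrier ?A" using k by (intro jm_carrier) simp
    have bA: "b \<in> carrier ?A" unfolding b_def using jc scal_carrier by blast
    define d' where "d' N = d N * (y * (ct (N k) - ct (M k)))" for N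
    have act: "word_act sop (b \<otimes>\<^bsub>?A\<^esub> a) f = (\<lambda>N. d' N * f N)" if f: "f \<in> W" for f
    proof
      fix N
      have g: "(\<lambda>M. d M * f M) \<in> W" using f by (simp add: W_def)
      have "word_act sop b g N = y * (foldr sop (jm k) g N - ct (M k) * g N)" for g
        unfolding b_def free_scal_mult word_act_scale word_act_minus[OF jc scal_carrier] by simp
      then have "word_act sop (b \<otimes>\<^bsub>?A\<^esub> a) f N =
          y * (foldr sop (jm k) (\<lambda>M. d M * f M) N - ct (M k) * (d N * f N))"
        using f a(4) by (simp add: word_act_mult[OF linear_op_sop bA a(1)])
      also have "\<dots> = d' N * f N"
      proof (cases "N \<in> STD")
        case True
        then show ?thesis using jm_act[OF _ _ g True, of k] k by (simp add: d'_def algebra_simps)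
      next
        case False
        then have "f N = 0" "foldr sop (jm k) (\<lambda>M. d M * f M) N = 0"
          using f foldr_sop_W[OF g, of "jm k"] by (simp_all add: W_def)
        then show ?thesis by simp
      qed
      finally show "word_act sop (b \<otimes>\<^bsub>?A\<^esub> a) f N = d' N * f N" .
    qed
    have "d' L = 1" using a(2) k by (simp add: d'_def y_def)
    moreover have "\<forall>N\<in>insert M X. d' N = 0" using a(3) by (auto simp: d'_def)
    moreover have "b \<otimes>\<^bsub>?A\<^esub> a \<in> carrier ?A" using bA a(1) by blast
    ultimately show ?case using act by blast
  qed
  from this[of "STD - {L}"] obtain a d where a: "a \<in> carrier ?A" "d L = 1" "\<forall>M\<in>STD - {L}. d M = 0"
    "\<forall>f\<in>W. word_act sop a f = (\<lambda>M. d M * f M)" using STD_finite by auto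
  have "word_act sop a f = (\<lambda>M. if M = L then f L else 0)" if f: "f \<in> W" for f
  proof
    fix M
    have "d M * f M = (if M = L then f L else 0)"
      using a(2,3) f by (cases "M \<in> STD") (auto simp: W_def)
    then show "word_act sop a f M = (if M = L then f L else 0)" using a(4) f by simp
  qed
  then show ?thesis using a(1) by blast
qed

lemma soff_nz:
  assumes nz: "ct a \<noteq> 0" "ct b \<noteq> 0" and ne: "ct a \<noteq> ct b" and "\<not> near (ct a) (ct b)"
  shows "soff a b \<noteq> 0"
proof
  assume "soff a b = 0"
  then have "sdiag b a = - inverse Q" using assms(4) by (simp add: soff_def eq_neg_iff_add_eq_0 add.commute)
  then have "h * ct a / (ct a - ct b) = - inverse Q" using nz by (simp add: sdiag_alt)
  then have "h * ct a = - inverse Q * (ct a - ct b)" using ne by (simp add: divide_eq_eq)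
  then have "Q * (h * ct a) = Q * (- inverse Q * (ct a - ct b))" by simp
  then have "Q ^ 2 * ct a = ct b"
    using Q_facts(1) by (simp add: algebra_simps power2_eq_square)
  then show False using assms(4) by (simp add: near_def)
qed

text \<open>The projection at L is carried along swaps: T_i leads from N to its neighbour with the
  coefficient \<open>soff\<close>, nonzero because both tableaux are standard, and the projection at
  the neighbour discards the rest. By \<open>std_connected\<close> every tableau of the shape is
  reached.\<close>

lemma matrix_unit_exists:
  assumes L: "L \<in> STD" and M: "M \<in> STD" and LM: "L ` {1..n} = M ` {1..n}"
  shows "\<exists>a\<in>carrier (free_algebra n). \<forall>f\<in>W. word_act sop a f = (\<lambda>N. if N = M then f L else 0)"
proof -
  let ?A = "free_algebra n" and ?D = "L ` {1..n}"
  interpret A: ring ?A by (rule ring_free_algebra)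
  define X where "X = {M. \<exists>a\<in>carrier ?A. \<forall>f\<in>W. word_act sop a f = (\<lambda>N. if N = M then f L else 0)}"
  have "M \<in> X"
  proof (rule std_connected[OF STD_std(1)[OF L] STD_std(2)[OF L]])
    show "M \<in> std n ?D" using STD_std(2)[OF M] LM by simp
    show "L \<in> X" using projection_exists[OF L] by (simp add: X_def)
  next
    fix N i assume N: "N \<in> X" "N \<in> std n ?D" "i \<in> {2..n}" "swap_entries i N \<in> std n ?D"
    let ?N = "swap_entries i N"
    have NS: "N \<in> STD" "?N \<in> STD" using STD_I[OF STD_std(1)[OF L]] N by auto
    obtain a where a: "a \<in> carrier ?A" "\<And>f. f \<in> W \<Longrightarrow> word_act sop a f = (\<lambda>N'. if N' = N then f L else 0)"
      using N(1) by (auto simp: X_def)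
    obtain p where p: "p \<in> carrier ?A" "\<And>f. f \<in> W \<Longrightarrow> word_act sop p f = (\<lambda>N'. if N' = ?N then f ?N else 0)"
      using projection_exists[OF NS(2)] by blast
    have i: "i \<in> {1..n}" "i - 1 \<in> {1..n}" "i - 1 < i" "i \<noteq> 1" "i \<le> i - 1 + 2" using N(3) by auto
    define c where "c = soff (?N (i - 1)) (?N i)"
    have sw: "swap_entries i ?N = N" by (simp add: swap_entries_def)
    have NN: "?N \<noteq> N"
    proof
      assume "?N = N"
      then have "?N i = N i" by simp
      then have "N (i - 1) = N i" by (simp add: swap_entries_def)
      then show False using STD_ct_neq[OF NS(1) i(2,1,3,5)] by simp
    qed
    have "c \<noteq> 0" unfolding c_def
    proof (rule soff_nz)
      show "ct (?N (i - 1)) \<noteq> 0" "ct (?N i) \<noteq> 0" using STD_ct_nz[OF NS(2)] i by auto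
      show "ct (?N (i - 1)) \<noteq> ct (?N i)" using STD_ct_neq[OF NS(2) i(2,1,3,5)] by simp
      show "\<not> near (ct (?N (i - 1))) (ct (?N i))"
        using STD_near_iff[OF NS(2) N(3)] swap_STD_iff[OF NS(2) N(3)] sw NS(1) by simp
    qed
    define b where "b = p \<otimes>\<^bsub>?A\<^esub> (gen i \<otimes>\<^bsub>?A\<^esub> a)"
    have gi: "gen i \<in> carrier ?A" using i(1) by (rule gen_carrier)
    have ga: "gen i \<otimes>\<^bsub>?A\<^esub> a \<in> carrier ?A" and bA: "b \<in> carrier ?A"
      unfolding b_def using gi a(1) p(1) by blast+
    have bact: "word_act sop b f = (\<lambda>N'. if N' = ?N then c * f L else 0)" if f: "f \<in> W" for f
    proof -
      let ?g = "\<lambda>N'. if N' = N then f L else 0"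
      have "word_act sop b f = word_act sop p (sop i ?g)"
        unfolding b_def using f a gi
        by (simp add: word_act_mult[OF linear_op_sop p(1) ga] word_act_mult[OF linear_op_sop gi a(1)])
      also have "\<dots> = (\<lambda>N'. if N' = ?N then sop i ?g ?N else 0)" by (rule p(2)[OF sop_closed])
      also have "sop i ?g ?N = c * f L"
        using NS(2) NN i(4) sw[unfolded swap_entries_def[of i ?N]]
        by (simp add: sop_def full_op_def exch_def c_def)
      finally show ?thesis .
    qed
    have "word_act sop (\<lambda>w. inverse c * b w) f = (\<lambda>N'. if N' = ?N then f L else 0)" if "f \<in> W" for f
      unfolding word_act_scale bact[OF that] using \<open>c \<noteq> 0\<close> by (auto simp: fun_eq_iff)
    moreover have "(\<lambda>w. inverse c * b w) \<in> carrier ?A" by (rule free_scale_carrier[OF bA])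
    ultimately show "?N \<in> X" unfolding X_def by blast
  qed
  then show ?thesis by (simp add: X_def)
qed

definition shape_pairs :: "(tableau \<times> tableau) set" where
  "shape_pairs = {(L, M). L \<in> STD \<and> M \<in> STD \<and> L ` {1..n} = M ` {1..n}}"

text \<open>Sends the basis vector of L to that of M and all others to zero. The choice concerns
  only the representative in the free algebra; by faithfulness the class in the Hecke algebra is
  unique.\<close>

definition mat_unit :: "tableau \<Rightarrow> tableau \<Rightarrow> nat list \<Rightarrow> complex" where
  "mat_unit L M = (SOME a. a \<in> carrier (free_algebra n) \<and>
     (\<forall>f\<in>W. word_act sop a f = (\<lambda>N. if N = M then f L else 0)))"

lemma mat_unit:
  assumes "(L, M) \<in> shape_pairs"
  shows "mat_unit L M \<in> carrier (free_algebra n)"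
    and "f \<in> W \<Longrightarrow> word_act sop (mat_unit L M) f = (\<lambda>N. if N = M then f L else 0)"
proof -
  have "\<exists>a. a \<in> carrier (free_algebra n) \<and> (\<forall>f\<in>W. word_act sop a f = (\<lambda>N. if N = M then f L else 0))"
    using matrix_unit_exists[of L M] assms by (auto simp: shape_pairs_def)
  from someI_ex[OF this] show "mat_unit L M \<in> carrier (free_algebra n)"
    and "f \<in> W \<Longrightarrow> word_act sop (mat_unit L M) f = (\<lambda>N. if N = M then f L else 0)"
    by (simp_all add: mat_unit_def)
qed

lemma card_shape_pairs: "finite shape_pairs" "card shape_pairs = r ^ n * fact n"
proof -
  have eq: "shape_pairs = (\<Union>D\<in>diagrams r n. std n D \<times> std n D)"
  proof (intro equalityI subsetI)
    fix p assume "p \<in> shape_pairs"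
    then obtain L M where p: "p = (L, M)" "L \<in> STD" "M \<in> STD" "L ` {1..n} = M ` {1..n}"
      by (auto simp: shape_pairs_def)
    then show "p \<in> (\<Union>D\<in>diagrams r n. std n D \<times> std n D)"
      using STD_std[OF p(2)] STD_std(2)[OF p(3)] by auto
  next
    fix p assume "p \<in> (\<Union>D\<in>diagrams r n. std n D \<times> std n D)"
    then obtain D L M where p: "D \<in> diagrams r n" "p = (L, M)" "L \<in> std n D" "M \<in> std n D" by blast
    then show "p \<in> shape_pairs"
      using STD_I[OF p(1,3)] STD_I[OF p(1,4)] std_image[OF p(3)] std_image[OF p(4)]
      by (simp add: shape_pairs_def)
  qed
  have fin: "finite (std n D)" if "D \<in> diagrams r n" for D
    using that by (intro finite_std) (simp add: diagrams_def)
  have "card shape_pairs = (\<Sum>D\<in>diagrams r n. card (std n D \<times> std n D))"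
    unfolding eq
  proof (rule card_UN_disjoint[OF finite_diagrams])
    show "\<forall>D\<in>diagrams r n. finite (std n D \<times> std n D)" using fin by simp
    show "\<forall>D\<in>diagrams r n. \<forall>E\<in>diagrams r n. D \<noteq> E \<longrightarrow> std n D \<times> std n D \<inter> (std n E \<times> std n E) = {}"
      using std_image by blast
  qed
  then show "card shape_pairs = r ^ n * fact n"
    using sum_card_std_squares[of n r] by (simp add: card_cartesian_product)
  show "finite shape_pairs" unfolding eq using fin finite_diagrams by blast
qed

text \<open>The matrix coefficients of the seminormal representation are \<open>r\<^sup>n n!\<close> linearly independent
  functionals on the Hecke algebra, and normal forms show that there are no more.\<close>

theorem sop_faithful:
  assumes a: "a \<in> carrier (free_algebra n)" and kill: "\<And>f. f \<in> W \<Longrightarrow> word_act sop a f = (\<lambda>x. 0)"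
  shows "a \<in> hecke_ideal n us Q"
proof (rule ccontr)
  assume "a \<notin> hecke_ideal n us Q"
  then obtain \<phi> where \<phi>: "\<And>b. b \<in> hecke_ideal n us Q \<Longrightarrow> pairing \<phi> b = 0" "pairing \<phi> a = 1"
    using separating_functional[OF n a] by blast
  \<comment> \<open>For r = 0 the cyclotomic relation reads 1 = 0, and the ideal would contain
    \<open>a\<close>.\<close>
  have r: "r > 0"
  proof (rule ccontr)
    assume "\<not> r > 0"
    then have us: "us = []" using len by simp
    interpret A: ring "free_algebra n" by (rule ring_free_algebra)
    interpret I: ideal "hecke_ideal n us Q" "free_algebra n" by (rule ideal_hecke_ideal[OF n])
    have "\<one>\<^bsub>free_algebra n\<^esub> \<in> hecke_relations n us Q"
      unfolding hecke_relations_def Let_def us cyclotomic_poly_def by simp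
    then have "\<one>\<^bsub>free_algebra n\<^esub> \<in> hecke_ideal n us Q"
      unfolding hecke_ideal_def using A.genideal_self[OF hecke_relations_carrier[OF n]] by blast
    then have "a \<in> hecke_ideal n us Q" using I.I_l_closed[of "\<one>\<^bsub>free_algebra n\<^esub>" a] a by simp
    then show False using \<open>a \<notin> hecke_ideal n us Q\<close> by simp
  qed
  \<comment> \<open>The index \<open>None\<close> stands for the separating functional; with it
    there are more functionals than normal words.\<close>
  define v where "v k w = (case k of None \<Rightarrow> \<phi> w | Some (L, M) \<Rightarrow> foldr sop w (delta L) M)" for k w
  define K where "K = insert None (Some ` shape_pairs)"
  have finK: "finite K" using card_shape_pairs(1) by (simp add: K_def)
  have "card K = Suc (card shape_pairs)"
    using card_shape_pairs(1) by (simp add: K_def card_insert_if card_image image_iff)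
  then have "card (normal_words r n) < card K"
    using card_normal_words[OF r, of n] card_shape_pairs(2) by simp
  then obtain c where c: "\<exists>k\<in>K. c k \<noteq> 0" "\<And>b. b \<in> normal_words r n \<Longrightarrow> (\<Sum>k\<in>K. c k * v k b) = 0"
    using nontrivial_relation[of "normal_words r n" K v] card_normal_words[OF r, of n] finK by blast
  define \<Psi> where "\<Psi> w = (\<Sum>k\<in>K. c k * v k w)" for w
  have pv: "pairing (v (Some (L, M))) b = word_act sop b (delta L) M" for L M b
    by (simp add: v_def[abs_def] word_act_def)
  have pN: "pairing (v None) b = pairing \<phi> b" for b
    by (simp add: v_def[abs_def])
  have pP: "pairing \<Psi> b = (\<Sum>k\<in>K. c k * pairing (v k) b)" for b
    unfolding \<Psi>_def by (rule pairing_sum_left)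
  have pair_ideal: "pairing (v k) b = 0" if "k \<in> K" "b \<in> hecke_ideal n us Q" for k b
  proof (cases k)
    case None
    then show ?thesis using \<phi>(1) that pN by simp
  next
    case (Some p)
    then obtain L M where "k = Some (L, M)" "L \<in> STD"
      using \<open>k \<in> K\<close> by (auto simp: K_def shape_pairs_def)
    then show ?thesis using S.hecke_ideal_acts_zero[OF that(2) delta_W] pv by simp
  qed
  have "pairing \<Psi> b = 0" if "b \<in> hecke_ideal n us Q" for b
    unfolding pP using pair_ideal that by (intro sum.neutral) simp
  then obtain p where "hecke_word_fun n (length us) h p \<Psi>"
    using annihilator_word_fun[OF n Q_facts(1), of us \<Psi>] by blast
  then interpret F: hecke_word_fun n r h p \<Psi> by (simp add: len)
  have "\<Psi> w = 0" if "set w \<subseteq> {1..n}" for w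
    using F.vanish_on_normal_words[OF r, of n "[]" w] c(2) that by (simp add: \<Psi>_def)
  then have zero: "pairing \<Psi> b = 0" if "b \<in> carrier (free_algebra n)" for b
    using pairing_cong[OF that, of \<Psi> "\<lambda>w. 0"] by simp
  have split: "pairing \<Psi> b = c None * pairing \<phi> b + (\<Sum>p\<in>shape_pairs. c (Some p) * pairing (v (Some p)) b)" for b
  proof -
    have "pairing \<Psi> b = c None * pairing (v None) b + (\<Sum>k\<in>Some ` shape_pairs. c k * pairing (v k) b)"
      unfolding pP K_def using card_shape_pairs(1) by (subst sum.insert) auto
    then show ?thesis by (simp add: pN sum.reindex)
  qed
  have "pairing (v (Some p)) a = 0" if "p \<in> shape_pairs" for p
    using that kill[OF delta_W] pv by (auto simp: shape_pairs_def)
  \<comment> \<open>At \<open>a\<close> the matrix coefficients vanish while \<open>\<phi>\<close>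
    takes the value 1, so \<open>\<phi>\<close> does not occur in the relation; the matrix units
    then isolate the remaining coefficients.\<close>
  then have c0: "c None = 0" using split[of a] zero[OF a] \<phi>(2) by simp
  have cS: "c (Some (L, M)) = 0" if LM: "(L, M) \<in> shape_pairs" for L M
  proof -
    have val: "pairing (v (Some p)) (mat_unit L M) = (if p = (L, M) then 1 else 0)" if "p \<in> shape_pairs" for p
    proof -
      obtain L' M' where p: "p = (L', M')" "L' \<in> STD"
        using \<open>p \<in> shape_pairs\<close> by (auto simp: shape_pairs_def)
      then show ?thesis using mat_unit(2)[OF LM delta_W[OF p(2)]] pv by (auto simp: delta_def)
    qed
    have "pairing \<Psi> (mat_unit L M) = (\<Sum>p\<in>shape_pairs. if p = (L, M) then c (Some p) else 0)"
      unfolding split c0 using val by (auto intro!: sum.cong)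
    also have "\<dots> = c (Some (L, M))"
      using LM by (subst sum.delta[OF card_shape_pairs(1)]) simp
    finally show ?thesis using zero[OF mat_unit(1)[OF LM]] by simp
  qed
  show False using c(1) c0 cS by (auto simp: K_def)
qed

end

section \<open>Simplicity, non-isomorphism and completeness of the list\<close>

section \<open>The simple modules\<close>

text \<open>The homomorphism will be built from the concrete module to the abstract one, while the
  classification asks for the opposite direction.\<close>

lemma left_module_iso_inverse:
  assumes bij: "bij_betw \<psi> (carrier N) (carrier M)"
    and add: "\<And>x y. x \<in> carrier N \<Longrightarrow> y \<in> carrier N \<Longrightarrow> x \<oplus>\<^bsub>N\<^esub> y \<in> carrier N"
    and smult: "\<And>a x. a \<in> carrier R \<Longrightarrow> x \<in> carrier N \<Longrightarrow> a \<odot>\<^bsub>N\<^esub> x \<in> carrier N"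
    and hom_add: "\<And>x y. x \<in> carrier N \<Longrightarrow> y \<in> carrier N \<Longrightarrow> \<psi> (x \<oplus>\<^bsub>N\<^esub> y) = \<psi> x \<oplus>\<^bsub>M\<^esub> \<psi> y"
    and hom_smult: "\<And>a x. a \<in> carrier R \<Longrightarrow> x \<in> carrier N \<Longrightarrow> \<psi> (a \<odot>\<^bsub>N\<^esub> x) = a \<odot>\<^bsub>M\<^esub> \<psi> x"
  shows "left_module_iso R M N"
proof -
  define \<phi> where "\<phi> = inv_into (carrier N) \<psi>"
  have \<phi>: "\<phi> x \<in> carrier N" "\<psi> (\<phi> x) = x" if "x \<in> carrier M" for x
    using bij that unfolding \<phi>_def bij_betw_def by (auto intro: inv_into_into f_inv_into_f)
  have \<phi>\<psi>: "\<phi> (\<psi> y) = y" if "y \<in> carrier N" for y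
    using bij that unfolding \<phi>_def bij_betw_def by (auto intro: inv_into_f_f)
  have "bij_betw \<phi> (carrier M) (carrier N)"
    unfolding \<phi>_def by (rule bij_betw_inv_into[OF bij])
  moreover have "\<phi> (x \<oplus>\<^bsub>M\<^esub> y) = \<phi> x \<oplus>\<^bsub>N\<^esub> \<phi> y" if "x \<in> carrier M" "y \<in> carrier M" for x y
    using \<phi>\<psi>[OF add[OF \<phi>(1)[OF that(1)] \<phi>(1)[OF that(2)]]] hom_add[OF \<phi>(1)[OF that(1)] \<phi>(1)[OF that(2)]] \<phi>(2) that
    by simp
  moreover have "\<phi> (a \<odot>\<^bsub>M\<^esub> x) = a \<odot>\<^bsub>N\<^esub> \<phi> x" if "a \<in> carrier R" "x \<in> carrier M" for a x
    using \<phi>\<psi>[OF smult[OF that(1) \<phi>(1)[OF that(2)]]] hom_smult[OF that(1) \<phi>(1)[OF that(2)]] \<phi>(2) that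
    by simp
  ultimately show ?thesis unfolding left_module_iso_def by blast
qed

context left_module
begin

lemma smult_l_null:
  assumes "x \<in> carrier M"
  shows "\<zero>\<^bsub>R\<^esub> \<odot>\<^bsub>M\<^esub> x = \<zero>\<^bsub>M\<^esub>"
proof -
  have "\<zero>\<^bsub>R\<^esub> \<odot>\<^bsub>M\<^esub> x \<oplus>\<^bsub>M\<^esub> \<zero>\<^bsub>R\<^esub> \<odot>\<^bsub>M\<^esub> x = \<zero>\<^bsub>R\<^esub> \<odot>\<^bsub>M\<^esub> x"
    using smult_l_distr[of "\<zero>\<^bsub>R\<^esub>" "\<zero>\<^bsub>R\<^esub>" x] assms by simp
  then show ?thesis using assms M.add.l_cancel_one[of "\<zero>\<^bsub>R\<^esub> \<odot>\<^bsub>M\<^esub> x"] by simp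
qed

lemma smult_r_null:
  assumes "a \<in> carrier R"
  shows "a \<odot>\<^bsub>M\<^esub> \<zero>\<^bsub>M\<^esub> = \<zero>\<^bsub>M\<^esub>"
proof -
  have "a \<odot>\<^bsub>M\<^esub> \<zero>\<^bsub>M\<^esub> \<oplus>\<^bsub>M\<^esub> a \<odot>\<^bsub>M\<^esub> \<zero>\<^bsub>M\<^esub> = a \<odot>\<^bsub>M\<^esub> \<zero>\<^bsub>M\<^esub>"
    using smult_r_distr[of a "\<zero>\<^bsub>M\<^esub>" "\<zero>\<^bsub>M\<^esub>"] assms by simp
  then show ?thesis using assms M.add.l_cancel_one[of "a \<odot>\<^bsub>M\<^esub> \<zero>\<^bsub>M\<^esub>"] by simp
qed

end

context separated_parameters
begin

interpretation S: hecke_rep n us Q sop W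
  by (rule hecke_rep_sop)

abbreviation cls :: "(nat list \<Rightarrow> complex) \<Rightarrow> (nat list \<Rightarrow> complex) set" where
  "cls \<equiv> hecke_class n us Q"

text \<open>Faithfulness as a tool: identities in the Hecke algebra are checked on functions of
  tableaux and can then be applied in an arbitrary module.\<close>

lemma cls_eqI:
  assumes "a \<in> carrier (free_algebra n)" "b \<in> carrier (free_algebra n)"
    and "\<And>f. f \<in> W \<Longrightarrow> word_act sop a f = word_act sop b f"
  shows "cls a = cls b"
proof (rule hecke_class_eqI[OF n assms(1,2)], rule sop_faithful)
  interpret A: ring "free_algebra n" by (rule ring_free_algebra)
  show "a \<ominus>\<^bsub>free_algebra n\<^esub> b \<in> carrier (free_algebra n)" using assms(1,2) by simp
  show "word_act sop (a \<ominus>\<^bsub>free_algebra n\<^esub> b) f = (\<lambda>x. 0)" if "f \<in> W" for f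
    using assms(3)[OF that] by (simp add: word_act_minus[OF assms(1,2)])
qed

text \<open>For f supported on the shape of L, the element that sends the basis vector of L to f and
  all others to zero. For fixed L the classes of these elements form a column of matrix units, a
  copy of the module of this shape inside the algebra.\<close>

definition comb :: "tableau \<Rightarrow> (tableau \<Rightarrow> complex) \<Rightarrow> nat list \<Rightarrow> complex" where
  "comb L f = (\<lambda>w. \<Sum>M\<in>std n (L ` {1..n}). f M * mat_unit L M w)"

definition shape_space :: "diagram_box set \<Rightarrow> (tableau \<Rightarrow> complex) set" where
  "shape_space D = {f. \<forall>L. L \<notin> std n D \<longrightarrow> f L = 0}"

lemma shape_space_W: "D \<in> diagrams r n \<Longrightarrow> f \<in> shape_space D \<Longrightarrow> f \<in> W"
  using STD_I by (auto simp: W_def shape_space_def)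

lemma shape_space_subspace: "fun_subspace (shape_space D)"
  by (auto simp: fun_subspace_def shape_space_def)

context
  fixes L :: tableau and D :: "diagram_box set"
  assumes D: "D \<in> diagrams r n" and L: "L \<in> std n D"
begin

lemma image_L: "L ` {1..n} = D"
  by (rule std_image[OF L])

lemma pairs_L: "M \<in> std n D \<Longrightarrow> (L, M) \<in> shape_pairs" "M \<in> std n D \<Longrightarrow> (M, L) \<in> shape_pairs"
  using STD_I[OF D L] STD_I[OF D] std_image image_L by (auto simp only: shape_pairs_def mem_Collect_eq prod.case)

lemma comb_carrier: "comb L f \<in> carrier (free_algebra n)"
  unfolding comb_def image_L
  by (intro free_sum_carrier free_scale_carrier mat_unit(1) pairs_L)

lemma comb_act:
  assumes "f \<in> shape_space D" "g \<in> W"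
  shows "word_act sop (comb L f) g = (\<lambda>N. g L * f N)"
proof
  fix N
  have fin: "finite (std n D)" using D by (intro finite_std) (simp add: diagrams_def)
  have "word_act sop (comb L f) g N = (\<Sum>M\<in>std n D. word_act sop (\<lambda>w. f M * mat_unit L M w) g N)"
    unfolding comb_def image_L
    using word_act_sum[of "std n D" "\<lambda>M w. f M * mat_unit L M w" n sop g]
      free_scale_carrier[OF mat_unit(1)[OF pairs_L(1)]] by simp
  also have "\<dots> = (\<Sum>M\<in>std n D. if M = N then f N * g L else 0)"
    using mat_unit(2)[OF pairs_L(1) assms(2)] by (intro sum.cong refl) (simp add: word_act_scale)
  also have "\<dots> = g L * f N"
    using assms(1) fin by (simp add: shape_space_def)
  finally show "word_act sop (comb L f) g N = g L * f N" .
qed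

lemma delta_shape_space: "delta L \<in> shape_space D"
  using L by (auto simp: delta_def shape_space_def)

end

section \<open>Comparison with the modules attached to multipartitions\<close>

context
  fixes lam :: "nat list list" and c :: "diagram_box \<Rightarrow> complex"
  assumes lam: "lam \<in> multipartitions r n" and c: "content_function q us lam c"
begin

abbreviation "D \<equiv> boxes lam"

lemma D_diagram: "D \<in> diagrams r n"
  by (rule boxes_in_diagrams[OF lam])

lemma q2pow_ct: "b \<in> D \<Longrightarrow> q2pow q (c b) = ct b"
  using content_function_formula[OF q c, of "fst b" "fst (snd b)" "snd (snd b)"] lam
  by (simp add: multipartitions_def ct_def cont_def)

lemma q2pow_diff:
  assumes "b \<in> D" "b' \<in> D"
  shows "q2pow q (c b - c b') = ct b / ct b'"
proof -
  have "q2pow q (c b) = q2pow q (c b - c b') * q2pow q (c b')"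
    using q2pow_add[of q "c b - c b'" "c b'"] by simp
  moreover have "q2pow q (c b') \<noteq> 0" by (simp add: q2pow_def)
  ultimately show ?thesis using q2pow_ct assms by (simp add: nonzero_eq_divide_eq)
qed

lemma st: "standard_tableaux n lam = std n D"
  by (rule standard_tableaux_eq_std[OF lam])

lemma std_boxes: "L \<in> std n D \<Longrightarrow> k \<in> {1..n} \<Longrightarrow> L k \<in> D"
  using bij_betwE[OF std_bij] by blast

lemma no_denominator_vanishes:
  assumes "L \<in> standard_tableaux n lam" "i \<in> {2..n}"
  shows "q2pow q (c (L (i - 1)) - c (L i)) \<noteq> 1"
proof -
  have L: "L \<in> std n D" "L \<in> STD" using assms(1) st STD_I[OF D_diagram] by auto
  have i: "i - 1 \<in> {1..n}" "i \<in> {1..n}" "i - 1 < i" "i \<le> i - 1 + 2" using assms(2) by auto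
  show ?thesis
    unfolding q2pow_diff[OF std_boxes[OF L(1) i(1)] std_boxes[OF L(1) i(2)]]
    using STD_ct_neq[OF L(2) i] STD_ct_nz[OF L(2) i(2)] by simp
qed

text \<open>The module is given by images of basis vectors, \<open>sop\<close> by coordinates, so
  one is the transpose of the other. Since a swap is an involution, each coordinate receives at most
  two contributions.\<close>

lemma gen_op_eq_sop:
  assumes f: "f \<in> shape_space D" and i: "i \<in> {1..n}"
  shows "gen_op q n c lam i f = sop i f" "sop i f \<in> shape_space D"
proof -
  have fin: "finite (std n D)" using D_diagram by (intro finite_std) (simp add: diagrams_def)
  have f0: "f N = 0" if "N \<notin> std n D" for N using f that by (simp add: shape_space_def)
  have bv: "basis_vec n lam L M = (if M = L \<and> L \<in> std n D then 1 else 0)" for L M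
    by (simp add: basis_vec_def st)
  \<comment> \<open>A swap preserves the set of boxes, so the operators preserve the functions
    supported on one shape.\<close>
  have outside: "sop i f M = 0" if M: "M \<notin> std n D" for M
  proof (cases "M \<in> STD \<and> i \<noteq> 1")
    case True
    then have i2: "i \<in> {2..n}" using i by auto
    have "swap_entries i M \<notin> std n D"
    proof
      assume "swap_entries i M \<in> std n D"
      then have "swap_entries i M ` {1..n} = D" by (rule std_image)
      then have "M ` {1..n} = D" using swap_image[OF i2] by simp
      then show False using STD_std(2)[of M] True M by simp
    qed
    then have "f (M \<circ> transpose (i - 1) i) = 0" using f0 by (simp add: swap_entries_def)
    then show ?thesis using f0[OF M] True by (simp add: sop_def full_op_def exch_def)
  next
    case False
    then show ?thesis using f0[OF M] by (auto simp: sop_def full_op_def)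
  qed
  then show "sop i f \<in> shape_space D" by (simp add: shape_space_def)
  show "gen_op q n c lam i f = sop i f"
  proof
    fix M
    show "gen_op q n c lam i f M = sop i f M"
    proof (cases "i = 1")
      case True
      have "gen_op q n c lam i f M =
          (\<Sum>L\<in>std n D. if L = M then f M * q2pow q (c (M 1)) else 0)"
        unfolding gen_op_def st
        by (rule sum.cong[OF refl]) (simp add: gen_on_basis_def True bv)
      also have "\<dots> = (if M \<in> std n D then f M * q2pow q (c (M 1)) else 0)" using fin by simp
      also have "\<dots> = sop i f M"
      proof (cases "M \<in> std n D")
        case M: True
        then show ?thesis
          using q2pow_ct[OF std_boxes[OF M, of 1]] n STD_I[OF D_diagram M] True
          by (simp add: sop_def full_op_def)
      qed (simp add: outside)
      finally show ?thesis .
    next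
      case False
      then have i2: "i \<in> {2..n}" using i by auto
      have i': "i - 1 \<in> {1..n}" "i \<in> {1..n}" using i2 by auto
      have sw: "swap_entries i (swap_entries i N) = N" for N by (simp add: swap_entries_def)
      have eq: "M = swap_entries i L \<longleftrightarrow> L = swap_entries i M" for L using sw by metis
      have "gen_op q n c lam i f M =
          (\<Sum>L\<in>std n D. (if L = M then f M * diag_coeff q c i M else 0)
            + (if L = swap_entries i M then (if M \<in> std n D then
                f L * (complex_of_real (inverse q) + diag_coeff q c i L) else 0) else 0))"
        unfolding gen_op_def st
      proof (rule sum.cong[OF refl])
        fix L assume "L \<in> std n D"
        have "gen_on_basis q n c lam i L M = diag_coeff q c i L * (if M = L then 1 else 0) +
            (complex_of_real (inverse q) + diag_coeff q c i L) *
              (if L = swap_entries i M \<and> M \<in> std n D then 1 else 0)"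
        proof (cases "L = swap_entries i M")
          case True
          then have "swap_entries i L = M" using sw by simp
          then show ?thesis using True False \<open>L \<in> std n D\<close> by (simp add: gen_on_basis_def bv)
        next
          case F: False
          then have "M \<noteq> swap_entries i L" using eq by simp
          then show ?thesis using F False \<open>L \<in> std n D\<close> by (simp add: gen_on_basis_def bv)
        qed
        then show "f L * gen_on_basis q n c lam i L M = (if L = M then f M * diag_coeff q c i M else 0)
            + (if L = swap_entries i M then (if M \<in> std n D then
                f L * (complex_of_real (inverse q) + diag_coeff q c i L) else 0) else 0)"
          by (simp add: distrib_left)
      qed
      also have "\<dots> = (if M \<in> std n D then f M * diag_coeff q c i M else 0)
          + (if swap_entries i M \<in> std n D then (if M \<in> std n D then f (swap_entries i M) *
              (complex_of_real (inverse q) + diag_coeff q c i (swap_entries i M)) else 0) else 0)"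
        using fin by (simp add: sum.distrib)
      also have "\<dots> = sop i f M"
      proof (cases "M \<in> std n D")
        case M: True
        have MS: "M \<in> STD" by (rule STD_I[OF D_diagram M])
        have d: "diag_coeff q c i N = sdiag (N (i - 1)) (N i)" if "N \<in> std n D" for N
          using q2pow_diff[OF std_boxes[OF that i'(1)] std_boxes[OF that i'(2)]]
          by (simp add: diag_coeff_def sdiag_def)
        have s: "swap_entries i M (i - 1) = M i" "swap_entries i M i = M (i - 1)"
          by (simp_all add: swap_entries_def)
        have "soff (M (i - 1)) (M i) * f (swap_entries i M) =
            (if swap_entries i M \<in> std n D then f (swap_entries i M) *
              (complex_of_real (inverse q) + diag_coeff q c i (swap_entries i M)) else 0)"
        proof (cases "swap_entries i M \<in> std n D")
          case T: True
          have "\<not> near (ct (M (i - 1))) (ct (M i))"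
            using STD_near_iff[OF MS i2] swap_std_iff[OF M i2] T by blast
          then show ?thesis using T d[OF T] s by (simp add: soff_def)
        qed (simp add: f0)
        then show ?thesis
          using M MS False d[OF M] unfolding swap_entries_def[of i M]
          by (simp add: sop_def full_op_def exch_def)
      qed (simp add: outside)
      finally show ?thesis .
    qed
  qed
qed

lemma free_act_eq_sop:
  assumes f: "f \<in> shape_space D" and a: "a \<in> carrier (free_algebra n)"
  shows "free_act q n c lam a f = word_act sop a f"
proof -
  have "foldr (gen_op q n c lam) w f = foldr sop w f \<and> foldr sop w f \<in> shape_space D" if "set w \<subseteq> {1..n}" for w
    using that by (induction w) (simp_all add: f gen_op_eq_sop)
  then show ?thesis
    unfolding free_act_eq_word_act word_act_def by (intro ext pairing_cong[OF a]) simp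
qed

lemma word_act_shape:
  assumes "f \<in> shape_space D" "a \<in> carrier (free_algebra n)"
  shows "word_act sop a f \<in> shape_space D"
  by (rule word_act_closed[OF shape_space_subspace _ assms(2,1)]) (rule gen_op_eq_sop(2))

abbreviation "V \<equiv> H_tilde q n c lam"

lemma V_simps: "carrier V = shape_space D" "\<zero>\<^bsub>V\<^esub> = (\<lambda>L. 0)" "f \<oplus>\<^bsub>V\<^esub> g = (\<lambda>L. f L + g L)"
  by (simp_all add: H_tilde_def shape_space_def st)

lemma V_smult:
  assumes f: "f \<in> shape_space D" and a: "a \<in> carrier (free_algebra n)"
  shows "cls a \<odot>\<^bsub>V\<^esub> f = word_act sop a f"
proof -
  interpret A: ring "free_algebra n" by (rule ring_free_algebra)
  have "b \<in> carrier (free_algebra n)" if "b \<in> cls a" for b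
    using that mem_hecke_class[OF n] hecke_ideal_carrier[OF n] a by auto
  then have "(\<lambda>a. free_act q n c lam a f) ` cls a = (\<lambda>a. word_act sop a f) ` cls a"
    using free_act_eq_sop[OF f] by (intro image_cong) simp_all
  then have "cls a \<odot>\<^bsub>V\<^esub> f = S.class_act (cls a) f" by (simp add: H_tilde_def S.class_act_def)
  then show ?thesis using S.class_act_class[OF a shape_space_W[OF D_diagram f]] by simp
qed

lemma V_action:
  assumes "a \<in> carrier (free_algebra n)" "f \<in> carrier V"
  shows "cls a \<odot>\<^bsub>V\<^esub> f = free_act q n c lam a f"
  using assms V_smult free_act_eq_sop by (simp add: V_simps)

lemma V_left_module: "left_module (hecke n us Q) V"
proof -
  let ?R = "hecke n us Q"
  interpret A: ring "free_algebra n" by (rule ring_free_algebra)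
  interpret R: ring ?R by (rule ring_hecke[OF n])
  have sub: "(\<lambda>x. f x + g x) \<in> shape_space D" "(\<lambda>x. 0) \<in> shape_space D"
    if "f \<in> shape_space D" "g \<in> shape_space D" for f g
    using that by (simp_all add: shape_space_def)
  have lin: "linear_op (word_act sop a)" for a by (rule linear_op_word_act[OF linear_op_sop])
  interpret V: abelian_group V
  proof (rule abelian_groupI)
    fix x assume x: "x \<in> carrier V"
    then have "(\<lambda>L. - x L) \<in> carrier V" by (simp add: V_simps shape_space_def)
    moreover have "(\<lambda>L. - x L) \<oplus>\<^bsub>V\<^esub> x = \<zero>\<^bsub>V\<^esub>" by (simp add: V_simps)
    ultimately show "\<exists>y\<in>carrier V. y \<oplus>\<^bsub>V\<^esub> x = \<zero>\<^bsub>V\<^esub>" by blast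
  qed (simp_all add: V_simps shape_space_def algebra_simps)
  show ?thesis
  proof (intro left_module.intro left_module_axioms.intro)
    show "ring ?R" by (rule R.ring_axioms)
    show "abelian_group V" by (rule V.abelian_group_axioms)
  next
    fix X x assume "X \<in> carrier ?R" "x \<in> carrier V"
    then show "X \<odot>\<^bsub>V\<^esub> x \<in> carrier V"
      using word_act_shape V_smult by (auto simp: hecke_carrier[OF n] V_simps)
  next
    fix X Y x assume X: "X \<in> carrier ?R" and Y: "Y \<in> carrier ?R" and x: "x \<in> carrier V"
    obtain a b where ab: "a \<in> carrier (free_algebra n)" "X = cls a" "b \<in> carrier (free_algebra n)" "Y = cls b"
      using X Y by (auto simp: hecke_carrier[OF n])
    have x': "x \<in> shape_space D" using x by (simp add: V_simps)
    show "(X \<oplus>\<^bsub>?R\<^esub> Y) \<odot>\<^bsub>V\<^esub> x = X \<odot>\<^bsub>V\<^esub> x \<oplus>\<^bsub>V\<^esub> Y \<odot>\<^bsub>V\<^esub> x"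
      using ab x' V_smult[OF x'] by (simp add: hecke_class_add[OF n, symmetric] V_simps word_act_add)
    show "(X \<otimes>\<^bsub>?R\<^esub> Y) \<odot>\<^bsub>V\<^esub> x = X \<odot>\<^bsub>V\<^esub> (Y \<odot>\<^bsub>V\<^esub> x)"
      using ab x' V_smult[OF x'] V_smult[OF word_act_shape[OF x' ab(3)]]
      by (simp add: hecke_class_mult[OF n, symmetric] word_act_mult[OF linear_op_sop])
  next
    fix X x y assume X: "X \<in> carrier ?R" and xy: "x \<in> carrier V" "y \<in> carrier V"
    obtain a where a: "a \<in> carrier (free_algebra n)" "X = cls a" using X by (auto simp: hecke_carrier[OF n])
    have xy': "x \<in> shape_space D" "y \<in> shape_space D" using xy by (simp_all add: V_simps)
    show "X \<odot>\<^bsub>V\<^esub> (x \<oplus>\<^bsub>V\<^esub> y) = X \<odot>\<^bsub>V\<^esub> x \<oplus>\<^bsub>V\<^esub> X \<odot>\<^bsub>V\<^esub> y"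
      using a V_smult[OF xy'(1) a(1)] V_smult[OF xy'(2) a(1)] V_smult[OF sub(1)[OF xy'] a(1)]
        linear_opD(1)[OF lin] by (simp add: V_simps)
  next
    fix x assume "x \<in> carrier V"
    then show "\<one>\<^bsub>?R\<^esub> \<odot>\<^bsub>V\<^esub> x = x"
      using V_smult[of x "\<one>\<^bsub>free_algebra n\<^esub>"] by (simp add: hecke_class_one[OF n, symmetric] V_simps)
  qed
qed

text \<open>If f is nonzero at L, a combination of the matrix units out of L carries f to any
  prescribed vector of the module.\<close>

lemma V_simple: "simple_left_module (hecke n us Q) V"
  unfolding simple_left_module_def
proof (intro conjI allI impI)
  show "left_module (hecke n us Q) V" by (rule V_left_module)
  obtain L where L: "L \<in> std n D" using std_nonempty[OF D_diagram] by blast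
  have "delta L \<in> carrier V" using delta_shape_space[OF D_diagram L] by (simp add: V_simps)
  moreover have "delta L \<noteq> \<zero>\<^bsub>V\<^esub>" by (auto simp: delta_def V_simps fun_eq_iff)
  ultimately show "carrier V \<noteq> {\<zero>\<^bsub>V\<^esub>}" by blast
next
  fix N assume N: "submodule N (hecke n us Q) V"
  have sub: "N \<subseteq> carrier V" "\<zero>\<^bsub>V\<^esub> \<in> N"
    using subgroup.subset[OF submodule.axioms(1)[OF N]] subgroup.one_closed[OF submodule.axioms(1)[OF N]]
    by simp_all
  show "N = {\<zero>\<^bsub>V\<^esub>} \<or> N = carrier V"
  proof (cases "N = {\<zero>\<^bsub>V\<^esub>}")
    case False
    then obtain f where f: "f \<in> N" "f \<noteq> \<zero>\<^bsub>V\<^esub>" using sub(2) by blast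
    then obtain L where L: "f L \<noteq> 0" by (auto simp: V_simps fun_eq_iff)
    have fD: "f \<in> shape_space D" using f sub by (auto simp: V_simps)
    then have LD: "L \<in> std n D" using L by (auto simp: shape_space_def)
    have "g \<in> N" if g: "g \<in> shape_space D" for g
    proof -
      let ?g = "\<lambda>M. inverse (f L) * g M"
      have g': "?g \<in> shape_space D" using g by (simp add: shape_space_def)
      have cc: "comb L ?g \<in> carrier (free_algebra n)" by (rule comb_carrier[OF D_diagram LD])
      have "cls (comb L ?g) \<odot>\<^bsub>V\<^esub> f \<in> N"
        using submodule.smult_closed[OF N hecke_class_closed[OF n cc] f(1)] .
      moreover have "cls (comb L ?g) \<odot>\<^bsub>V\<^esub> f = g"
        using V_smult[OF fD cc] comb_act[OF D_diagram LD g' shape_space_W[OF D_diagram fD]] L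
        by (simp add: fun_eq_iff)
      ultimately show ?thesis by simp
    qed
    then show ?thesis using sub by (auto simp: V_simps)
  qed simp
qed

end

text \<open>The diagonal matrix unit of a tableau of the first shape fixes a nonzero vector of the
  first module and annihilates the second, where all functions vanish at this tableau.\<close>

lemma V_not_iso:
  assumes lam: "lam \<in> multipartitions r n" "content_function q us lam c"
    and mu: "mu \<in> multipartitions r n" "content_function q us mu c'"
    and iso: "left_module_iso (hecke n us Q) (H_tilde q n c lam) (H_tilde q n c' mu)"
  shows "lam = mu"
proof (rule ccontr)
  assume ne: "lam \<noteq> mu"
  let ?V = "H_tilde q n c lam" and ?V' = "H_tilde q n c' mu"
  obtain \<phi> where \<phi>: "bij_betw \<phi> (carrier ?V) (carrier ?V')"
    "\<And>x y. x \<in> carrier ?V \<Longrightarrow> y \<in> carrier ?V \<Longrightarrow> \<phi> (x \<oplus>\<^bsub>?V\<^esub> y) = \<phi> x \<oplus>\<^bsub>?V'\<^esub> \<phi> y"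
    "\<And>a x. a \<in> carrier (hecke n us Q) \<Longrightarrow> x \<in> carrier ?V \<Longrightarrow> \<phi> (a \<odot>\<^bsub>?V\<^esub> x) = a \<odot>\<^bsub>?V'\<^esub> \<phi> x"
    using iso unfolding left_module_iso_def by blast
  note D = D_diagram[OF lam] and D' = D_diagram[OF mu]
  obtain L where L: "L \<in> std n (boxes lam)" using std_nonempty[OF D] by blast
  have dL: "delta L \<in> shape_space (boxes lam)" by (rule delta_shape_space[OF D L])
  let ?e = "mat_unit L L"
  have pL: "(L, L) \<in> shape_pairs" by (rule pairs_L(1)[OF D L L])
  note e = mat_unit[OF pL]
  have z: "(\<lambda>x. 0) \<in> carrier ?V" by (simp add: V_simps[OF lam] shape_space_def)
  have "\<phi> (\<lambda>x. 0) = (\<lambda>x. \<phi> (\<lambda>x. 0) x + \<phi> (\<lambda>x. 0) x)"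
    using \<phi>(2)[OF z z] by (simp add: V_simps[OF lam] V_simps[OF mu])
  then have \<phi>0: "\<phi> (\<lambda>x. 0) = (\<lambda>x. 0)" by (simp add: fun_eq_iff)
  have \<phi>L: "\<phi> (delta L) \<in> shape_space (boxes mu)"
    using bij_betwE[OF \<phi>(1)] dL by (simp add: V_simps[OF lam] V_simps[OF mu])
  have "L \<notin> std n (boxes mu)"
  proof
    assume "L \<in> std n (boxes mu)"
    then have "boxes lam = boxes mu" using std_image L by blast
    then show False using boxes_inj[OF lam(1) mu(1)] ne by simp
  qed
  then have L0: "\<phi> (delta L) L = 0" using \<phi>L by (simp add: shape_space_def)
  have "cls ?e \<odot>\<^bsub>?V\<^esub> delta L = delta L"
    using V_smult[OF lam dL e(1)] e(2)[OF shape_space_W[OF D dL]] by (auto simp: delta_def)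
  then have "\<phi> (delta L) = cls ?e \<odot>\<^bsub>?V'\<^esub> \<phi> (delta L)"
    using \<phi>(3)[OF hecke_class_closed[OF n e(1)], of "delta L"] dL by (simp add: V_simps[OF lam])
  also have "\<dots> = (\<lambda>x. 0)"
    using V_smult[OF mu \<phi>L e(1)] e(2)[OF shape_space_W[OF D' \<phi>L]] L0 by auto
  finally have "delta L = (\<lambda>x. 0)"
    using \<phi>(1) \<phi>0 dL z unfolding bij_betw_def inj_on_def by (metis V_simps(1)[OF lam])
  then show False by (metis delta_def zero_neq_one)
qed

text \<open>The module is only an abelian group with an action of the algebra, so complex scalars
  act through the classes of \<open>scal z\<close>. The identities between matrix units applied in
  it are checked on tableaux by \<open>cls_eqI\<close>.\<close>

lemma simple_module_classified:
  fixes M :: "((nat list \<Rightarrow> complex) set, 'm) module"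
  assumes simple: "simple_left_module (hecke n us Q) M"
    and c: "\<And>lam. lam \<in> multipartitions r n \<Longrightarrow> content_function q us lam (c lam)"
  shows "\<exists>lam\<in>multipartitions r n. left_module_iso (hecke n us Q) M (H_tilde q n (c lam) lam)"
proof -
  let ?R = "hecke n us Q" and ?A = "free_algebra n"
  interpret A: ring ?A by (rule ring_free_algebra)
  interpret M: left_module ?R M using simple by (simp add: simple_left_module_def)
  note clsC = hecke_class_closed[OF n]
  have mult: "cls a \<odot>\<^bsub>M\<^esub> (cls b \<odot>\<^bsub>M\<^esub> x) = cls (a \<otimes>\<^bsub>?A\<^esub> b) \<odot>\<^bsub>M\<^esub> x"
    if "a \<in> carrier ?A" "b \<in> carrier ?A" "x \<in> carrier M" for a b x
    using M.smult_assoc1[OF clsC[OF that(1)] clsC[OF that(2)] that(3)] hecke_class_mult[OF n that(1,2)] by simp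
  have add: "cls (a \<oplus>\<^bsub>?A\<^esub> b) \<odot>\<^bsub>M\<^esub> x = cls a \<odot>\<^bsub>M\<^esub> x \<oplus>\<^bsub>M\<^esub> cls b \<odot>\<^bsub>M\<^esub> x"
    if "a \<in> carrier ?A" "b \<in> carrier ?A" "x \<in> carrier M" for a b x
    using M.smult_l_distr[OF clsC[OF that(1)] clsC[OF that(2)] that(3)] hecke_class_add[OF n that(1,2)] by simp
  have zero: "cls (\<lambda>w. 0) \<odot>\<^bsub>M\<^esub> x = \<zero>\<^bsub>M\<^esub>" if "x \<in> carrier M" for x
    using M.smult_l_null[OF that] hecke_class_zero[OF n, of us Q] by (simp add: free_zero)
  have one: "cls \<one>\<^bsub>?A\<^esub> \<odot>\<^bsub>M\<^esub> x = x" if "x \<in> carrier M" for x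
    using M.smult_one[OF that] hecke_class_one[OF n, of us Q] by simp
  have "carrier M \<noteq> {\<zero>\<^bsub>M\<^esub>}" using simple by (simp add: simple_left_module_def)
  then obtain m0 where m0: "m0 \<in> carrier M" "m0 \<noteq> \<zero>\<^bsub>M\<^esub>" using M.zero_closed by blast
  have unit: "mat_unit L L \<in> carrier ?A" "\<And>f. f \<in> W \<Longrightarrow> word_act sop (mat_unit L L) f = (\<lambda>N. if N = L then f L else 0)"
    if "L \<in> STD" for L
    using mat_unit[of L L] that by (auto simp: shape_pairs_def)
  \<comment> \<open>In the Hecke algebra the diagonal matrix units add up to 1, so one of them does
    not annihilate \<open>m0\<close>.\<close>
  define u where "u = (\<lambda>w. \<Sum>L\<in>STD. mat_unit L L w)"
  have uA: "u \<in> carrier ?A" unfolding u_def by (intro free_sum_carrier unit(1))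
  have "cls u = cls \<one>\<^bsub>?A\<^esub>"
  proof (rule cls_eqI[OF uA A.one_closed])
    fix f assume f: "f \<in> W"
    have "word_act sop u f N = f N" for N
    proof -
      have "word_act sop u f N = (\<Sum>L\<in>STD. word_act sop (mat_unit L L) f N)"
        unfolding u_def using word_act_sum[of STD "\<lambda>L. mat_unit L L" n sop f] unit(1) by simp
      also have "\<dots> = (\<Sum>L\<in>STD. if L = N then f N else 0)"
        using unit(2)[OF _ f] by (intro sum.cong refl) auto
      also have "\<dots> = f N" using STD_finite f by (simp add: W_def)
      finally show ?thesis .
    qed
    then show "word_act sop u f = word_act sop \<one>\<^bsub>?A\<^esub> f" by (simp add: fun_eq_iff)
  qed
  then have u1: "cls u \<odot>\<^bsub>M\<^esub> m0 = m0" using one[OF m0(1)] by simp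
  have "\<exists>L\<in>STD. cls (mat_unit L L) \<odot>\<^bsub>M\<^esub> m0 \<noteq> \<zero>\<^bsub>M\<^esub>"
  proof (rule ccontr)
    assume no: "\<not> ?thesis"
    have "cls (\<lambda>w. \<Sum>L\<in>X. mat_unit L L w) \<odot>\<^bsub>M\<^esub> m0 = \<zero>\<^bsub>M\<^esub>" if "X \<subseteq> STD" for X
      using finite_subset[OF that STD_finite] that
    proof (induction X)
      case empty
      then show ?case using zero[OF m0(1)] by simp
    next
      case (insert L X)
      have sX: "(\<lambda>w. \<Sum>L\<in>X. mat_unit L L w) \<in> carrier ?A"
        using insert.prems by (intro free_sum_carrier unit(1)) auto
      have "(\<lambda>w. \<Sum>L\<in>insert L X. mat_unit L L w) = mat_unit L L \<oplus>\<^bsub>?A\<^esub> (\<lambda>w. \<Sum>L\<in>X. mat_unit L L w)"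
        using insert.hyps by (simp add: free_add)
      then show ?case
        using insert.IH insert.prems add[OF unit(1) sX m0(1), of L] no by simp
    qed
    then show False using u1 m0(2) by (simp add: u_def)
  qed
  then obtain L where L: "L \<in> STD" "cls (mat_unit L L) \<odot>\<^bsub>M\<^esub> m0 \<noteq> \<zero>\<^bsub>M\<^esub>" by blast
  define m1 where "m1 = cls (mat_unit L L) \<odot>\<^bsub>M\<^esub> m0"
  have m1: "m1 \<in> carrier M" "m1 \<noteq> \<zero>\<^bsub>M\<^esub>"
    using M.smult_closed[OF clsC[OF unit(1)[OF L(1)]] m0(1)] L(2) by (simp_all add: m1_def)
  have e1: "cls (mat_unit L L) \<odot>\<^bsub>M\<^esub> m1 = m1"
  proof -
    have "cls (mat_unit L L \<otimes>\<^bsub>?A\<^esub> mat_unit L L) = cls (mat_unit L L)"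
    proof (rule cls_eqI)
      fix f assume f: "f \<in> W"
      show "word_act sop (mat_unit L L \<otimes>\<^bsub>?A\<^esub> mat_unit L L) f = word_act sop (mat_unit L L) f"
        unfolding word_act_mult[OF linear_op_sop unit(1)[OF L(1)] unit(1)[OF L(1)]]
          unit(2)[OF L(1) word_act_W[OF unit(1)[OF L(1)] f]]
        using unit(2)[OF L(1) f] by (auto simp: fun_eq_iff)
    qed (use unit(1)[OF L(1)] in simp_all)
    then show ?thesis
      using mult[OF unit(1)[OF L(1)] unit(1)[OF L(1)] m0(1)] by (simp add: m1_def)
  qed
  obtain lam where lam: "lam \<in> multipartitions r n" "boxes lam = L ` {1..n}"
    using boxes_surj[OF STD_std(1)[OF L(1)]] by blast
  let ?V = "H_tilde q n (c lam) lam"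
  note lc = lam(1) c[OF lam(1)]
  let ?D = "boxes lam"
  have D: "?D \<in> diagrams r n" by (rule D_diagram[OF lc])
  have LD: "L \<in> std n ?D" using STD_std(2)[OF L(1)] lam(2) by simp
  note V = V_simps[OF lc]
  have cA: "comb L f \<in> carrier ?A" for f by (rule comb_carrier[OF D LD])
  interpret V: left_module ?R ?V by (rule V_left_module[OF lc])
  \<comment> \<open>Since \<open>m1\<close> is fixed by the diagonal unit at L, the submodule it
    generates is the image of the column of matrix units out of L.\<close>
  define \<psi> where "\<psi> f = cls (comb L f) \<odot>\<^bsub>M\<^esub> m1" for f
  have \<psi>M: "\<psi> f \<in> carrier M" for f
    unfolding \<psi>_def using clsC[OF cA] m1(1) by (rule M.smult_closed)
  have \<psi>add: "\<psi> (f \<oplus>\<^bsub>?V\<^esub> g) = \<psi> f \<oplus>\<^bsub>M\<^esub> \<psi> g" for f g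
  proof -
    have "comb L (f \<oplus>\<^bsub>?V\<^esub> g) = comb L f \<oplus>\<^bsub>?A\<^esub> comb L g"
      by (simp add: comb_def V free_add distrib_right sum.distrib)
    then show ?thesis unfolding \<psi>_def using add[OF cA cA m1(1)] by simp
  qed
  have \<psi>smult: "\<psi> (X \<odot>\<^bsub>?V\<^esub> f) = X \<odot>\<^bsub>M\<^esub> \<psi> f" if X: "X \<in> carrier ?R" and f: "f \<in> carrier ?V" for X f
  proof -
    obtain a where a: "a \<in> carrier ?A" "X = cls a" using X by (auto simp: hecke_carrier[OF n])
    have fD: "f \<in> shape_space ?D" using f by (simp add: V)
    have afD: "word_act sop a f \<in> shape_space ?D" by (rule word_act_shape[OF lc fD a(1)])
    have "cls (a \<otimes>\<^bsub>?A\<^esub> comb L f) = cls (comb L (word_act sop a f))"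
    proof (rule cls_eqI)
      fix g assume g: "g \<in> W"
      have "word_act sop a (\<lambda>x. g L * f x) = (\<lambda>x. g L * word_act sop a f x)"
        by (rule linear_opD(2)[OF linear_op_word_act[OF linear_op_sop]])
      then show "word_act sop (a \<otimes>\<^bsub>?A\<^esub> comb L f) g = word_act sop (comb L (word_act sop a f)) g"
        by (simp add: word_act_mult[OF linear_op_sop a(1) cA] comb_act[OF D LD fD g] comb_act[OF D LD afD g])
    qed (use a(1) cA in simp_all)
    then show ?thesis
      unfolding \<psi>_def a(2) V_smult[OF lc fD a(1)] mult[OF a(1) cA m1(1)] by simp
  qed
  \<comment> \<open>The matrix unit from N back to L recovers the coefficient of f at N as a
    multiple of \<open>m1\<close>; this gives injectivity.\<close>
  have \<psi>coeff: "cls (mat_unit N L) \<odot>\<^bsub>M\<^esub> \<psi> f = cls (scal (f N)) \<odot>\<^bsub>M\<^esub> m1"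
    if f: "f \<in> carrier ?V" and N: "N \<in> std n ?D" for f N
  proof -
    have fD: "f \<in> shape_space ?D" using f by (simp add: V)
    note NL = mat_unit[OF pairs_L(2)[OF D LD N]]
    note uL = unit[OF L(1)]
    have "cls (mat_unit N L \<otimes>\<^bsub>?A\<^esub> comb L f) = cls (scal (f N) \<otimes>\<^bsub>?A\<^esub> mat_unit L L)"
    proof (rule cls_eqI)
      fix g assume g: "g \<in> W"
      have "(\<lambda>N. g L * f N) \<in> W"
        using shape_space_W[OF D fD] by (simp add: W_def)
      then show "word_act sop (mat_unit N L \<otimes>\<^bsub>?A\<^esub> comb L f) g = word_act sop (scal (f N) \<otimes>\<^bsub>?A\<^esub> mat_unit L L) g"
        using NL(2) uL(2)[OF g]
        by (simp add: word_act_mult[OF linear_op_sop NL(1) cA] comb_act[OF D LD fD g] free_scal_mult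
            word_act_scale fun_eq_iff)
    qed (use NL(1) uL(1) cA scal_carrier in simp_all)
    then show ?thesis
      unfolding \<psi>_def mult[OF NL(1) cA m1(1)]
      using mult[OF scal_carrier uL(1) m1(1), of "f N"] e1 by simp
  qed
  have inj: "inj_on \<psi> (carrier ?V)"
  proof (rule inj_onI)
    fix f g assume f: "f \<in> carrier ?V" and g: "g \<in> carrier ?V" and eq: "\<psi> f = \<psi> g"
    show "f = g"
    proof (rule ccontr)
      assume "f \<noteq> g"
      then obtain N where N: "f N \<noteq> g N" by (auto simp: fun_eq_iff)
      then have ND: "N \<in> std n ?D" using f g unfolding V shape_space_def by force
      let ?z = "f N - g N"
      have "scal (f N) = scal ?z \<oplus>\<^bsub>?A\<^esub> scal (g N)" by (auto simp: free_add scal_def)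
      then have "cls (scal ?z) \<odot>\<^bsub>M\<^esub> m1 \<oplus>\<^bsub>M\<^esub> cls (scal (g N)) \<odot>\<^bsub>M\<^esub> m1 = cls (scal (g N)) \<odot>\<^bsub>M\<^esub> m1"
        using \<psi>coeff[OF f ND] \<psi>coeff[OF g ND] eq add[OF scal_carrier scal_carrier m1(1), of ?z "g N"] by simp
      then have x0: "cls (scal ?z) \<odot>\<^bsub>M\<^esub> m1 = \<zero>\<^bsub>M\<^esub>"
        using M.smult_closed[OF clsC[OF scal_carrier] m1(1)] M.add.r_cancel_one by metis
      have "scal (inverse ?z) \<otimes>\<^bsub>?A\<^esub> scal ?z = \<one>\<^bsub>?A\<^esub>"
        unfolding free_scal_mult free_one_eq_scal using N by (auto simp: scal_def)
      then have "m1 = cls (scal (inverse ?z)) \<odot>\<^bsub>M\<^esub> \<zero>\<^bsub>M\<^esub>"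
        using mult[OF scal_carrier scal_carrier m1(1), of "inverse ?z" ?z] x0 one[OF m1(1)] by simp
      then show False using M.smult_r_null[OF clsC[OF scal_carrier]] m1(2) by metis
    qed
  qed
  have \<psi>0: "\<psi> \<zero>\<^bsub>?V\<^esub> = \<zero>\<^bsub>M\<^esub>"
    unfolding \<psi>_def using zero[OF m1(1)] by (simp add: comb_def V)
  have sub: "submodule (\<psi> ` carrier ?V) ?R M"
  proof (intro submodule.intro submodule_axioms.intro)
    show "subgroup (\<psi> ` carrier ?V) (add_monoid M)"
    proof
      show "\<psi> ` carrier ?V \<subseteq> carrier (add_monoid M)" using \<psi>M by auto
      show "\<one>\<^bsub>add_monoid M\<^esub> \<in> \<psi> ` carrier ?V"
        using imageI[OF V.zero_closed, of \<psi>] unfolding \<psi>0 by simp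
    next
      fix x y assume "x \<in> \<psi> ` carrier ?V" "y \<in> \<psi> ` carrier ?V"
      then obtain f g where fg: "x = \<psi> f" "y = \<psi> g" "f \<in> carrier ?V" "g \<in> carrier ?V" by blast
      then show "x \<otimes>\<^bsub>add_monoid M\<^esub> y \<in> \<psi> ` carrier ?V"
        using imageI[OF V.a_closed[OF fg(3,4)], of \<psi>] unfolding \<psi>add by simp
    next
      fix x assume "x \<in> \<psi> ` carrier ?V"
      then obtain f where f: "x = \<psi> f" "f \<in> carrier ?V" by blast
      have "\<psi> (\<ominus>\<^bsub>?V\<^esub> f) \<oplus>\<^bsub>M\<^esub> x = \<zero>\<^bsub>M\<^esub>"
        using \<psi>add[of "\<ominus>\<^bsub>?V\<^esub> f" f] \<psi>0 V.l_neg[OF f(2)] f(1) by simp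
      then have "\<ominus>\<^bsub>M\<^esub> x = \<psi> (\<ominus>\<^bsub>?V\<^esub> f)" using \<psi>M f(1) by (intro M.minus_equality) auto
      then show "inv\<^bsub>add_monoid M\<^esub> x \<in> \<psi> ` carrier ?V"
        using V.a_inv_closed[OF f(2)] by (simp add: a_inv_def[symmetric])
    qed
    fix X x assume X: "X \<in> carrier ?R" and "x \<in> \<psi> ` carrier ?V"
    then obtain f where "x = \<psi> f" "f \<in> carrier ?V" by blast
    then show "X \<odot>\<^bsub>M\<^esub> x \<in> \<psi> ` carrier ?V"
      using \<psi>smult[OF X, of f] V.smult_closed[OF X, of f] by (metis imageI)
  qed
  have surj: "\<psi> ` carrier ?V = carrier M"
  proof -
    have "\<psi> ` carrier ?V \<noteq> {\<zero>\<^bsub>M\<^esub>}"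
    proof
      assume a: "\<psi> ` carrier ?V = {\<zero>\<^bsub>M\<^esub>}"
      have dV: "delta L \<in> carrier ?V" using delta_shape_space[OF D LD] by (simp add: V)
      have "\<psi> (delta L) = \<psi> \<zero>\<^bsub>?V\<^esub>"
        unfolding \<psi>0 using imageI[OF dV, of \<psi>] unfolding a by simp
      then have "delta L = \<zero>\<^bsub>?V\<^esub>" using inj dV V.zero_closed unfolding inj_on_def by blast
      then show False by (metis V(2) delta_def zero_neq_one)
    qed
    then show ?thesis using simple sub by (auto simp: simple_left_module_def)
  qed
  have "left_module_iso ?R M ?V"
    by (rule left_module_iso_inverse[where \<psi> = \<psi>])
       (use inj surj \<psi>add \<psi>smult V.a_closed V.smult_closed in \<open>auto simp: bij_betw_def\<close>)
  then show ?thesis using lam(1) by blast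
qed

end

theorem theorem3p18:
  fixes q :: real and r n :: nat and us :: "complex list"
    and c :: "nat list list \<Rightarrow> diagram_box \<Rightarrow> complex"
  assumes "q > 0" and "q \<noteq> 1" and "r > 0" and "n > 0"
    and "length us = r" and "0 \<notin> set us"
    and "semisimple_ring (hecke n us (complex_of_real q))"
    and "\<And>lam. lam \<in> multipartitions r n \<Longrightarrow> content_function q us lam (c lam)"
  shows
    \<comment> \<open>the modules are well defined: no denominator vanishes, and the formulas for the
      generators induce an action of the Hecke algebra\<close>
    "(\<forall>lam\<in>multipartitions r n.
        (\<forall>L\<in>standard_tableaux n lam. \<forall>i\<in>{2..n}.
           q2pow q (c lam (L (i - 1)) - c lam (L i)) \<noteq> 1) \<and>
        (\<forall>a\<in>carrier (free_algebra n). \<forall>f\<in>carrier (H_tilde q n (c lam) lam).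
           hecke_class n us (complex_of_real q) a \<odot>\<^bsub>H_tilde q n (c lam) lam\<^esub> f
             = free_act q n (c lam) lam a f))
     \<and> (\<forall>lam\<in>multipartitions r n.
          simple_left_module (hecke n us (complex_of_real q)) (H_tilde q n (c lam) lam))
     \<and> (\<forall>lam\<in>multipartitions r n. \<forall>mu\<in>multipartitions r n.
          left_module_iso (hecke n us (complex_of_real q))
            (H_tilde q n (c lam) lam) (H_tilde q n (c mu) mu) \<longrightarrow> lam = mu)
     \<and> (\<forall>M :: ((nat list \<Rightarrow> complex) set, 'm) module.
          simple_left_module (hecke n us (complex_of_real q)) M \<longrightarrow>
          (\<exists>lam\<in>multipartitions r n.
             left_module_iso (hecke n us (complex_of_real q)) M (H_tilde q n (c lam) lam)))"
proof -
  have n: "n \<ge> 1" using assms(4) by simp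
  interpret separated_parameters q n r us
  proof
    fix i j k assume ij: "i < r" "j < r" "i \<noteq> j" "k < n"
    have "us ! i \<noteq> 0" using assms(5,6) ij(1) nth_mem by metis
    then show "us ! j \<noteq> us ! i * complex_of_real q ^ (2 * k)"
      using semisimple_parameters[OF n _ assms(7), of i j k] assms(1,5) ij by simp
  qed (use assms n in auto)
  note c = assms(8)
  show ?thesis
    using no_denominator_vanishes[OF _ c] V_action[OF _ c] V_simple[OF _ c] V_not_iso[OF _ c _ c]
      simple_module_classified[OF _ c]
    by blast
qed

end
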